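(* Let $X$ be a Banach space, $\alpha\in\mathbb{R}$ with $\alpha\ne0$, $\beta\ge 0$, $0<\mu<\widetilde\mu\le 1$ and $\omega<0$, and assume $\beta+\omega\le 0$. Let $A$ be a closed, densely defined linear operator on $X$ and let $(S_{\alpha,\beta}^\mu(t))_{t\ge0}$ denote the $(\alpha,\beta,\mu)$-resolvent family generated by $A$. (a) If $\alpha>0$ and $A$ is $\omega$-sectorial of angle $\widetilde\mu\frac{\pi}{2}$, then there exists $C>0$ such that $\|S_{\alpha,\beta}^\mu(t)\|\le Ce^{-\beta t}$ for all $t\ge0$. (b) If $\alpha<0$, $\alpha+\beta^\mu\ge|\alpha|$, and $A$ is $\omega$-sectorial of angle $\widetilde\mu\frac{\pi}{2}$, then there exists $C>0$ such that $$\|S_{\alpha,\beta}^\mu(t)\|\le C\left(1+\alpha\omega t^{\mu+1}\right)e^{-\left(\beta-(\alpha\omega)^{\frac{1}{\mu+1}}\right)t}\quad\text{for all } t\ge 0.$$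
   Context: Kernel: $\kappa(t)=\alpha e^{-\beta t}\frac{t^{\mu-1}}{\Gamma(\mu)}$, $t>0$, and $(1\ast\kappa)(t)=\int_0^t\kappa(s)\,ds$. An $(\alpha,\beta,\mu)$-resolvent family generated by $A$ is a family $(S_{\alpha,\beta}^\mu(t))_{t\ge0}$ of bounded linear operators on $X$ such that: $S_{\alpha,\beta}^\mu(0)=I$ and $t\mapsto S_{\alpha,\beta}^\mu(t)$ is strongly continuous on $[0,\infty)$; $S_{\alpha,\beta}^\mu(t)D(A)\subset D(A)$ and $S_{\alpha,\beta}^\mu(t)Ax=AS_{\alpha,\beta}^\mu(t)x$ for $x\in D(A)$, $t\ge0$; and for all $x\in D(A)$, $t\ge 0$, $S_{\alpha,\beta}^\mu(t)x=x+\int_0^t(1+1\ast\kappa)(t-s)AS_{\alpha,\beta}^\mu(s)x\,ds$. For $\omega\in\mathbb{R}$ and an angle $\theta$, $A$ is $\omega$-sectorial of angle $\theta$ if $\omega+\Sigma_\theta:=\{\omega+\lambda:\lambda\in\mathbb{C},\ |\arg\lambda|<\theta+\frac{\pi}{2}\}\subset\rho(A)$ and there is $M>0$ with $\|(\lambda-A)^{-1}\|\le M/|\lambda-\omega|$ for all $\lambda\in(\omega+\Sigma_\theta)\setminus\{\omega\}$. *)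

theory Defs
  imports "HOL-Analysis.Analysis"
begin

class complex_banach = banach +
  fixes scaleC :: "complex \<Rightarrow> 'a \<Rightarrow> 'a"
  assumes scaleC_add_right: "scaleC c (x + y) = scaleC c x + scaleC c y"
    and scaleC_add_left: "scaleC (c + d) x = scaleC c x + scaleC d x"
    and scaleC_scaleC: "scaleC c (scaleC d x) = scaleC (c * d) x"
    and scaleC_one: "scaleC 1 x = x"
    and scaleC_of_real: "scaleC (complex_of_real r) x = r *\<^sub>R x"
    and norm_scaleC: "norm (scaleC c x) = cmod c * norm x"

definition cbl :: "('a::complex_banach \<Rightarrow> 'a) \<Rightarrow> bool" where
  "cbl T \<longleftrightarrow> bounded_linear T \<and> (\<forall>c x. T (scaleC c x) = scaleC c (T x))"

definition linear_operator :: "'a::complex_banach set \<Rightarrow> ('a \<Rightarrow> 'a) \<Rightarrow> bool" where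
  "linear_operator D A \<longleftrightarrow>
     0 \<in> D \<and> (\<forall>x\<in>D. \<forall>y\<in>D. x + y \<in> D) \<and> (\<forall>c. \<forall>x\<in>D. scaleC c x \<in> D) \<and>
     (\<forall>x\<in>D. \<forall>y\<in>D. A (x + y) = A x + A y) \<and> (\<forall>c. \<forall>x\<in>D. A (scaleC c x) = scaleC c (A x))"

definition closed_operator :: "'a::complex_banach set \<Rightarrow> ('a \<Rightarrow> 'a) \<Rightarrow> bool" where
  "closed_operator D A \<longleftrightarrow> linear_operator D A \<and> closed {(x, A x) | x. x \<in> D}"

definition densely_defined :: "'a::complex_banach set \<Rightarrow> bool" where
  "densely_defined D \<longleftrightarrow> closure D = UNIV"

definition resolvent :: "'a::complex_banach set \<Rightarrow> ('a \<Rightarrow> 'a) \<Rightarrow> complex \<Rightarrow> 'a \<Rightarrow> 'a" where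
  "resolvent D A l = inv_into D (\<lambda>x. scaleC l x - A x)"

definition resolvent_set :: "'a::complex_banach set \<Rightarrow> ('a \<Rightarrow> 'a) \<Rightarrow> complex set" where
  "resolvent_set D A = {l. bij_betw (\<lambda>x. scaleC l x - A x) D UNIV \<and> cbl (resolvent D A l)}"

text \<open>The shifted sector \<omega> + \<Sigma>_\<theta> (0 excluded from \<Sigma>_\<theta>, where arg is undefined).\<close>
definition shifted_sector :: "real \<Rightarrow> real \<Rightarrow> complex set" where
  "shifted_sector \<omega> \<theta> = {complex_of_real \<omega> + z | z. z \<noteq> 0 \<and> \<bar>Arg z\<bar> < \<theta> + pi / 2}"

definition omega_sectorial :: "'a::complex_banach set \<Rightarrow> ('a \<Rightarrow> 'a) \<Rightarrow> real \<Rightarrow> real \<Rightarrow> bool" where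
  "omega_sectorial D A \<omega> \<theta> \<longleftrightarrow>
     shifted_sector \<omega> \<theta> \<subseteq> resolvent_set D A \<and>
     (\<exists>M>0. \<forall>l\<in>shifted_sector \<omega> \<theta> - {complex_of_real \<omega>}.
        onorm (resolvent D A l) \<le> M / cmod (l - complex_of_real \<omega>))"

definition kappa :: "real \<Rightarrow> real \<Rightarrow> real \<Rightarrow> real \<Rightarrow> real" where
  "kappa \<alpha> \<beta> \<mu> t = \<alpha> * exp (- \<beta> * t) * t powr (\<mu> - 1) / Gamma \<mu>"

definition one_conv_kappa :: "real \<Rightarrow> real \<Rightarrow> real \<Rightarrow> real \<Rightarrow> real" where
  "one_conv_kappa \<alpha> \<beta> \<mu> t = integral {0..t} (kappa \<alpha> \<beta> \<mu>)"

definition resolvent_family ::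
  "real \<Rightarrow> real \<Rightarrow> real \<Rightarrow> 'a::complex_banach set \<Rightarrow> ('a \<Rightarrow> 'a) \<Rightarrow> (real \<Rightarrow> 'a \<Rightarrow> 'a) \<Rightarrow> bool" where
  "resolvent_family \<alpha> \<beta> \<mu> D A S \<longleftrightarrow>
     (\<forall>t\<ge>0. cbl (S t)) \<and>
     S 0 = id \<and>
     (\<forall>x. continuous_on {0..} (\<lambda>t. S t x)) \<and>
     (\<forall>t\<ge>0. \<forall>x\<in>D. S t x \<in> D \<and> S t (A x) = A (S t x)) \<and>
     (\<forall>t\<ge>0. \<forall>x\<in>D.
        ((\<lambda>s. (1 + one_conv_kappa \<alpha> \<beta> \<mu> (t - s)) *\<^sub>R A (S s x)) has_integral (S t x - x)) {0..t})"

end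

theory Submission
  imports Defs "HOL-Complex_Analysis.Complex_Analysis"
begin

text \<open>
  For \<open>x \<in> D\<close> and a bounded complex-linear functional \<open>\<phi>\<close>, the Laplace transform of
  \<open>f t = \<phi> (S t x)\<close> should be \<open>h \<lambda> = z\<^sup>\<mu> / (z\<^sup>\<mu> + \<alpha>) * \<phi> (R (g \<lambda>) x)\<close> with \<open>z = \<lambda> + \<beta>\<close>, \<open>R\<close> the
  resolvent of \<open>A\<close> and \<open>g \<lambda> = \<lambda> z\<^sup>\<mu> / (z\<^sup>\<mu> + \<alpha>)\<close>. Here
  \<open>g \<lambda> - \<omega> = (z\<^sup>\<mu>\<^sup>+\<^sup>1 - (\<beta> + \<omega>) z\<^sup>\<mu> - \<omega> \<alpha>) / (z\<^sup>\<mu> + \<alpha>)\<close>. Put \<open>r = 0\<close> in case (a) and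
  \<open>r = (\<alpha> \<omega>) powr (1 / (\<mu> + 1))\<close> in case (b). On a sector with vertex \<open>z = r\<close> and half-angle slightly
  larger than \<open>\<pi>/2\<close>, the value \<open>g \<lambda>\<close> stays in the sector where \<open>R\<close> is controlled, and
  \<open>\<bar>h \<lambda>\<bar> \<le> C \<parallel>x\<parallel> / \<bar>z - r\<bar>\<close>; deforming a contour into this sector gives
  \<open>\<bar>f t\<bar> \<le> C' \<parallel>x\<parallel> exp ((r - \<beta>) t)\<close>, which is stronger than the claim in (b).

  The family \<open>S\<close> is not assumed to be exponentially bounded, so \<open>f\<close> need not a priori have a Laplace
  transform. The Volterra equation does show that the transform of \<open>f\<close> truncated to \<open>[0, \<tau>]\<close> differs
  from \<open>h\<close> by \<open>O (exp (- \<tau> Re \<lambda>))\<close>, and this error disappears in Post's inversion formula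
  \<open>f t = lim (-1)\<^sup>n / n! (n/t)\<^sup>n\<^sup>+\<^sup>1 h\<^sup>(\<^sup>n\<^sup>) (n/t)\<close> once \<open>\<tau>\<close> is a large multiple of \<open>t\<close>.
  The Hahn-Banach theorem reduces the vector-valued estimate to these scalar ones.
\<close>

section \<open>Norming functionals\<close>

text \<open>The symbol estimates work because nothing cancels. With
  \<open>r powr (\<mu> + 1) = \<alpha> * \<omega>\<close> the numerator of
  \<open>g - \<omega>\<close> is the increment of \<open>z powr (\<mu> + 1)\<close> from the vertex
  \<open>r\<close> plus a nonnegative multiple of \<open>z powr \<mu>\<close>, as
  \<open>\<beta> + \<omega> \<le> 0\<close>; with \<open>r = 0\<close> a constant
  \<open>- \<omega> * \<alpha> > 0\<close> is added. The denominator is the increment of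
  \<open>z powr \<mu>\<close> plus \<open>r powr \<mu> + \<alpha>\<close>, positive in case (b)
  because \<open>\<beta> powr \<mu> \<ge> 2 * \<bar>\<alpha>\<bar>\<close> and
  \<open>\<beta> \<le> - \<omega>\<close>. Above the real axis the summands of the numerator have
  arguments between 0 and \<open>(\<mu> + 1) * \<theta>\<close>, those of the denominator between 0
  and \<open>\<theta>\<close>, so the argument of the quotient never exceeds
  \<open>(\<mu> + 1) * \<theta>\<close> in modulus. The gap between \<open>\<mu>\<close> and
  \<open>\<mu>'\<close> leaves room for \<open>\<theta> > pi / 2\<close>. Post's formula fits
  because it evaluates the transform only near real points that tend to infinity while the
  truncation is fixed. On a fixed vertical line the truncation error need not become small.\<close>

definition sublinear :: "('a::real_vector \<Rightarrow> real) \<Rightarrow> bool" where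
  "sublinear q \<longleftrightarrow> (\<forall>x y. q (x + y) \<le> q x + q y) \<and> (\<forall>x. \<forall>c\<ge>0. q (c *\<^sub>R x) = c * q x)"

text \<open>At \<open>x = - y\<close> the last property gives \<open>q' (- y) \<le> - q y\<close>,
  so every linear functional below \<open>q'\<close> is at least \<open>q y\<close> at
  \<open>y\<close>. Applied to a minimal \<open>q\<close> the lemma forces additivity, applied to
  the norm it forces the norm to be attained.\<close>

lemma sublinear_minorant:
  fixes q :: "'a::real_vector \<Rightarrow> real"
  assumes q: "sublinear q"
  obtains q' where "sublinear q'" "q' \<le> q" "\<And>x. q' x \<le> q (x + y) - q y"
proof -
  have sub: "q (u + v) \<le> q u + q v" for u v using q by (simp add: sublinear_def)
  have hom: "c \<ge> 0 \<Longrightarrow> q (c *\<^sub>R u) = c * q u" for c u using q by (simp add: sublinear_def)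
  have q0: "q 0 = 0" using hom[of 0 0] by simp
  \<comment> \<open>The parameter \<open>t = 0\<close> gives \<open>m \<le> q\<close> and
    \<open>t = 1\<close> the required inequality. The whole half-line is used because it is closed
    under sums and positive scaling, which gives subadditivity and homogeneity.\<close>
  define m where "m x = (INF t\<in>{0..}. q (x + t *\<^sub>R y) - t * q y)" for x
  have lb: "- q (- x) \<le> q (x + t *\<^sub>R y) - t * q y" if "t \<ge> 0" for x t
    using sub[of "x + t *\<^sub>R y" "- x"] hom[OF that, of y] by simp
  have bdd: "bdd_below ((\<lambda>t. q (x + t *\<^sub>R y) - t * q y) ` {0..})" for x
    by (rule bdd_belowI2[of _ "- q (- x)"]) (use lb in auto)
  have le: "m x \<le> q (x + t *\<^sub>R y) - t * q y" if "t \<ge> 0" for x t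
    unfolding m_def by (rule cINF_lower[OF bdd]) (use that in auto)
  have ge: "c \<le> m x" if "\<And>t. t \<ge> 0 \<Longrightarrow> c \<le> q (x + t *\<^sub>R y) - t * q y" for c x
    unfolding m_def by (rule cINF_greatest) (use that in auto)
  have "m (u + v) \<le> m u + m v" for u v
  proof -
    have "m (u + v) \<le> (q (u + s *\<^sub>R y) - s * q y) + (q (v + t *\<^sub>R y) - t * q y)"
      if "s \<ge> 0" "t \<ge> 0" for s t
    proof -
      have "m (u + v) \<le> q ((u + v) + (s + t) *\<^sub>R y) - (s + t) * q y"
        by (rule le) (use that in auto)
      also have "(u + v) + (s + t) *\<^sub>R y = (u + s *\<^sub>R y) + (v + t *\<^sub>R y)"
        by (simp add: scaleR_add_left)
      finally show ?thesis using sub[of "u + s *\<^sub>R y" "v + t *\<^sub>R y"] by (simp add: algebra_simps)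
    qed
    hence "m (u + v) - (q (u + s *\<^sub>R y) - s * q y) \<le> m v" if "s \<ge> 0" for s
      by (intro ge) (use that in \<open>force simp: algebra_simps\<close>)
    hence "m (u + v) - m v \<le> m u"
      by (intro ge) (force simp: algebra_simps)
    thus ?thesis by simp
  qed
  moreover have "m (c *\<^sub>R u) = c * m u" if c: "c \<ge> 0" for c u
  proof (cases "c = 0")
    case True
    have "m 0 = 0"
    proof (rule antisym)
      show "m 0 \<le> 0" using le[of 0 0] q0 by simp
      show "0 \<le> m 0" using lb[of _ 0] by (intro ge) (simp add: q0)
    qed
    thus ?thesis using True by simp
  next
    case False
    with c have c: "c > 0" by simp
    have *: "d * m u \<le> m (d *\<^sub>R u)" if "d > 0" for d u
    proof (rule ge)
      fix t :: real assume t: "t \<ge> 0"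
      have "m u \<le> q (u + (t/d) *\<^sub>R y) - (t/d) * q y"
        by (rule le) (use t that in auto)
      hence "d * m u \<le> d * q (u + (t/d) *\<^sub>R y) - t * q y"
        using that by (simp add: field_simps)
      also have "d * q (u + (t/d) *\<^sub>R y) = q (d *\<^sub>R u + t *\<^sub>R y)"
        using hom[of d "u + (t/d) *\<^sub>R y"] that by (simp add: scaleR_add_right)
      finally show "d * m u \<le> q (d *\<^sub>R u + t *\<^sub>R y) - t * q y" .
    qed
    show ?thesis using *[OF c, of u] *[of "1/c" "c *\<^sub>R u"] c by (simp add: field_simps)
  qed
  moreover have "m \<le> q" using le[of 0] by (simp add: le_fun_def)
  moreover have "m x \<le> q (x + y) - q y" for x using le[of 1] by simp
  ultimately show thesis by (intro that) (auto simp: sublinear_def)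
qed

text \<open>A minimal sublinear functional \<open>q\<close> below \<open>p\<close> is linear:
  \<open>sublinear_minorant\<close> produces a \<open>q'\<close> below it, minimality gives
  \<open>q' = q\<close>, and the inequality for \<open>q'\<close> becomes superadditivity of
  \<open>q\<close>.\<close>

lemma sublinear_dominates_linear:
  fixes p :: "'a::real_vector \<Rightarrow> real"
  assumes p: "sublinear p"
  obtains f where "linear f" "\<And>x. f x \<le> p x"
proof -
  \<comment> \<open>The order is reversed: \<open>(q, q')\<close> means that \<open>q'\<close> lies
    below \<open>q\<close>. Upper bounds of chains are thus pointwise infima, and a maximal element
    is a minimal functional.\<close>
  define r where "r = {(q, q'). sublinear q \<and> sublinear q' \<and> q' \<le> q \<and> q \<le> p}"
  have fld: "Field r = {q. sublinear q \<and> q \<le> p}"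
    unfolding r_def Field_def by (auto intro: order_trans)
  have "Partial_order r"
    unfolding partial_order_on_def preorder_on_def fld
    by (auto simp: r_def refl_on_def trans_def antisym_def intro: order_trans)
  moreover have "\<exists>u\<in>Field r. \<forall>a\<in>C. (a, u) \<in> r" if C: "C \<in> Chains r" for C
  proof (cases "C = {}")
    case True
    thus ?thesis using p by (auto simp: fld)
  next
    case False
    have Cf: "sublinear q" "q \<le> p" if "q \<in> C" for q
      using C that unfolding Chains_def r_def by (auto intro: order_trans)
    have tot: "q \<le> q' \<or> q' \<le> q" if "q \<in> C" "q' \<in> C" for q q'
      using C that unfolding Chains_def r_def by auto
    define m where "m x = (INF q\<in>C. q x)" for x
    \<comment> \<open>This bound does not depend on \<open>q\<close>, so the infimum over the chain
      is finite.\<close>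
    have lb: "- p (- x) \<le> q x" if "q \<in> C" for q x
    proof -
      have "q 0 = 0" using Cf[OF that] unfolding sublinear_def by (metis mult_zero_left order_refl scaleR_zero_left)
      moreover have "q (x + - x) \<le> q x + q (- x)" using Cf[OF that] unfolding sublinear_def by blast
      moreover have "q (- x) \<le> p (- x)" using Cf[OF that] by (simp add: le_fun_def)
      ultimately show ?thesis by simp
    qed
    have bdd: "bdd_below ((\<lambda>q. q x) ` C)" for x
      by (rule bdd_belowI2[of _ "- p (- x)"]) (use lb in auto)
    have le: "m x \<le> q x" if "q \<in> C" for x q
      unfolding m_def by (rule cINF_lower[OF bdd that])
    have ge: "c \<le> m x" if "\<And>q. q \<in> C \<Longrightarrow> c \<le> q x" for c x
      unfolding m_def by (rule cINF_greatest) (use that False in auto)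
    have "m (u + v) \<le> m u + m v" for u v
    proof -
      \<comment> \<open>Subadditivity can be used only for one functional at both points;
        comparability in the chain allows taking the smaller of \<open>q\<close> and
        \<open>q'\<close>.\<close>
      have "m (u + v) \<le> q u + q' v" if qq: "q \<in> C" "q' \<in> C" for q q'
        using tot[OF qq]
      proof
        assume "q \<le> q'"
        have "m (u + v) \<le> q (u + v)" by (rule le[OF qq(1)])
        also have "\<dots> \<le> q u + q v" using Cf[OF qq(1)] unfolding sublinear_def by blast
        also have "q v \<le> q' v" using \<open>q \<le> q'\<close> by (simp add: le_fun_def)
        finally show ?thesis by simp
      next
        assume "q' \<le> q"
        have "m (u + v) \<le> q' (u + v)" by (rule le[OF qq(2)])
        also have "\<dots> \<le> q' u + q' v" using Cf[OF qq(2)] unfolding sublinear_def by blast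
        also have "q' u \<le> q u" using \<open>q' \<le> q\<close> by (simp add: le_fun_def)
        finally show ?thesis by simp
      qed
      hence "m (u + v) - q u \<le> m v" if "q \<in> C" for q
        by (intro ge) (use that in \<open>force simp: algebra_simps\<close>)
      hence "m (u + v) - m v \<le> m u"
        by (intro ge) (force simp: algebra_simps)
      thus ?thesis by simp
    qed
    moreover have "m (c *\<^sub>R u) = c * m u" if c: "c \<ge> 0" for c u
    proof (cases "c = 0")
      case True
      have "q 0 = 0" if "q \<in> C" for q
        using Cf[OF that] unfolding sublinear_def by (metis mult_zero_left order_refl scaleR_zero_left)
      hence "m 0 = 0" using le ge False by (metis all_not_in_conv antisym order_refl)
      thus ?thesis using True by simp
    next
      case False
      have hom: "q (d *\<^sub>R u) = d * q u" if "q \<in> C" "d \<ge> 0" for q d u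
        using Cf[OF that(1)] that(2) unfolding sublinear_def by blast
      have *: "d * m u \<le> m (d *\<^sub>R u)" if "d \<ge> 0" for d u
      proof (rule ge)
        fix q assume "q \<in> C"
        thus "d * m u \<le> q (d *\<^sub>R u)" using le[of q u] hom[of q d u] that by (simp add: mult_left_mono)
      qed
      show ?thesis using *[OF c, of u] *[of "1/c" "c *\<^sub>R u"] c False by (simp add: field_simps)
    qed
    ultimately have "sublinear m" by (simp add: sublinear_def)
    moreover have "m \<le> q" if "q \<in> C" for q using le[OF that] by (simp add: le_fun_def)
    ultimately show ?thesis
      using Cf False unfolding fld
      by (intro bexI[of _ m]) (auto simp: r_def intro: order_trans)
  qed
  ultimately obtain q where q: "q \<in> Field r" and min: "\<And>a. a \<in> Field r \<Longrightarrow> (q, a) \<in> r \<Longrightarrow> a = q"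
    using Zorns_po_lemma[of r] by blast
  from q have sq: "sublinear q" and qp: "q \<le> p" by (auto simp: fld)
  have add: "q (x + y) = q x + q y" for x y
  proof (rule antisym)
    show "q (x + y) \<le> q x + q y" using sq by (simp add: sublinear_def)
    obtain q' where q': "sublinear q'" "q' \<le> q" "\<And>x. q' x \<le> q (x + y) - q y"
      using sublinear_minorant[OF sq] by metis
    have "q' \<le> p" using q'(2) qp by (rule order_trans)
    hence "q' = q" using q' sq qp by (intro min) (unfold fld, auto simp: r_def)
    with q'(3)[of x] show "q x + q y \<le> q (x + y)" by simp
  qed
  have q0: "q 0 = 0" using add[of 0 0] by simp
  have neg: "q (- x) = - q x" for x using add[of x "- x"] q0 by simp
  have hom: "q (c *\<^sub>R x) = c * q x" for c x
  proof (cases "c \<ge> 0")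
    case False
    have "q ((- c) *\<^sub>R x) = (- c) * q x" using sq False by (simp add: sublinear_def del: scaleR_minus_left)
    thus ?thesis by (simp add: neg)
  qed (use sq in \<open>simp add: sublinear_def\<close>)
  have "linear q" by (rule linearI) (auto simp: add hom)
  thus thesis using qp that by (auto simp: le_fun_def)
qed

text \<open>The minorant \<open>p\<close> of the norm satisfies
  \<open>p (- x) \<le> - norm x\<close>, so a linear \<open>f\<close> below \<open>p\<close> has
  \<open>f x \<ge> norm x\<close>, while \<open>p \<le> norm\<close> gives the converse
  bound.\<close>

lemma norming_functional:
  fixes x :: "'a::real_normed_vector"
  obtains f :: "'a \<Rightarrow> real" where "linear f" "\<And>y. \<bar>f y\<bar> \<le> norm y" "f x = norm x"
proof -
  have "sublinear (norm :: 'a \<Rightarrow> real)" by (auto simp: sublinear_def norm_triangle_ineq)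
  then obtain p where p: "sublinear p" "p \<le> norm" "\<And>u. p u \<le> norm (u + x) - norm x"
    by (rule sublinear_minorant[where y = x]) auto
  obtain f where f: "linear f" "\<And>u. f u \<le> p u" using sublinear_dominates_linear[OF p(1)] by blast
  have le: "f u \<le> norm u" for u using f(2)[of u] p(2) by (auto simp: le_fun_def intro: order_trans)
  have neg: "f (- u) = - f u" for u using f(1) by (simp add: linear_neg)
  have "\<bar>f u\<bar> \<le> norm u" for u using le[of u] le[of "- u"] by (simp add: neg)
  moreover have "f x = norm x" using f(2)[of "- x"] p(3)[of "- x"] le[of x] by (simp add: neg)
  ultimately show thesis using f(1) that by blast
qed

text \<open>The usual complexification \<open>f y - i * f (i * y)\<close> of a real norming
  functional. Adding the bounds of real and imaginary part gives the factor 2, which enters only the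
  final constant; the real part alone already attains \<open>norm x\<close>.\<close>

lemma norming_complex_functional:
  fixes x :: "'a::complex_banach"
  obtains \<phi> :: "'a \<Rightarrow> complex" where "bounded_linear \<phi>" "\<And>c y. \<phi> (scaleC c y) = c * \<phi> y"
    "\<And>y. norm (\<phi> y) \<le> 2 * norm y" "norm x \<le> norm (\<phi> x)"
proof -
  obtain f :: "'a \<Rightarrow> real" where f: "linear f" "\<And>y. \<bar>f y\<bar> \<le> norm y" "f x = norm x"
    using norming_functional[of x] by blast
  define \<phi> where "\<phi> y = Complex (f y) (- f (scaleC \<i> y))" for y
  have fa: "f (u + v) = f u + f v" and fs: "f (c *\<^sub>R u) = c * f u" for u v c
    using f(1) by (auto simp: linear_add linear_scale)
  have fd: "f (u - v) = f u - f v" for u v using f(1) by (rule linear_diff)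
  have dec: "scaleC c y = Re c *\<^sub>R y + Im c *\<^sub>R scaleC \<i> y" for c and y :: 'a
  proof -
    have "scaleC c y = scaleC (of_real (Re c) + of_real (Im c) * \<i>) y"
      by (metis complex_eq mult.commute)
    thus ?thesis by (simp only: scaleC_add_left scaleC_scaleC[symmetric] scaleC_of_real)
  qed
  have ii: "scaleC \<i> (scaleC \<i> y) = - y" for y :: 'a
    using dec[of "-1" y] by (simp add: scaleC_scaleC)
  have comm: "scaleC \<i> (c *\<^sub>R y) = c *\<^sub>R scaleC \<i> y" for c and y :: 'a
    by (metis scaleC_of_real scaleC_scaleC mult.commute)
  have neg: "f (- u) = - f u" for u using f(1) by (simp add: linear_neg)
  have bound: "norm (\<phi> y) \<le> 2 * norm y" for y
  proof -
    have "norm (\<phi> y) \<le> \<bar>f y\<bar> + \<bar>f (scaleC \<i> y)\<bar>"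
      using cmod_le[of "\<phi> y"] by (simp add: \<phi>_def)
    also have "\<dots> \<le> norm y + norm (scaleC \<i> y)" by (intro add_mono f(2))
    finally show ?thesis by (simp add: norm_scaleC)
  qed
  have "bounded_linear \<phi>"
    by (rule bounded_linear_intro[where K = 2])
       (use bound in \<open>auto simp: \<phi>_def complex_eq_iff fa fs comm scaleC_add_right mult.commute\<close>)
  moreover have "\<phi> (scaleC c y) = c * \<phi> y" for c y
    by (subst dec) (simp add: \<phi>_def complex_eq_iff fa fs fd comm ii neg scaleC_add_right algebra_simps)
  moreover have "norm x \<le> norm (\<phi> x)"
    using abs_Re_le_cmod[of "\<phi> x"] f(3) by (simp add: \<phi>_def)
  ultimately show thesis using bound that by blast
qed

section \<open>Post's inversion formula\<close>

text \<open>Euler's integral after scaling the variable by \<open>z\<close>. It serves twice: for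
  the moments of the Post kernel and for the transform of \<open>kappa\<close>.\<close>

lemma has_integral_powr_exp:
  fixes x z :: real
  assumes "x > 0" "z > 0"
  shows "((\<lambda>v. v powr (x - 1) * exp (- z * v)) has_integral Gamma x / z powr x) {0..}"
proof -
  have im: "(\<lambda>v. z * v) ` {0..} = {0::real..}"
  proof safe
    fix y :: real assume "y \<ge> 0"
    thus "y \<in> (\<lambda>v. z * v) ` {0..}" using assms by (intro image_eqI[of _ _ "y / z"]) auto
  qed (use assms in auto)
  have "(\<lambda>t. t powr (x - 1) / exp t) absolutely_integrable_on {0..}"
    using Gamma_integral_real[OF assms(1)]
    by (intro nonnegative_absolutely_integrable_1) (auto simp: has_integral_iff)
  hence "(\<lambda>t. t powr (x - 1) / exp t) absolutely_integrable_on (\<lambda>v. z * v) ` {0..} \<and>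
      integral ((\<lambda>v. z * v) ` {0..}) (\<lambda>t. t powr (x - 1) / exp t) = Gamma x"
    unfolding im using Gamma_integral_real[OF assms(1)] by (simp add: has_integral_iff)
  hence "(\<lambda>v. \<bar>z\<bar> * ((z * v) powr (x - 1) / exp (z * v))) absolutely_integrable_on {0..} \<and>
      integral {0..} (\<lambda>v. \<bar>z\<bar> * ((z * v) powr (x - 1) / exp (z * v))) = Gamma x"
    using assms by (subst has_absolute_integral_change_of_variables_1')
      (auto intro!: derivative_eq_intros inj_onI)
  hence "((\<lambda>v. z * ((z * v) powr (x - 1) / exp (z * v))) has_integral Gamma x) {0..}"
    using assms by (auto simp: has_integral_iff absolutely_integrable_on_def)
  hence "((\<lambda>v. inverse (z powr x) * (z * ((z * v) powr (x - 1) / exp (z * v)))) has_integral inverse (z powr x) * Gamma x) {0..}"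
    by (rule has_integral_mult_right)
  moreover have "inverse (z powr x) * Gamma x = Gamma x / z powr x"
    by (simp add: field_simps)
  moreover have "inverse (z powr x) * (z * ((z * v) powr (x - 1) / exp (z * v))) = v powr (x - 1) * exp (- z * v)"
    if "v \<in> {0..}" for v
    using assms that by (simp add: powr_mult powr_diff exp_minus field_simps)
  ultimately show ?thesis by (metis (no_types, lifting) has_integral_cong)
qed

lemma has_integral_power_exp:
  fixes z :: real
  assumes "z > 0"
  shows "((\<lambda>v. v ^ n * exp (- z * v)) has_integral fact n / z ^ Suc n) {0..}"
\<comment> \<open>The point 0 is exempted since for \<open>n = 0\<close> it gives
  \<open>0 ^ 0 = 1\<close> but \<open>0 powr 0 = 0\<close>.\<close>
proof (rule has_integral_spike[of "{0}"])
  show "((\<lambda>v. v powr (real (Suc n) - 1) * exp (- z * v)) has_integral fact n / z ^ Suc n) {0..}"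
    using has_integral_powr_exp[of "real (Suc n)" z] assms Gamma_fact[of n, where 'a = real]
      powr_realpow[OF assms, of "Suc n"]
    by (simp add: add.commute)
qed (use assms in \<open>auto simp: powr_realpow\<close>)

text \<open>The kernel is the density of the Gamma distribution with mean \<open>(n + 1) t / n\<close>;
  its second moment about \<open>t\<close> is \<open>t\<^sup>2 (n + 2) / n\<^sup>2\<close>, and Chebyshev's inequality applies.\<close>
lemma Post_Widder:
  fixes f :: "real \<Rightarrow> complex"
  assumes cont: "continuous_on {0..\<tau>} f" and t: "0 < t" "t < \<tau>"
  shows "(\<lambda>n. of_real ((n / t) ^ Suc n / fact n) *
            integral {0..\<tau>} (\<lambda>u. of_real (u ^ n * exp (- (n / t) * u)) * f u)) \<longlonglongrightarrow> f t"
proof (rule LIMSEQ_I)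
  fix e :: real assume e: "e > 0"
  define k :: "nat \<Rightarrow> real \<Rightarrow> real" where "k n u = (n / t) ^ Suc n / fact n * (u ^ n * exp (- (n / t) * u))" for n u
  obtain B where B: "\<And>u. u \<in> {0..\<tau>} \<Longrightarrow> norm (f u) \<le> B"
    using compact_imp_bounded[OF compact_continuous_image[OF cont]] unfolding bounded_iff by blast
  have B0: "B \<ge> 0" using order_trans[OF norm_ge_zero B[of 0]] t by auto
  have "continuous (at t within {0..\<tau>}) f" using cont t by (auto simp: continuous_on_eq_continuous_within)
  then obtain d0 where d0: "d0 > 0" "\<And>u. u \<in> {0..\<tau>} \<Longrightarrow> \<bar>u - t\<bar> < d0 \<Longrightarrow> norm (f u - f t) < e / 2"
    unfolding continuous_within_eps_delta using e by (metis dist_norm half_gt_zero real_norm_def)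
  \<comment> \<open>The cap \<open>\<tau> - t\<close> keeps the window around \<open>t\<close>
    inside the interval on which \<open>f\<close> is controlled.\<close>
  define d where "d = min d0 (\<tau> - t)"
  have d: "d > 0" "d \<le> d0" "t + d \<le> \<tau>" using d0 t by (auto simp: d_def)
  \<comment> \<open>Extending by zero moves the integral to the half-line, where the moments of the
    kernel are known exactly.\<close>
  define F where "F u = (if u \<in> {0..\<tau>} then f u else 0)" for u
  have Fle: "norm (F u) \<le> B" for u using B B0 by (auto simp: F_def)
  have diff: "norm (F u - f t) \<le> e / 2 + 2 * B / d\<^sup>2 * (u - t)\<^sup>2" if "u \<ge> 0" for u
  proof (cases "\<bar>u - t\<bar> < d")
    case True
    hence "u \<in> {0..\<tau>}" using that d by auto
    with d0(2)[of u] True d have "norm (F u - f t) \<le> e / 2" by (simp add: F_def)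
    moreover have "0 \<le> 2 * B / d\<^sup>2 * (u - t)\<^sup>2" using B0 by simp
    ultimately show ?thesis by linarith
  next
    case False
    hence "d\<^sup>2 \<le> (u - t)\<^sup>2" using d by (simp add: abs_le_square_iff[symmetric])
    hence "2 * B * 1 \<le> 2 * B * ((u - t)\<^sup>2 / d\<^sup>2)" using B0 d by (intro mult_left_mono) auto
    moreover have "norm (F u - f t) \<le> 2 * B"
      using norm_triangle_ineq4[of "F u" "f t"] Fle[of u] B[of t] t by auto
    ultimately show ?thesis using e by simp
  qed
  have main: "norm (of_real ((n / t) ^ Suc n / fact n) *
            integral {0..\<tau>} (\<lambda>u. of_real (u ^ n * exp (- (n / t) * u)) * f u) - f t)
            \<le> e / 2 + 2 * B / d\<^sup>2 * (t\<^sup>2 * (real n + 2) / (real n)\<^sup>2)" if n: "n > 0" for n :: nat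
  proof -
    define s where "s = real n / t"
    have s: "s > 0" using n t by (simp add: s_def)
    have mom: "((\<lambda>u. u ^ i * k n u) has_integral (fact (n + i) / fact n) / s ^ i) {0..}" for i
    proof -
      have "((\<lambda>u. s ^ Suc n / fact n * (u ^ (n + i) * exp (- s * u))) has_integral
              s ^ Suc n / fact n * (fact (n + i) / s ^ Suc (n + i))) {0..}"
        by (intro has_integral_mult_right has_integral_power_exp s)
      also have "s ^ Suc n / fact n * (fact (n + i) / s ^ Suc (n + i)) = (fact (n + i) / fact n) / s ^ i"
        using s by (simp add: power_add field_simps)
      also have "(\<lambda>u. s ^ Suc n / fact n * (u ^ (n + i) * exp (- s * u))) = (\<lambda>u. u ^ i * k n u)"
        by (simp add: k_def s_def power_add mult_ac)
      finally show ?thesis .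
    qed
    have f1: "fact (n + 1) / fact n = real n + 1" by simp
    have f2: "fact (n + 2) / fact n = (real n + 2) * (real n + 1)" by (simp add: add.commute)
    have m0: "(k n has_integral 1) {0..}" using mom[of 0] by simp
    have "((\<lambda>u. u ^ 2 * k n u - 2 * t * (u ^ 1 * k n u) + t\<^sup>2 * k n u) has_integral
            ((real n + 2) * (real n + 1) / s ^ 2 - 2 * t * ((real n + 1) / s ^ 1) + t\<^sup>2 * 1)) {0..}"
      using mom[of 2] mom[of 1] m0 unfolding f1 f2
      by (intro has_integral_add has_integral_diff has_integral_mult_right) auto
    also have "(real n + 2) * (real n + 1) / s ^ 2 - 2 * t * ((real n + 1) / s ^ 1) + t\<^sup>2 * 1
        = t\<^sup>2 * (real n + 2) / (real n)\<^sup>2"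
      using t n by (simp add: s_def field_simps power2_eq_square)
    also have "(\<lambda>u. u ^ 2 * k n u - 2 * t * (u ^ 1 * k n u) + t\<^sup>2 * k n u) = (\<lambda>u. (u - t)\<^sup>2 * k n u)"
      by (simp add: power2_eq_square algebra_simps)
    finally have var: "((\<lambda>u. (u - t)\<^sup>2 * k n u) has_integral t\<^sup>2 * (real n + 2) / (real n)\<^sup>2) {0..}" .
    have kpos: "k n u \<ge> 0" if "u \<ge> 0" for u using that t by (simp add: k_def)
    have "(\<lambda>u. of_real (k n u) * f u) integrable_on {0..\<tau>}"
      unfolding k_def by (intro integrable_continuous_real continuous_intros cont)
    then have hi: "((\<lambda>u. of_real (k n u) * f u) has_integral integral {0..\<tau>} (\<lambda>u. of_real (k n u) * f u)) {0..\<tau>}"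
      by (rule integrable_integral)
    have "((\<lambda>u. of_real (k n u) * F u) has_integral integral {0..\<tau>} (\<lambda>u. of_real (k n u) * f u)) {0..}"
    proof -
      have "((\<lambda>u. if u \<in> {0..\<tau>} then of_real (k n u) * f u else 0) has_integral
          integral {0..\<tau>} (\<lambda>u. of_real (k n u) * f u)) {0..}"
        by (subst has_integral_restrict) (use hi in auto)
      thus ?thesis by (rule has_integral_eq[rotated]) (auto simp: F_def)
    qed
    moreover have "((\<lambda>u. of_real (k n u) * f t) has_integral of_real 1 * f t) {0..}"
      by (intro has_integral_mult_left has_integral_of_real m0)
    ultimately have "((\<lambda>u. of_real (k n u) * (F u - f t)) has_integral
        integral {0..\<tau>} (\<lambda>u. of_real (k n u) * f u) - f t) {0..}"
      by (drule_tac has_integral_diff) (auto simp: algebra_simps)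
    moreover have "((\<lambda>u. e / 2 * k n u + 2 * B / d\<^sup>2 * ((u - t)\<^sup>2 * k n u)) has_integral
        e / 2 * 1 + 2 * B / d\<^sup>2 * (t\<^sup>2 * (real n + 2) / (real n)\<^sup>2)) {0..}"
      by (intro has_integral_add has_integral_mult_right var m0)
    moreover have "norm (of_real (k n u) * (F u - f t)) \<le> e / 2 * k n u + 2 * B / d\<^sup>2 * ((u - t)\<^sup>2 * k n u)"
      if "u \<in> {0..}" for u
    proof -
      have "norm (of_real (k n u) * (F u - f t)) = k n u * norm (F u - f t)"
        using kpos that by (simp add: norm_mult)
      also have "\<dots> \<le> k n u * (e / 2 + 2 * B / d\<^sup>2 * (u - t)\<^sup>2)"
        by (intro mult_left_mono diff kpos) (use that in auto)
      finally show ?thesis by (simp add: algebra_simps)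
    qed
    ultimately have "norm (integral {0..\<tau>} (\<lambda>u. of_real (k n u) * f u) - f t)
      \<le> e / 2 * 1 + 2 * B / d\<^sup>2 * (t\<^sup>2 * (real n + 2) / (real n)\<^sup>2)"
      by (metis (no_types, lifting) has_integral_integrable integral_norm_bound_integral integral_unique)
    moreover have "integral {0..\<tau>} (\<lambda>u. of_real (k n u) * f u) = of_real ((n / t) ^ Suc n / fact n) *
            integral {0..\<tau>} (\<lambda>u. of_real (u ^ n * exp (- (n / t) * u)) * f u)"
      by (subst integral_mult_right[symmetric]) (simp add: k_def mult_ac)
    ultimately show ?thesis by simp
  qed
  have "(\<lambda>n. 2 * B / d\<^sup>2 * (t\<^sup>2 * (real n + 2) / (real n)\<^sup>2)) \<longlonglongrightarrow> 0"
  proof -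
    have "(\<lambda>n. 2 * B / d\<^sup>2 * t\<^sup>2 * (1 / real n + 2 * (1 / real n) * (1 / real n))) \<longlonglongrightarrow> 2 * B / d\<^sup>2 * t\<^sup>2 * (0 + 2 * 0 * 0)"
      by (intro tendsto_intros lim_1_over_n)
    moreover have "2 * B / d\<^sup>2 * t\<^sup>2 * (1 / real n + 2 * (1 / real n) * (1 / real n)) = 2 * B / d\<^sup>2 * (t\<^sup>2 * (real n + 2) / (real n)\<^sup>2)" for n
      by (cases "n = 0") (simp_all add: field_simps power2_eq_square)
    ultimately show ?thesis by simp
  qed
  hence "eventually (\<lambda>n. 2 * B / d\<^sup>2 * (t\<^sup>2 * (real n + 2) / (real n)\<^sup>2) < e / 2) sequentially"
    using e by (intro order_tendstoD) auto
  then obtain N where N: "\<And>n. n \<ge> N \<Longrightarrow> 2 * B / d\<^sup>2 * (t\<^sup>2 * (real n + 2) / (real n)\<^sup>2) < e / 2"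
    unfolding eventually_sequentially by blast
  show "\<exists>no. \<forall>n\<ge>no. norm (of_real ((n / t) ^ Suc n / fact n) *
            integral {0..\<tau>} (\<lambda>u. of_real (u ^ n * exp (- (n / t) * u)) * f u) - f t) < e"
    using N main by (intro exI[of _ "max 1 N"]) (smt (verit) field_sum_of_halves less_le_trans max.bounded_iff zero_less_one)
qed

section \<open>Higher derivatives of functions holomorphic in a sector\<close>

text \<open>For \<open>k \<ge> 0\<close> this is the open sector about the positive axis with
  half-angle \<open>pi / 2 + arctan k\<close>. With \<open>k = - cos \<theta> / sin \<theta>\<close>
  the half-angle is \<open>\<theta>\<close>.\<close>

definition wedge :: "real \<Rightarrow> complex set" where
  "wedge k = {w. Re w + k * \<bar>Im w\<bar> > 0}"

lemma wedge_nonzero: "0 \<notin> wedge k"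
  by (simp add: wedge_def)

lemma open_wedge: "open (wedge k)"
  unfolding wedge_def by (intro open_Collect_less continuous_intros)

lemma half_plane_subset_wedge: "k \<ge> 0 \<Longrightarrow> {w. Re w > 0} \<subseteq> wedge k"
  by (auto simp: wedge_def intro: add_pos_nonneg)

text \<open>Cauchy's formula on a rectangle to the right of the imaginary axis, in the order bottom,
  right, top, left. As \<open>R\<close> grows only the left side matters, and that side is bent into
  the wedge afterwards.\<close>

lemma higher_deriv_rectpath:
  fixes h :: "complex \<Rightarrow> complex" and \<sigma> \<delta> R :: real and n :: nat
  assumes h: "h holomorphic_on {w. Re w > 0}" and d: "0 < \<delta>" "\<delta> < \<sigma>" and R: "\<sigma> < \<delta> + R"
  defines "F \<equiv> \<lambda>w. h w / (w - of_real \<sigma>) ^ Suc n"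
  shows "2 * pi * \<i> * ((deriv ^^ n) h (of_real \<sigma>) / fact n) =
     contour_integral (linepath (Complex \<delta> (-R)) (Complex (\<delta> + R) (-R))) F +
     (contour_integral (linepath (Complex (\<delta> + R) (-R)) (Complex (\<delta> + R) R)) F +
     (contour_integral (linepath (Complex (\<delta> + R) R) (Complex \<delta> R)) F +
      contour_integral (linepath (Complex \<delta> R) (Complex \<delta> (-R))) F))"
proof -
  define S where "S = {w. Re w > 0}"
  have S: "open S" "connected S" "convex S"
    unfolding S_def by (auto simp: open_halfspace_Re_gt convex_halfspace_Re_gt convex_connected)
  have R0: "R > 0" using R d by linarith
  let ?a = "Complex \<delta> (-R)" and ?b = "Complex (\<delta> + R) R"
  have F: "F holomorphic_on S - {of_real \<sigma>}"
    unfolding F_def using h by (auto intro!: holomorphic_intros simp: S_def elim: holomorphic_on_subset)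
  have im: "path_image (rectpath ?a ?b) \<subseteq> S - {of_real \<sigma>}"
    using path_image_rectpath[of ?a ?b] d R R0 by (auto simp: S_def)
  have "contour_integral (rectpath ?a ?b) F =
      2 * pi * \<i> * (\<Sum>p\<in>{complex_of_real \<sigma>}. winding_number (rectpath ?a ?b) p * residue F p)"
  proof (rule Residue_theorem[OF S(1,2) _ F _ _ im])
    show "\<forall>z. z \<notin> S \<longrightarrow> winding_number (rectpath ?a ?b) z = 0"
      using im by (intro allI impI winding_number_zero_outside[OF _ S(3)]) auto
  qed auto
  moreover have "winding_number (rectpath ?a ?b) (of_real \<sigma>) = 1"
    using d R R0 by (intro winding_number_rectpath) (auto simp: in_box_complex_iff)
  moreover have "residue F (of_real \<sigma>) = (deriv ^^ n) h (of_real \<sigma>) / fact n"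
    unfolding F_def by (rule residue_holomorphic_over_power[OF S(1)]) (use h d in \<open>auto simp: S_def\<close>)
  ultimately have *: "contour_integral (rectpath ?a ?b) F = 2 * pi * \<i> * ((deriv ^^ n) h (of_real \<sigma>) / fact n)"
    by simp
  have ci: "F contour_integrable_on linepath u v" if "closed_segment u v \<subseteq> path_image (rectpath ?a ?b)" for u v
    using that im F by (intro contour_integrable_continuous_linepath holomorphic_on_imp_continuous_on)
      (auto elim!: holomorphic_on_subset)
  have segs: "path_image (rectpath ?a ?b) = closed_segment ?a (Complex (\<delta> + R) (-R)) \<union>
     (closed_segment (Complex (\<delta> + R) (-R)) ?b \<union> (closed_segment ?b (Complex \<delta> R) \<union> closed_segment (Complex \<delta> R) ?a))"
    by (simp add: rectpath_def Let_def path_image_join)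
  show ?thesis unfolding *[symmetric] rectpath_def Let_def
    using ci[of ?a "Complex (\<delta> + R) (-R)"] ci[of "Complex (\<delta> + R) (-R)" ?b]
      ci[of ?b "Complex \<delta> R"] ci[of "Complex \<delta> R" ?a]
    unfolding segs by (simp add: contour_integrable_joinI le_supI1 le_supI2)
qed

text \<open>Cauchy's theorem on a triangle: half of the left side is turned about
  \<open>\<delta>\<close> to run parallel to the boundary of the wedge. On the triangle
  \<open>Re w + k * (e * Im w) \<ge> \<delta>\<close> keeps \<open>w\<close> in the wedge and
  \<open>Re w \<le> \<delta>\<close> keeps it away from the pole. The sign \<open>e\<close> treats
  upper and lower half together.\<close>

lemma contour_integral_tilt:
  fixes F :: "complex \<Rightarrow> complex"
  assumes F: "F holomorphic_on wedge k - {of_real \<sigma>}" and d: "0 < \<delta>" "\<delta> < \<sigma>" and k: "0 < k" and e: "e = 1 \<or> e = -1" and R: "R > 0"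
  shows "contour_integral (linepath (Complex \<delta> (e * R)) (of_real \<delta>)) F =
      contour_integral (linepath (Complex \<delta> (e * R)) (Complex (\<delta> - k * R) (e * R))) F +
      contour_integral (linepath (Complex (\<delta> - k * R) (e * R)) (of_real \<delta>)) F"
proof -
  let ?a = "Complex \<delta> (e * R)" and ?b = "Complex (\<delta> - k * R) (e * R)" and ?c = "complex_of_real \<delta>"
  have "convex {w. Re w + k * (e * Im w) \<ge> \<delta> \<and> Re w \<le> \<delta>}"
  proof -
    have "{w. Re w + k * (e * Im w) \<ge> \<delta> \<and> Re w \<le> \<delta>} = {w. Complex 1 (k * e) \<bullet> w \<ge> \<delta>} \<inter> {w. Re w \<le> \<delta>}"
      by (auto simp: inner_complex_def)
    thus ?thesis by (simp add: convex_Int convex_halfspace_ge convex_halfspace_Re_le)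
  qed
  hence "convex hull {?a, ?b, ?c} \<subseteq> {w. Re w + k * (e * Im w) \<ge> \<delta> \<and> Re w \<le> \<delta>}"
    using e k R d by (intro hull_minimal) (auto simp: mult_ac)
  also have "\<dots> \<subseteq> wedge k - {of_real \<sigma>}"
  proof -
    have "w \<in> wedge k" if "Re w + k * (e * Im w) \<ge> \<delta>" for w
    proof -
      have "k * (e * Im w) \<le> k * \<bar>Im w\<bar>" using k e by (intro mult_left_mono) auto
      thus ?thesis using that d by (simp add: wedge_def)
    qed
    thus ?thesis using d by auto
  qed
  finally have sub: "convex hull {?a, ?b, ?c} \<subseteq> wedge k - {of_real \<sigma>}" .
  hence hol: "F holomorphic_on convex hull {?a, ?b, ?c}" using F holomorphic_on_subset by blast
  have ci: "F contour_integrable_on linepath u v" if "u \<in> {?a,?b,?c}" "v \<in> {?a,?b,?c}" for u v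
    using that by (intro contour_integrable_continuous_linepath holomorphic_on_imp_continuous_on)
      (metis (no_types, lifting) hol closed_segment_subset convex_convex_hull holomorphic_on_subset hull_inc)
  have "contour_integral (linepath ?a ?b +++ linepath ?b ?c +++ linepath ?c ?a) F = 0"
    by (rule contour_integral_unique[OF Cauchy_theorem_triangle[OF hol]])
  moreover have "contour_integral (linepath ?c ?a) F = - contour_integral (linepath ?a ?c) F"
    by (metis contour_integral_reversepath reversepath_linepath valid_path_linepath)
  ultimately show ?thesis by (simp add: ci contour_integrable_joinI) (simp add: algebra_simps)
qed

text \<open>After tilting, the integrand is at most a constant times \<open>t / (1 + k t y)\<^sup>2\<close> at height \<open>y\<close>,
  because \<open>(1 - 1/n) ^ (-(n + 1)) \<le> e\<^sup>3\<close>.\<close>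
lemma tilted_line_bound:
  fixes h :: "complex \<Rightarrow> complex" and t C k :: real and n :: nat
  assumes h: "h holomorphic_on wedge k" and C: "\<And>w. w \<in> wedge k \<Longrightarrow> norm (h w) \<le> C / norm w"
    and t: "t > 0" and n: "n \<ge> 2" and k: "0 < k" "k \<le> 1" and e: "e = 1 \<or> e = -1" and R: "R > 0"
  defines "\<sigma> \<equiv> n / t" and "\<delta> \<equiv> 1 / t"
  shows "\<sigma> ^ Suc n * norm (contour_integral (linepath (Complex (\<delta> - k * R) (e * R)) (of_real \<delta>))
      (\<lambda>w. h w / (w - of_real \<sigma>) ^ Suc n)) \<le> 6 * exp 3 / k * C"
proof -
  define F where "F = (\<lambda>w. h w / (w - complex_of_real \<sigma>) ^ Suc n)"
  define v where "v = Complex (-k) e"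
  have d: "0 < \<delta>" "\<delta> < \<sigma>" "\<sigma> - \<delta> = (n - 1) / t" using t n by (auto simp: \<delta>_def \<sigma>_def divide_strict_right_mono diff_divide_distrib of_nat_diff)
  have C0: "C \<ge> 0"
  proof -
    have "(1::complex) \<in> wedge k" using k by (simp add: wedge_def)
    from order_trans[OF norm_ge_zero C[OF this]] show ?thesis by simp
  qed
  have nv: "norm v \<le> 2" using cmod_le[of v] k e by (auto simp: v_def)
  have wy: "Complex (\<delta> - k * y) (e * y) = of_real \<delta> + of_real y * v" for y
    by (simp add: v_def complex_eq_iff)
  have win: "of_real \<delta> + of_real y * v \<in> wedge k" if "y \<ge> 0" for y
    using that e d k by (auto simp: wedge_def v_def abs_mult)
  have ws: "norm (of_real \<delta> + of_real y * v - of_real \<sigma>) \<ge> \<sigma> - \<delta> + k * y" for y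
    using abs_Re_le_cmod[of "of_real \<delta> + of_real y * v - of_real \<sigma>"] by (simp add: v_def mult.commute)
  \<comment> \<open>Both \<open>y\<close> and \<open>\<delta> - k * y\<close> are at most the
    modulus and \<open>k * y \<le> y\<close>, so \<open>\<delta> + y\<close> is at most the modulus
    plus \<open>2 * y\<close>; hence the 3.\<close>
  have w0: "\<delta> + y \<le> 3 * norm (of_real \<delta> + of_real y * v)" if "y \<ge> 0" for y
  proof -
    let ?w = "of_real \<delta> + of_real y * v"
    have "y \<le> norm ?w" using abs_Im_le_cmod[of ?w] e that by (auto simp: v_def)
    moreover have "\<delta> - k * y \<le> norm ?w" using abs_Re_le_cmod[of ?w] by (simp add: v_def mult.commute)
    moreover have "k * y \<le> y" using k that mult_right_mono[of k 1 y] by simp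
    ultimately show ?thesis by linarith
  qed
  have pt: "\<sigma> ^ Suc n * norm (F (of_real \<delta> + of_real y * v)) \<le> 3 * exp 3 * C * (t / (1 + k * t * y)\<^sup>2)" if y: "y \<ge> 0" for y
  proof -
    let ?w = "of_real \<delta> + of_real y * v"
    have wpos: "norm ?w > 0" using w0[OF y] d y by linarith
    have ps: "\<sigma> - \<delta> + k * y > 0" using d(2) k y by (intro add_pos_nonneg) auto
    have "\<sigma> ^ Suc n * norm (F ?w) = norm (h ?w) * (\<sigma> / norm (?w - of_real \<sigma>)) ^ Suc n"
      by (simp add: F_def norm_divide norm_power power_divide norm_mult)
    also have "\<dots> \<le> (3 * C * t / (1 + k * t * y)) * (exp 3 / (1 + k * t * y))"
    proof (rule mult_mono)
      have "norm (h ?w) \<le> C / norm ?w" by (rule C[OF win[OF y]])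
      also have "\<dots> \<le> C / ((\<delta> + y) / 3)"
        using w0[OF y] d y C0 wpos by (intro divide_left_mono) auto
      also have "\<dots> = 3 * C * t / (1 + t * y)" using t by (simp add: \<delta>_def field_simps)
      also have "\<dots> \<le> 3 * C * t / (1 + k * t * y)"
      proof -
        have "k * (t * y) \<le> 1 * (t * y)" using k t y by (intro mult_right_mono) auto
        thus ?thesis using C0 t y k by (intro divide_left_mono) (auto simp: mult.assoc intro!: add_pos_nonneg mult_pos_pos)
      qed
      finally show "norm (h ?w) \<le> 3 * C * t / (1 + k * t * y)" .
      have "\<sigma> / norm (?w - of_real \<sigma>) \<le> \<sigma> / (\<sigma> - \<delta> + k * y)"
        using ws[of y] ps d by (intro divide_left_mono mult_pos_pos) auto
      also have "\<dots> = (\<sigma> / (\<sigma> - \<delta>)) / (1 + k * y / (\<sigma> - \<delta>))"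
      proof -
        have "c / (b + x) = (c / b) / (1 + x / b)" if "b > 0" "b + x > 0" for b c x :: real
          using that by (simp add: field_simps)
        thus ?thesis using d(2) ps by simp
      qed
      finally have "(\<sigma> / norm (?w - of_real \<sigma>)) ^ Suc n \<le> ((\<sigma> / (\<sigma> - \<delta>)) / (1 + k * y / (\<sigma> - \<delta>))) ^ Suc n"
        using d by (intro power_mono) auto
      also have "\<dots> = (\<sigma> / (\<sigma> - \<delta>)) ^ Suc n / (1 + k * y / (\<sigma> - \<delta>)) ^ Suc n"
        by (rule power_divide)
      also have "\<dots> \<le> exp 3 / (1 + k * t * y)"
      proof (rule frac_le)
        \<comment> \<open>The ratio is \<open>n / (n - 1)\<close>, and the exponent obtained below,
          \<open>(n + 1) / (n - 1)\<close>, is at most 3 for \<open>n \<ge> 2\<close>.\<close>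
        have "\<sigma> / (\<sigma> - \<delta>) = 1 + 1 / (real n - 1)"
          unfolding d(3) unfolding \<sigma>_def using n t by (simp add: field_simps of_nat_diff)
        also have "\<dots> \<le> exp (1 / (real n - 1))" by (rule exp_ge_add_one_self)
        finally have "(\<sigma> / (\<sigma> - \<delta>)) ^ Suc n \<le> exp (1 / (real n - 1)) ^ Suc n"
          using d(1,2) by (intro power_mono divide_nonneg_pos) auto
        also have "\<dots> = exp ((1 + real n) / (real n - 1))"
          by (subst exp_of_nat_mult[symmetric]) simp
        also have "\<dots> \<le> exp 3" using n by (simp add: field_simps)
        finally show "(\<sigma> / (\<sigma> - \<delta>)) ^ Suc n \<le> exp 3" .
        \<comment> \<open>Bernoulli's inequality extracts one factor of linear decay from the power,
          with a rate uniform in \<open>n\<close> because \<open>(n + 1) / (\<sigma> - \<delta>) = t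
          * (n + 1) / (n - 1) \<ge> t\<close>.\<close>
        have "k * t * y \<le> real (Suc n) * (k * y / (\<sigma> - \<delta>))"
        proof -
          have "k * y * t \<le> k * y * (real (Suc n) / (\<sigma> - \<delta>))"
          proof (intro mult_left_mono)
            show "t \<le> real (Suc n) / (\<sigma> - \<delta>)" using n t d by (simp add: d(3) field_simps)
          qed (use k y in auto)
          thus ?thesis by (simp add: mult_ac)
        qed
        also have "1 + real (Suc n) * (k * y / (\<sigma> - \<delta>)) \<le> (1 + k * y / (\<sigma> - \<delta>)) ^ Suc n"
          by (rule Bernoulli_inequality) (use k y d(1,2) in \<open>auto intro: order_trans[of _ 0]\<close>)
        finally show "1 + k * t * y \<le> (1 + k * y / (\<sigma> - \<delta>)) ^ Suc n" by simp
        show "0 < 1 + k * t * y" using k t y by (intro add_pos_nonneg) auto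
      qed simp
      finally show "(\<sigma> / norm (?w - of_real \<sigma>)) ^ Suc n \<le> exp 3 / (1 + k * t * y)" .
    qed (use C0 t k y d in auto)
    also have "\<dots> = 3 * exp 3 * C * (t / (1 + k * t * y)\<^sup>2)" by (simp add: power2_eq_square mult_ac)
    finally show ?thesis .
  qed
  have Fhol: "F holomorphic_on wedge k - {of_real \<sigma>}"
    unfolding F_def using h by (auto intro!: holomorphic_intros elim: holomorphic_on_subset)
  let ?b = "Complex (\<delta> - k * R) (e * R)"
  \<comment> \<open>An antiderivative of the majorant
    \<open>6 * exp 3 * C * t / (1 + k * t * y)\<^sup>2\<close>, the extra 2 being the bound for
    \<open>norm v\<close>. Its total variation on the half-line is \<open>6 * exp 3 * C / k\<close>,
    free of \<open>t\<close>, \<open>n\<close> and \<open>R\<close>.\<close>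
  define G where "G y = - (3 * exp 3 * C * 2 / k) / (1 + k * t * y)" for y
  have int: "F contour_integrable_on linepath ?b (of_real \<delta>)"
  proof (intro contour_integrable_continuous_linepath holomorphic_on_imp_continuous_on holomorphic_on_subset[OF Fhol])
    show "closed_segment ?b (of_real \<delta>) \<subseteq> wedge k - {of_real \<sigma>}"
    proof
      fix w assume "w \<in> closed_segment ?b (of_real \<delta>)"
      then obtain u where u: "0 \<le> u" "u \<le> 1" "w = (1 - u) *\<^sub>R ?b + u *\<^sub>R of_real \<delta>"
        by (auto simp: closed_segment_def)
      hence w: "w = of_real \<delta> + of_real ((1 - u) * R) * v"
        by (simp add: v_def complex_eq_iff algebra_simps)
      have "(1 - u) * R \<ge> 0" using u R by simp
      moreover have "Re w < \<sigma>"
      proof -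
        have "Re w = \<delta> - k * ((1 - u) * R)" by (simp add: w v_def)
        moreover have "0 \<le> k * ((1 - u) * R)" using k u R by simp
        ultimately show ?thesis using d(2) by linarith
      qed
      ultimately show "w \<in> wedge k - {of_real \<sigma>}" using win[of "(1 - u) * R"] w by (metis Diff_iff Re_complex_of_real less_irrefl singletonD)
    qed
  qed
  have hi: "((\<lambda>u. F (linepath ?b (of_real \<delta>) u) * (of_real \<delta> - ?b)) has_integral
      contour_integral (linepath ?b (of_real \<delta>)) F) {0..1}"
    using has_contour_integral_integral[OF int] unfolding has_contour_integral_linepath by simp
  have lp: "linepath ?b (of_real \<delta>) u = of_real \<delta> + of_real ((1 - u) * R) * v" for u
    by (simp add: linepath_def v_def complex_eq_iff algebra_simps)
  have hi2: "((\<lambda>u. 3 * exp 3 * C * 2 * (t * R / (1 + k * t * ((1 - u) * R))\<^sup>2)) has_integral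
      (- G ((1 - 1) * R)) - (- G ((1 - 0) * R))) {0..1}"
  proof (rule fundamental_theorem_of_calculus)
    fix u :: real assume "u \<in> {0..1}"
    hence "1 + k * t * ((1 - u) * R) > 0" using k t R by (intro add_pos_nonneg) auto
    thus "((\<lambda>u. - G ((1 - u) * R)) has_vector_derivative
        3 * exp 3 * C * 2 * (t * R / (1 + k * t * ((1 - u) * R))\<^sup>2)) (at u within {0..1})"
      unfolding G_def has_real_derivative_iff_has_vector_derivative[symmetric] using k
      by (auto intro!: derivative_eq_intros simp: power2_eq_square divide_simps)
  qed simp
  have "norm (contour_integral (linepath ?b (of_real \<delta>)) F) * \<sigma> ^ Suc n = 
      norm (of_real (\<sigma> ^ Suc n) * contour_integral (linepath ?b (of_real \<delta>)) F)"
    using d by (simp add: norm_mult norm_power)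
  also have "\<dots> \<le> - G ((1 - 1) * R) - (- G ((1 - 0) * R))"
  proof -
    have a: "((\<lambda>u. of_real (\<sigma> ^ Suc n) * (F (linepath ?b (of_real \<delta>) u) * (of_real \<delta> - ?b))) has_integral
      of_real (\<sigma> ^ Suc n) * contour_integral (linepath ?b (of_real \<delta>)) F) {0..1}"
      by (rule has_integral_mult_right[OF hi])
    have b: "norm (of_real (\<sigma> ^ Suc n) * (F (linepath ?b (of_real \<delta>) u) * (of_real \<delta> - ?b))) \<le>
       3 * exp 3 * C * 2 * (t * R / (1 + k * t * ((1 - u) * R))\<^sup>2)" if "u \<in> {0..1}" for u
    proof -
      have y: "(1 - u) * R \<ge> 0" using that R by auto
      have "norm (of_real \<delta> - ?b) = R * norm v" using R by (simp add: wy norm_mult norm_minus_commute)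
      also have "\<dots> \<le> R * 2" using nv R by simp
      finally have "\<sigma> ^ Suc n * norm (F (linepath ?b (of_real \<delta>) u)) * norm (of_real \<delta> - ?b)
         \<le> (3 * exp 3 * C * (t / (1 + k * t * ((1 - u) * R))\<^sup>2)) * (R * 2)"
        unfolding lp by (intro mult_mono[OF pt[OF y]]) (use C0 t in auto)
      thus ?thesis using d by (simp add: norm_mult norm_power mult_ac)
    qed
    show ?thesis using integral_norm_bound_integral[OF has_integral_integrable[OF a] has_integral_integrable[OF hi2] b]
      unfolding integral_unique[OF a] integral_unique[OF hi2] .
  qed
  also have "\<dots> \<le> 3 * exp 3 * C * 2 / k"
  proof -
    have "1 + k * t * R > 0" using k t R by (intro add_pos_nonneg) auto
    thus ?thesis using C0 k t R by (simp add: G_def)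
  qed
  finally show ?thesis by (simp add: F_def mult_ac)
qed

lemma far_segment_bound:
  fixes h :: "complex \<Rightarrow> complex" and \<sigma> C R :: real and n :: nat
  assumes C: "\<And>w. w \<in> wedge k \<Longrightarrow> norm (h w) \<le> C / norm w" and h: "h holomorphic_on wedge k"
    and sub: "closed_segment u v \<subseteq> wedge k" and far: "\<And>w. w \<in> closed_segment u v \<Longrightarrow> norm w \<ge> R / 2"
    and s: "\<sigma> \<ge> 0" and R: "R \<ge> 4 * \<sigma>" "R \<ge> 4" "R > 0" and uv: "norm (v - u) \<le> 2 * R" and C0: "C \<ge> 0" and n: "n \<ge> 1"
  shows "norm (contour_integral (linepath u v) (\<lambda>w. h w / (w - of_real \<sigma>) ^ Suc n)) \<le> 16 * C / R"
proof -
  have ge: "norm (w - of_real \<sigma>) \<ge> R / 4" if "w \<in> closed_segment u v" for w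
    using far[OF that] norm_triangle_ineq2[of w "of_real \<sigma>"] R s by simp
  have ne: "w \<noteq> of_real \<sigma>" if "w \<in> closed_segment u v" for w
    using ge[OF that] R by auto
  have "norm (h w / (w - of_real \<sigma>) ^ Suc n) \<le> 8 * C / R\<^sup>2" if w: "w \<in> closed_segment u v" for w
  proof -
    have "norm (h w) \<le> C / norm w" using C sub w by auto
    also have "\<dots> \<le> C / (R / 2)" using far[OF w] R C0 by (intro divide_left_mono mult_pos_pos) auto
    finally have 1: "norm (h w) \<le> C / (R / 2)" .
    have "R / 4 \<le> (R / 4) ^ Suc n" using R by (intro self_le_power) auto
    also have "\<dots> \<le> norm (w - of_real \<sigma>) ^ Suc n" using ge[OF w] R by (intro power_mono) auto
    finally have 2: "R / 4 \<le> norm (w - of_real \<sigma>) ^ Suc n" .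
    have "norm (h w / (w - of_real \<sigma>) ^ Suc n) \<le> (C / (R / 2)) / (R / 4)"
      unfolding norm_divide norm_power by (rule frac_le) (use 1 2 C0 R in auto)
    thus ?thesis by (simp add: power2_eq_square)
  qed
  moreover have "(\<lambda>w. h w / (w - of_real \<sigma>) ^ Suc n) contour_integrable_on linepath u v"
    using h sub ne by (intro contour_integrable_continuous_linepath holomorphic_on_imp_continuous_on)
      (auto intro!: holomorphic_intros elim: holomorphic_on_subset)
  ultimately have "norm (contour_integral (linepath u v) (\<lambda>w. h w / (w - of_real \<sigma>) ^ Suc n)) \<le> 8 * C / R\<^sup>2 * norm (v - u)"
    using C0 by (intro contour_integral_bound_linepath) auto
  also have "\<dots> \<le> 8 * C / R\<^sup>2 * (2 * R)" using uv C0 by (intro mult_left_mono) auto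
  also have "\<dots> = 16 * C / R" using R by (simp add: power2_eq_square)
  finally show ?thesis .
qed

text \<open>In the limit only two rays from \<open>1 / t\<close> remain, each costing
  \<open>6 * exp 3 / k * C\<close>. The vertex \<open>1 / t\<close> is at the natural scale: there
  \<open>h\<close> is at most \<open>C * t\<close>, and the ratio of \<open>n / t\<close> to the
  distance from the pole is \<open>n / (n - 1)\<close>, whose power \<open>n + 1\<close> stays
  bounded.\<close>

lemma higher_deriv_wedge_bound:
  fixes h :: "complex \<Rightarrow> complex" and t C k :: real and n :: nat
  assumes h: "h holomorphic_on wedge k" and C: "\<And>w. w \<in> wedge k \<Longrightarrow> norm (h w) \<le> C / norm w"
    and t: "t > 0" and n: "n \<ge> 2" and k: "0 < k" "k \<le> 1"
  shows "norm (of_real ((n / t) ^ Suc n / fact n) * (deriv ^^ n) h (of_real (n / t))) \<le> 12 * exp 3 / k * C"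
proof -
  define \<sigma> \<delta> where "\<sigma> = n / t" and "\<delta> = 1 / t"
  define F where "F = (\<lambda>w. h w / (w - complex_of_real \<sigma>) ^ Suc n)"
  have d: "0 < \<delta>" "\<delta> < \<sigma>" using t n by (auto simp: \<delta>_def \<sigma>_def divide_strict_right_mono)
  have C0: "C \<ge> 0"
  proof -
    have "(1::complex) \<in> wedge k" using k by (simp add: wedge_def)
    from order_trans[OF norm_ge_zero C[OF this]] show ?thesis by simp
  qed
  have Fhol: "F holomorphic_on wedge k - {of_real \<sigma>}"
    unfolding F_def using h by (auto intro!: holomorphic_intros elim: holomorphic_on_subset)
  have hh: "h holomorphic_on {w. Re w > 0}" using h half_plane_subset_wedge[of k] k holomorphic_on_subset by auto
  let ?D = "(deriv ^^ n) h (of_real \<sigma>) / fact n"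
  \<comment> \<open>The 80 is five times 16: three outer sides of the rectangle and the two
    horizontal segments created by tilting.\<close>
  have key: "norm (2 * pi * \<i> * ?D) * \<sigma> ^ Suc n \<le> 12 * exp 3 / k * C + (80 * C * \<sigma> ^ Suc n) * (1 / real m)"
    if m: "real m \<ge> 4 * \<sigma>" "real m \<ge> 4" for m
  proof -
    define R where "R = real m"
    have R: "R \<ge> 4 * \<sigma>" "R \<ge> 4" "R > 0" "\<sigma> < \<delta> + R" using m d by (auto simp: R_def)
    let ?a1 = "Complex \<delta> (-R)" and ?a2 = "Complex (\<delta> + R) (-R)" and ?a3 = "Complex (\<delta> + R) R" and ?a4 = "Complex \<delta> R"
    let ?b1 = "Complex (\<delta> - k * R) (-R)" and ?b4 = "Complex (\<delta> - k * R) R" and ?c = "complex_of_real \<delta>"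
    let ?I = "\<lambda>u v. contour_integral (linepath u v) F"
    have 1: "2 * pi * \<i> * ?D = ?I ?a1 ?a2 + (?I ?a2 ?a3 + (?I ?a3 ?a4 + ?I ?a4 ?a1))"
      unfolding F_def by (rule higher_deriv_rectpath[OF hh d R(4)])
    have split: "?I ?a4 ?a1 = ?I ?a4 ?c + ?I ?c ?a1"
    proof (rule contour_integral_split_linepath)
      have seg: "closed_segment ?a4 ?a1 \<subseteq> wedge k - {of_real \<sigma>}"
        using d R k by (auto simp: closed_segment_same_Re wedge_def intro!: add_pos_nonneg)
      thus "continuous_on (closed_segment ?a4 ?a1) F"
        using Fhol holomorphic_on_imp_continuous_on holomorphic_on_subset by blast
      show "?c \<in> closed_segment ?a4 ?a1"
        using R by (auto simp: closed_segment_same_Re closed_segment_eq_real_ivl)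
    qed
    have t4: "?I ?a4 ?c = ?I ?a4 ?b4 + ?I ?b4 ?c"
      using contour_integral_tilt[OF Fhol d k(1), of 1 R] R by simp
    have t1: "?I ?a1 ?c = ?I ?a1 ?b1 + ?I ?b1 ?c"
      using contour_integral_tilt[OF Fhol d k(1), of "-1" R] R by simp
    have rev: "?I ?c ?a1 = - ?I ?a1 ?c"
      by (metis contour_integral_reversepath reversepath_linepath valid_path_linepath)
    have eq: "2 * pi * \<i> * ?D = ?I ?a1 ?a2 + ?I ?a2 ?a3 + ?I ?a3 ?a4 + ?I ?a4 ?b4 - ?I ?a1 ?b1 + ?I ?b4 ?c - ?I ?b1 ?c"
      unfolding 1 split t4 rev t1 by (simp add: algebra_simps)
    have kR: "k * R \<le> R" "0 < k * R" using k R mult_right_mono[of k 1 R] by auto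
    have aux: "\<delta> - k * y \<le> x" "\<delta> \<le> x + k * y" if "\<delta> \<le> x" "0 \<le> y" for x y
      using that mult_nonneg_nonneg[of k y] k by linarith+
    \<comment> \<open>One region serves all five far segments: the second condition puts it into the
      wedge, the third makes the modulus at least \<open>R\<close>.\<close>
    have far: "norm (?I u v) \<le> 16 * C / R"
      if sub: "closed_segment u v \<subseteq> {w. Re w \<ge> \<delta> - k * R \<and> Re w + k * \<bar>Im w\<bar> \<ge> \<delta> \<and> (R \<le> Re w \<or> R \<le> \<bar>Im w\<bar>)}" and uv: "norm (v - u) \<le> 2 * R" for u v
      unfolding F_def
    proof (rule far_segment_bound[OF C h])
      show "closed_segment u v \<subseteq> wedge k" using sub d by (fastforce simp: wedge_def)
      fix w assume "w \<in> closed_segment u v"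
      with sub have "R \<le> Re w \<or> R \<le> \<bar>Im w\<bar>" by auto
      thus "R / 2 \<le> norm w" using abs_Re_le_cmod[of w] abs_Im_le_cmod[of w] R by linarith
    qed (use d R uv C0 n in auto)
    have f1: "norm (?I ?a1 ?a2) \<le> 16 * C / R"
      by (rule far) (use R d kR k in \<open>auto simp: closed_segment_same_Im complex_eq_iff closed_segment_eq_real_ivl cmod_def intro!: aux add_nonneg_nonneg\<close>)
    have f2: "norm (?I ?a2 ?a3) \<le> 16 * C / R"
      by (rule far) (use R d kR k in \<open>auto simp: closed_segment_same_Re complex_eq_iff closed_segment_eq_real_ivl cmod_def real_sqrt_mult intro!: aux add_nonneg_nonneg\<close>)
    have f3: "norm (?I ?a3 ?a4) \<le> 16 * C / R"
      by (rule far) (use R d kR k in \<open>auto simp: closed_segment_same_Im complex_eq_iff closed_segment_eq_real_ivl cmod_def intro!: aux add_nonneg_nonneg\<close>)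
    have f4: "norm (?I ?a4 ?b4) \<le> 16 * C / R"
      by (rule far) (use R d kR k in \<open>auto simp: closed_segment_same_Im complex_eq_iff closed_segment_eq_real_ivl cmod_def intro: add_pos_nonneg\<close>)
    have f5: "norm (?I ?a1 ?b1) \<le> 16 * C / R"
      by (rule far) (use R d kR k in \<open>auto simp: closed_segment_same_Im complex_eq_iff closed_segment_eq_real_ivl cmod_def intro: add_pos_nonneg\<close>)
    have g4: "\<sigma> ^ Suc n * norm (?I ?b4 ?c) \<le> 6 * exp 3 / k * C"
      using tilted_line_bound[OF h C t n k, of 1 R] R by (simp add: F_def \<sigma>_def \<delta>_def)
    have g1: "\<sigma> ^ Suc n * norm (?I ?b1 ?c) \<le> 6 * exp 3 / k * C"
      using tilted_line_bound[OF h C t n k, of "-1" R] R by (simp add: F_def \<sigma>_def \<delta>_def)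
    have tri: "norm (a1 + a2 + a3 + a4 - a5 + a6 - a7) \<le> norm a1 + norm a2 + norm a3 + norm a4 + norm a5 + norm a6 + norm a7"
      for a1 a2 a3 a4 a5 a6 a7 :: complex
      by norm
    have "norm (2 * pi * \<i> * ?D) \<le> 80 * C / R + norm (?I ?b4 ?c) + norm (?I ?b1 ?c)"
      unfolding eq using tri[of "?I ?a1 ?a2" "?I ?a2 ?a3" "?I ?a3 ?a4" "?I ?a4 ?b4" "?I ?a1 ?b1" "?I ?b4 ?c" "?I ?b1 ?c"]
        f1 f2 f3 f4 f5 by linarith
    hence "norm (2 * pi * \<i> * ?D) * \<sigma> ^ Suc n \<le> (80 * C / R + norm (?I ?b4 ?c) + norm (?I ?b1 ?c)) * \<sigma> ^ Suc n"
      using d by (intro mult_right_mono) auto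
    also have "\<dots> = 80 * C * \<sigma> ^ Suc n * (1 / R) + (\<sigma> ^ Suc n * norm (?I ?b4 ?c) + \<sigma> ^ Suc n * norm (?I ?b1 ?c))"
      by (simp add: algebra_simps)
    also have "\<dots> \<le> 80 * C * \<sigma> ^ Suc n * (1 / R) + (6 * exp 3 / k * C + 6 * exp 3 / k * C)"
      by (intro add_left_mono add_mono g4 g1)
    finally show ?thesis by (simp add: R_def mult_ac add.commute)
  qed
  have "(\<lambda>m. 12 * exp 3 / k * C + (80 * C * \<sigma> ^ Suc n) * (1 / real m)) \<longlonglongrightarrow> 12 * exp 3 / k * C + (80 * C * \<sigma> ^ Suc n) * 0"
    by (intro tendsto_intros lim_1_over_n)
  moreover have "eventually (\<lambda>m. norm (2 * pi * \<i> * ?D) * \<sigma> ^ Suc n \<le> 12 * exp 3 / k * C + (80 * C * \<sigma> ^ Suc n) * (1 / real m)) sequentially"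
    using eventually_ge_at_top[of "nat \<lceil>4 * \<sigma>\<rceil> + 4"]
  proof eventually_elim
    case (elim m)
    hence "real m \<ge> 4 * \<sigma>" "real m \<ge> 4" by linarith+
    thus ?case by (rule key)
  qed
  ultimately have fin: "norm (2 * pi * \<i> * ?D) * \<sigma> ^ Suc n \<le> 12 * exp 3 / k * C"
    by (auto intro: tendsto_lowerbound)
  have "norm (of_real (\<sigma> ^ Suc n / fact n) * (deriv ^^ n) h (of_real \<sigma>)) = norm ?D * \<sigma> ^ Suc n"
    using d by (simp add: norm_mult norm_divide norm_power)
  also have "\<dots> \<le> 2 * pi * (norm ?D * \<sigma> ^ Suc n)"
  proof -
    have "1 * (norm ?D * \<sigma> ^ Suc n) \<le> (2 * pi) * (norm ?D * \<sigma> ^ Suc n)"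
      using pi_gt3 d by (intro mult_right_mono) (simp, intro mult_nonneg_nonneg, auto)
    thus ?thesis by simp
  qed
  also have "\<dots> = norm (2 * pi * \<i> * ?D) * \<sigma> ^ Suc n" by (simp add: norm_mult[of _ ?D] norm_mult[of _ \<i>] norm_mult del: times_divide_eq_right)
  finally show ?thesis using fin by (simp add: \<sigma>_def)
qed

section \<open>Inversion from an approximate Laplace transform\<close>

lemma truncated_Laplace_higher_deriv:
  fixes f :: "real \<Rightarrow> complex"
  assumes cont: "continuous_on {0..\<tau>} f"
  defines "L \<equiv> \<lambda>s. integral {0..\<tau>} (\<lambda>u. exp (- s * of_real u) * f u)"
  shows "L holomorphic_on UNIV"
    and "(deriv ^^ n) L = (\<lambda>s. integral {0..\<tau>} (\<lambda>u. (- of_real u) ^ n * (exp (- s * of_real u) * f u)))"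
proof -
  have D: "((\<lambda>s. integral {0..\<tau>} (\<lambda>u. (- of_real u) ^ n * (exp (- s * of_real u) * f u))) has_field_derivative
       integral {0..\<tau>} (\<lambda>u. (- of_real u) ^ Suc n * (exp (- s * of_real u) * f u))) (at s)" for n s
    unfolding cbox_interval[symmetric]
  proof (rule leibniz_rule_field_derivative[where U = UNIV])
    show "((\<lambda>s. (- of_real t) ^ n * (exp (- s * of_real t) * f t)) has_field_derivative
        (- of_real t) ^ Suc n * (exp (- s * of_real t) * f t)) (at s)" for s t
      by (auto intro!: derivative_eq_intros)
    show "(\<lambda>u. (- of_real u) ^ n * (exp (- s * of_real u) * f u)) integrable_on cbox 0 \<tau>" for s
      unfolding cbox_interval by (intro integrable_continuous_real continuous_intros cont)
    show "continuous_on (UNIV \<times> cbox 0 \<tau>) (\<lambda>(s, u). (- of_real u) ^ Suc n * (exp (- s * of_real u) * f u))"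
      unfolding case_prod_unfold
      by (intro continuous_intros continuous_on_compose2[OF cont]) auto
  qed auto
  show "(deriv ^^ n) L = (\<lambda>s. integral {0..\<tau>} (\<lambda>u. (- of_real u) ^ n * (exp (- s * of_real u) * f u)))"
  proof (induction n)
    case (Suc n)
    show ?case by (simp only: funpow.simps o_def Suc.IH) (rule ext, rule DERIV_imp_deriv[OF D])
  qed (simp add: L_def)
  show "L holomorphic_on UNIV"
    using D[of 0] by (auto simp: holomorphic_on_def field_differentiable_def L_def)
qed

text \<open>The Post approximants of \<open>f\<close> split into those of \<open>h\<close>, bounded
  uniformly by \<open>higher_deriv_wedge_bound\<close>, and a remainder from the difference of the
  truncated transform and \<open>h\<close>, which Cauchy's inequality sends to 0. Since
  \<open>B\<close> and \<open>s0\<close> may depend on \<open>\<tau>\<close>, one truncation is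
  fixed before \<open>n\<close> grows.\<close>

theorem Laplace_inversion_bound:
  fixes f :: "real \<Rightarrow> complex" and h :: "complex \<Rightarrow> complex" and k C :: real
  assumes cont: "continuous_on {0..} f" and k: "0 < k" "k \<le> 1"
    and h: "h holomorphic_on wedge k" and C: "\<And>w. w \<in> wedge k \<Longrightarrow> norm (h w) \<le> C / norm w"
    and approx: "\<And>\<tau>. \<tau> > 0 \<Longrightarrow> \<exists>B s0. \<forall>s. Re s \<ge> s0 \<longrightarrow>
      norm (integral {0..\<tau>} (\<lambda>u. exp (- s * of_real u) * f u) - h s) \<le> B * exp (- \<tau> * Re s)"
    and t: "t > 0"
  shows "norm (f t) \<le> 12 * exp 3 / k * C"
proof -
  \<comment> \<open>Cauchy's inequality on a circle whose radius is half its centre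
    \<open>n / t\<close> costs \<open>2 ^ n\<close>, while truncation gains
    \<open>exp (- \<tau> * n / (2 * t))\<close>. With \<open>\<tau> = 4 * t\<close> the product is
    \<open>(2 * exp (-2)) ^ n\<close>, which tends to 0.\<close>
  define \<tau> where "\<tau> = 4 * t"
  have \<tau>: "t < \<tau>" "\<tau> > 0" using t by (auto simp: \<tau>_def)
  have cont': "continuous_on {0..\<tau>} f" using cont by (rule continuous_on_subset) auto
  define L where "L s = integral {0..\<tau>} (\<lambda>u. exp (- s * of_real u) * f u)" for s
  obtain B s0 where B: "\<And>s. Re s \<ge> s0 \<Longrightarrow> norm (L s - h s) \<le> B * exp (- \<tau> * Re s)"
    using approx[OF \<tau>(2)] unfolding L_def by blast
  have B0: "B \<ge> 0" 
    using order_trans[OF norm_ge_zero B[of "of_real s0"]] by (simp add: zero_le_mult_iff)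
  have L: "L holomorphic_on UNIV"
    "(deriv ^^ n) L = (\<lambda>s. integral {0..\<tau>} (\<lambda>u. (- of_real u) ^ n * (exp (- s * of_real u) * f u)))" for n
    using truncated_Laplace_higher_deriv[OF cont'] unfolding L_def by auto
  define a where "a n = of_real ((n / t) ^ Suc n / fact n) *
            integral {0..\<tau>} (\<lambda>u. of_real (u ^ n * exp (- (n / t) * u)) * f u)" for n
  define q where "q = 2 * exp (-2 :: real)"
  have q: "0 < q" "q < 1"
  proof -
    have "(2::real) < exp 2" using exp_ge_add_one_self[of "2::real"] by simp
    thus "q < 1" by (simp add: q_def exp_minus field_simps)
  qed (simp add: q_def)
  \<comment> \<open>The condition with \<open>s0\<close> puts the whole circle into the region of
    the error estimate: its leftmost point is \<open>n / t / 2\<close>.\<close>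
  have bound: "norm (a n) \<le> 12 * exp 3 / k * C + (B / t) * (of_nat n * q ^ n)"
    if n: "n \<ge> 2" "real n / t / 2 \<ge> s0" for n
  proof -
    define \<sigma> where "\<sigma> = real n / t"
    have s: "\<sigma> > 0" using n t by (simp add: \<sigma>_def)
    have sub: "cball (of_real \<sigma>) (\<sigma> / 2) \<subseteq> wedge k"
    proof
      fix w assume "w \<in> cball (complex_of_real \<sigma>) (\<sigma> / 2)"
      hence "\<bar>Re (of_real \<sigma> - w)\<bar> \<le> \<sigma> / 2"
        using abs_Re_le_cmod[of "of_real \<sigma> - w"] by (auto simp: dist_norm)
      hence "\<sigma> - Re w \<le> \<sigma> / 2" using abs_ge_self[of "\<sigma> - Re w"] by simp
      hence "Re w > 0" using s by simp
      thus "w \<in> wedge k" using half_plane_subset_wedge[of k] k by auto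
    qed
    have inw: "complex_of_real \<sigma> \<in> wedge k" using s by (simp add: wedge_def)
    have hol: "(\<lambda>w. L w - h w) holomorphic_on wedge k"
      using L(1) h by (intro holomorphic_intros) (auto elim: holomorphic_on_subset)
    have err: "norm ((deriv ^^ n) (\<lambda>w. L w - h w) (of_real \<sigma>)) \<le> fact n * (B * exp (- \<tau> * (\<sigma> / 2))) / (\<sigma> / 2) ^ n"
    proof (rule Cauchy_inequality)
      show "(\<lambda>w. L w - h w) holomorphic_on ball (of_real \<sigma>) (\<sigma> / 2)"
        by (rule holomorphic_on_subset[OF hol]) (use sub ball_subset_cball in blast)
      show "continuous_on (cball (of_real \<sigma>) (\<sigma> / 2)) (\<lambda>w. L w - h w)"
        by (intro holomorphic_on_imp_continuous_on holomorphic_on_subset[OF hol] sub)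
      fix w assume w: "norm (complex_of_real \<sigma> - w) = \<sigma> / 2"
      hence rw: "Re w \<ge> \<sigma> / 2"
        using abs_Re_le_cmod[of "of_real \<sigma> - w"] abs_ge_self[of "\<sigma> - Re w"] by simp
      hence "norm (L w - h w) \<le> B * exp (- \<tau> * Re w)" using n by (intro B) (simp add: \<sigma>_def)
      also have "\<dots> \<le> B * exp (- \<tau> * (\<sigma> / 2))" using rw \<tau> B0 by (intro mult_left_mono) auto
      finally show "norm (L w - h w) \<le> B * exp (- \<tau> * (\<sigma> / 2))" .
    qed (use s in auto)
    have "of_real (\<sigma> ^ Suc n / fact n) * (deriv ^^ n) L (of_real \<sigma>) = (- 1) ^ n * a n"
    proof -
      have "(- of_real u) ^ n * (exp (- of_real \<sigma> * of_real u) * f u)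
         = (-1) ^ n * (of_real (u ^ n * exp (- \<sigma> * u)) * f u)" for u
        by (simp add: power_minus[of "of_real u"] exp_of_real[symmetric] mult_ac)
      hence "(deriv ^^ n) L (of_real \<sigma>) = (-1) ^ n * integral {0..\<tau>} (\<lambda>u. of_real (u ^ n * exp (- \<sigma> * u)) * f u)"
        by (simp only: L(2) integral_mult_right)
      thus ?thesis by (simp add: a_def \<sigma>_def)
    qed
    hence "norm (a n) = norm (of_real (\<sigma> ^ Suc n / fact n) * (deriv ^^ n) L (of_real \<sigma>))"
      by (simp add: norm_mult norm_power)
    also have "(deriv ^^ n) L (of_real \<sigma>) = (deriv ^^ n) h (of_real \<sigma>) + (deriv ^^ n) (\<lambda>w. L w - h w) (of_real \<sigma>)"
      using higher_deriv_diff[OF holomorphic_on_subset[OF L(1)] h open_wedge inw, of n] by simp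
    also have "norm (of_real (\<sigma> ^ Suc n / fact n) * \<dots>) \<le>
        norm (of_real (\<sigma> ^ Suc n / fact n) * (deriv ^^ n) h (of_real \<sigma>)) +
        norm (of_real (\<sigma> ^ Suc n / fact n) * (deriv ^^ n) (\<lambda>w. L w - h w) (of_real \<sigma>))"
      unfolding distrib_left by (rule norm_triangle_ineq)
    also have "norm (of_real (\<sigma> ^ Suc n / fact n) * (deriv ^^ n) h (of_real \<sigma>)) \<le> 12 * exp 3 / k * C"
      unfolding \<sigma>_def by (rule higher_deriv_wedge_bound[OF h C t n(1) k])
    also have "norm (of_real (\<sigma> ^ Suc n / fact n) * (deriv ^^ n) (\<lambda>w. L w - h w) (of_real \<sigma>)) \<le> (B / t) * (of_nat n * q ^ n)"
    proof -
      have "norm (of_real (\<sigma> ^ Suc n / fact n) * (deriv ^^ n) (\<lambda>w. L w - h w) (of_real \<sigma>)) =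
         \<sigma> ^ Suc n / fact n * norm ((deriv ^^ n) (\<lambda>w. L w - h w) (of_real \<sigma>))"
        using s by (simp add: norm_mult norm_divide norm_power)
      also have "\<dots> \<le> \<sigma> ^ Suc n / fact n * (fact n * (B * exp (- \<tau> * (\<sigma> / 2))) / (\<sigma> / 2) ^ n)"
        using s by (intro mult_left_mono err) auto
      also have "\<dots> = \<sigma> * B * (2 ^ n * exp (- \<tau> * (\<sigma> / 2)))" using s by (simp add: power_divide)
      also have "exp (- \<tau> * (\<sigma> / 2)) = exp (-2) ^ n"
        using t by (subst exp_of_nat_mult[symmetric]) (simp add: \<tau>_def \<sigma>_def)
      also have "2 ^ n * exp (-2) ^ n = q ^ n" by (simp add: q_def power_mult_distrib)
      finally show ?thesis by (simp add: \<sigma>_def mult_ac)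
    qed
    finally show ?thesis by simp
  qed
  have lim: "(\<lambda>n. 12 * exp 3 / k * C + (B / t) * (of_nat n * q ^ n)) \<longlonglongrightarrow> 12 * exp 3 / k * C + (B / t) * 0"
    using q by (intro tendsto_intros powser_times_n_limit_0) auto
  have "(\<lambda>n. norm (a n)) \<longlonglongrightarrow> norm (f t)"
    unfolding a_def by (intro tendsto_norm Post_Widder cont' t \<tau>)
  moreover have "eventually (\<lambda>n. norm (a n) \<le> 12 * exp 3 / k * C + (B / t) * (of_nat n * q ^ n)) sequentially"
    using eventually_ge_at_top[of "nat \<lceil>2 * t * s0\<rceil> + 2"]
  proof eventually_elim
    case (elim n)
    hence "real n \<ge> 2 * t * s0" by linarith
    hence "real n / t / 2 \<ge> s0" using t by (simp add: field_simps)
    thus ?case using elim by (intro bound) auto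
  qed
  ultimately show ?thesis using tendsto_le[OF sequentially_bot lim] by simp
qed

section \<open>Mapping properties of the symbol\<close>

text \<open>For \<open>0 < g < pi\<close> this is the closed sector
  \<open>0 \<le> Arg z \<le> g\<close> together with 0. Two linear inequalities make closure under
  addition evident and also make sense at 0.\<close>

definition upper_sector :: "real \<Rightarrow> complex set" where
  "upper_sector g = {z. Im z \<ge> 0 \<and> Im (z * cis (- g)) \<le> 0}"

lemma upper_sector_add: "z \<in> upper_sector g \<Longrightarrow> w \<in> upper_sector g \<Longrightarrow> z + w \<in> upper_sector g"
  by (auto simp: upper_sector_def algebra_simps)

lemma upper_sector_scale:
  assumes "z \<in> upper_sector g" "c \<ge> 0"
  shows "of_real c * z \<in> upper_sector g"
proof -
  have "Im (of_real c * z * cis (- g)) = c * Im (z * cis (- g))" by (simp add: algebra_simps)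
  moreover have "Im (of_real c * z) = c * Im z" by simp
  ultimately show ?thesis using assms by (auto simp: upper_sector_def mult_nonneg_nonpos simp del: times_complex.simps)
qed

lemma rcis_in_upper_sector:
  assumes "r \<ge> 0" "0 \<le> p" "p \<le> g" "g \<le> pi"
  shows "rcis r p \<in> upper_sector g"
proof -
  have "rcis r p * cis (- g) = rcis r (p - g)" by (simp add: rcis_def cis_mult mult.assoc)
  moreover have "sin (p - g) \<le> 0" using assms sin_ge_zero[of "g - p"] sin_minus[of "g - p"] by simp
  moreover have "sin p \<ge> 0" using assms by (intro sin_ge_zero) auto
  ultimately show ?thesis using assms by (simp add: upper_sector_def mult_nonneg_nonpos del: times_complex.simps)
qed

lemma of_real_in_upper_sector: "c \<ge> 0 \<Longrightarrow> 0 \<le> g \<Longrightarrow> g \<le> pi \<Longrightarrow> complex_of_real c \<in> upper_sector g"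
  using rcis_in_upper_sector[of c 0 g] by (simp add: rcis_def)

lemma upper_sector_Arg:
  assumes z: "z \<in> upper_sector g" "z \<noteq> 0" and g: "0 < g" "g < pi"
  shows "0 \<le> Arg z" "Arg z \<le> g"
proof -
  define p where "p = Arg z"
  have zp: "z = rcis (norm z) p" by (simp add: p_def rcis_cmod_Arg)
  have pr: "-pi < p" "p \<le> pi" using Arg_bounded[of z] by (auto simp: p_def)
  have nz: "norm z > 0" using z by simp
  have "Im z = norm z * sin p" by (metis zp Im_rcis)
  hence s: "sin p \<ge> 0" using z nz by (simp add: upper_sector_def zero_le_mult_iff)
  show "0 \<le> Arg z"
  proof (rule ccontr)
    assume "\<not> 0 \<le> Arg z"
    hence "sin (- p) > 0" using pr by (intro sin_gt_zero) (auto simp: p_def)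
    thus False using s by simp
  qed
  have "z * cis (- g) = rcis (norm z) (p - g)"
    by (subst zp) (simp add: rcis_def cis_mult mult.assoc)
  hence "norm z * sin (p - g) \<le> 0" using z by (simp add: upper_sector_def del: times_complex.simps)
  hence s': "sin (p - g) \<le> 0" using nz by (simp add: mult_le_0_iff)
  show "Arg z \<le> g"
  proof (rule ccontr)
    assume "\<not> Arg z \<le> g"
    hence "sin (p - g) > 0" using pr g by (intro sin_gt_zero) (auto simp: p_def)
    thus False using s' by simp
  qed
qed

lemma rcis_Re_ge:
  assumes "r \<ge> 0" "0 \<le> p" "p \<le> g" "g < pi"
  shows "Re (rcis r p * cis (- (g / 2))) \<ge> cos (g / 2) * r"
proof -
  have "rcis r p * cis (- (g / 2)) = rcis r (p - g / 2)" by (simp add: rcis_def cis_mult mult.assoc)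
  moreover have "cos (p - g / 2) \<ge> cos (g / 2)"
  proof -
    have "cos \<bar>p - g / 2\<bar> \<ge> cos (g / 2)" using assms by (intro cos_monotone_0_pi_le) linarith+
    thus ?thesis by simp
  qed
  ultimately show ?thesis using assms by (simp add: mult.commute mult_left_mono del: times_complex.simps)
qed

text \<open>Rotation by half the opening centres the sector on the positive axis. The result is a
  linear lower bound for the modulus, so sums of elements of the sector cannot cancel.\<close>

lemma upper_sector_Re_ge:
  assumes z: "z \<in> upper_sector g" and g: "0 < g" "g < pi"
  shows "Re (z * cis (- (g / 2))) \<ge> cos (g / 2) * norm z"
proof (cases "z = 0")
  case False
  show ?thesis using rcis_Re_ge[of "norm z" "Arg z" g] upper_sector_Arg[OF z False g] g
    by (simp add: rcis_cmod_Arg del: times_complex.simps)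
qed simp

lemma powr_of_real_eq_rcis:
  assumes "z \<noteq> 0"
  shows "z powr (of_real p) = rcis (norm z powr p) (p * Arg z)"
proof -
  have "z powr (of_real p) = exp (of_real p * (of_real (ln (norm z)) + \<i> * of_real (Arg z)))"
    using assms by (simp add: powr_def Ln_Arg)
  also have "\<dots> = exp (of_real (p * ln (norm z))) * cis (p * Arg z)"
    by (simp add: cis_conv_exp exp_add[symmetric] algebra_simps)
  also have "exp (of_real (p * ln (norm z))) = complex_of_real (norm z powr p)"
    using assms by (simp add: powr_def exp_of_real[symmetric])
  finally show ?thesis by (simp add: rcis_def)
qed

lemma powr_in_upper_sector:
  assumes z: "z \<in> upper_sector g" and g: "0 < g" "g < pi" and p: "0 \<le> p" "p * g \<le> g'" "g' \<le> pi"
  shows "z powr (of_real p) \<in> upper_sector g'"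
proof (cases "z = 0")
  case False
  have a: "0 \<le> Arg z" "Arg z \<le> g" using upper_sector_Arg[OF z False g] by auto
  have "p * Arg z \<le> p * g" using a p by (intro mult_left_mono) auto
  thus ?thesis unfolding powr_of_real_eq_rcis[OF False]
    using a p by (intro rcis_in_upper_sector) auto
qed (simp add: upper_sector_def)

section \<open>Increments of complex powers along a ray starting at the vertex
  \<open>r\<close>\<close>

context
  fixes r \<rho> \<phi> \<theta> :: real and s :: complex and w :: "real \<Rightarrow> complex"
  assumes r: "r > 0" and \<rho>: "\<rho> > 0" and \<phi>: "0 \<le> \<phi>" "\<phi> \<le> \<theta>" and \<theta>: "0 < \<theta>" "\<theta> < pi"
    and s: "s = rcis \<rho> \<phi>" and w: "\<And>\<tau>. w \<tau> = of_real r + of_real \<tau> * s"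
begin

lemma ray_Arg:
  assumes "0 \<le> \<tau>"
  shows "w \<tau> \<notin> \<real>\<^sub>\<le>\<^sub>0" "w \<tau> \<noteq> 0" "0 \<le> Arg (w \<tau>)" "Arg (w \<tau>) \<le> \<phi>"
proof -
  have "w \<tau> \<notin> \<real>\<^sub>\<le>\<^sub>0 \<and> 0 \<le> Arg (w \<tau>) \<and> Arg (w \<tau>) \<le> \<phi>"
  \<comment> \<open>The set \<open>upper_sector 0\<close> is the whole real line and would not
    exclude the negative axis, so the real ray is computed directly.\<close>
  proof (cases "\<phi> = 0")
    case True
    have "w \<tau> = of_real (r + \<tau> * \<rho>)" by (simp add: w s True rcis_def)
    moreover have "r + \<tau> * \<rho> > 0" using r \<rho> assms by (intro add_pos_nonneg) auto
    ultimately show ?thesis using True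
      by (simp add: complex_nonpos_Reals_iff Arg_of_real del: of_real_add of_real_mult)
  next
    case False
    hence p: "0 < \<phi>" "\<phi> < pi" using \<phi> \<theta> by auto
    have c: "w \<tau> \<in> upper_sector \<phi>" unfolding w s
      by (intro upper_sector_add upper_sector_scale of_real_in_upper_sector rcis_in_upper_sector) (use p assms r \<rho> in auto)
    have "w \<tau> \<notin> \<real>\<^sub>\<le>\<^sub>0"
    proof (cases "\<tau> = 0")
      case False
      have "Im (w \<tau>) > 0" using False assms \<rho> p by (simp add: w s sin_gt_zero)
      thus ?thesis by (simp add: complex_nonpos_Reals_iff)
    qed (use r in \<open>simp add: w complex_nonpos_Reals_iff\<close>)
    moreover from this have "w \<tau> \<noteq> 0" by auto
    ultimately show ?thesis using upper_sector_Arg[OF c _ p] by auto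
  qed
  thus "w \<tau> \<notin> \<real>\<^sub>\<le>\<^sub>0" "0 \<le> Arg (w \<tau>)" "Arg (w \<tau>) \<le> \<phi>" by auto
  thus "w \<tau> \<noteq> 0" by auto
qed

text \<open>The polar form displays the direction of the velocity,
  \<open>\<phi> + (p - 1) * Arg (w \<tau>)\<close>, on which everything below rests. With
  \<open>c\<close> arbitrary, \<open>Re (c * _)\<close> runs through all real linear functionals on
  the plane.\<close>

lemma powr_ray_deriv:
  assumes "0 \<le> \<tau>"
  shows "((\<lambda>\<tau>. Re (c * w \<tau> powr of_real p)) has_real_derivative
      Re (c * rcis (p * norm (w \<tau>) powr (p - 1) * \<rho>) (\<phi> + (p - 1) * Arg (w \<tau>)))) (at \<tau>)"
proof -
  have wd: "(w has_vector_derivative s) (at \<tau>)"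
    unfolding w[abs_def] by (auto intro!: derivative_eq_intros)
  have "((\<lambda>\<tau>. w \<tau> powr of_real p) has_vector_derivative s * (of_real p * w \<tau> powr (of_real p - 1))) (at \<tau>)"
    using field_vector_diff_chain_at[OF wd has_field_derivative_powr[OF ray_Arg(1)[OF assms], of "of_real p"]]
    by (simp add: o_def)
  also have "of_real p - 1 = complex_of_real (p - 1)" by simp
  also have "w \<tau> powr complex_of_real (p - 1) = rcis (norm (w \<tau>) powr (p - 1)) ((p - 1) * Arg (w \<tau>))"
    by (rule powr_of_real_eq_rcis[OF ray_Arg(2)[OF assms]])
  also have "s * (of_real p * \<dots>) = rcis (p * norm (w \<tau>) powr (p - 1) * \<rho>) (\<phi> + (p - 1) * Arg (w \<tau>))"
    by (simp add: s rcis_def cis_mult[symmetric] mult_ac)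
  finally have "((\<lambda>\<tau>. c * w \<tau> powr of_real p) has_vector_derivative
      c * rcis (p * norm (w \<tau>) powr (p - 1) * \<rho>) (\<phi> + (p - 1) * Arg (w \<tau>))) (at \<tau>)"
    by (intro has_vector_derivative_mult_right)
  hence "((\<lambda>\<tau>. Re (c * w \<tau> powr of_real p)) has_vector_derivative
      Re (c * rcis (p * norm (w \<tau>) powr (p - 1) * \<rho>) (\<phi> + (p - 1) * Arg (w \<tau>)))) (at \<tau>)"
    by (rule bounded_linear.has_vector_derivative[OF bounded_linear_Re])
  thus ?thesis by (simp add: has_real_derivative_iff_has_vector_derivative)
qed

text \<open>A comparison principle for one linear functional of the increment: \<open>m = 0\<close>
  yields half-plane conditions, \<open>m \<tau> = K * \<tau> powr p\<close> a quantitative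
  bound.\<close>

lemma powr_ray_increment:
  assumes le: "\<And>\<tau>. 0 < \<tau> \<Longrightarrow> \<tau> < 1 \<Longrightarrow> m' \<tau> \<le>
      Re (c * rcis (p * norm (w \<tau>) powr (p - 1) * \<rho>) (\<phi> + (p - 1) * Arg (w \<tau>)))"
    and m: "\<And>\<tau>. 0 < \<tau> \<Longrightarrow> \<tau> < 1 \<Longrightarrow> (m has_real_derivative m' \<tau>) (at \<tau>)" "continuous_on {0..1} m"
  shows "m 1 - m 0 \<le> Re (c * ((of_real r + s) powr of_real p - of_real r powr of_real p))"
proof -
  define f where "f \<tau> = Re (c * w \<tau> powr of_real p) - m \<tau>" for \<tau>
  have "f 0 \<le> f 1"
  proof (rule DERIV_nonneg_imp_increasing_open[where f = f and a = 0 and b = 1])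
    fix \<tau> :: real assume t: "0 < \<tau>" "\<tau> < 1"
    have "(f has_real_derivative Re (c * rcis (p * norm (w \<tau>) powr (p - 1) * \<rho>) (\<phi> + (p - 1) * Arg (w \<tau>))) - m' \<tau>) (at \<tau>)"
      unfolding f_def using t by (intro DERIV_diff powr_ray_deriv m) auto
    thus "\<exists>y. (f has_real_derivative y) (at \<tau>) \<and> y \<ge> 0" using le[OF t] by force
  next
    have "isCont (\<lambda>\<tau>. Re (c * w \<tau> powr of_real p)) \<tau>" if "\<tau> \<in> {0..1}" for \<tau>
      using powr_ray_deriv that DERIV_isCont by fastforce
    thus "continuous_on {0..1} f" unfolding f_def
      by (intro continuous_on_diff m(2) continuous_at_imp_continuous_on) auto
  qed simp
  thus ?thesis by (simp add: f_def w algebra_simps)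
qed

text \<open>A closed convex cone that contains all velocities contains the increment. The two
  half-planes of the sector are tested with \<open>c = - i\<close> and
  \<open>c = i * cis (- g)\<close>.\<close>

lemma powr_ray_increment_in_upper_sector:
  assumes p: "0 \<le> p" and g: "0 \<le> g" "g < pi" and arg: "\<And>\<tau>. 0 < \<tau> \<Longrightarrow> \<tau> < 1 \<Longrightarrow> 0 \<le> \<phi> + (p - 1) * Arg (w \<tau>) \<and> \<phi> + (p - 1) * Arg (w \<tau>) \<le> g"
  shows "(of_real r + s) powr of_real p - of_real r powr of_real p \<in> upper_sector g"
proof -
  let ?v = "\<lambda>\<tau>. rcis (p * norm (w \<tau>) powr (p - 1) * \<rho>) (\<phi> + (p - 1) * Arg (w \<tau>))"
  let ?D = "(of_real r + s) powr of_real p - of_real r powr of_real p"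
  have v: "?v \<tau> \<in> upper_sector g" if "0 < \<tau>" "\<tau> < 1" for \<tau>
    using arg[OF that] p \<rho> g by (intro rcis_in_upper_sector) auto
  have "(0::real) - 0 \<le> Re (- \<i> * ?D)"
  proof (rule powr_ray_increment[where m = "\<lambda>_. 0" and m' = "\<lambda>_. 0"])
    show "0 \<le> Re (- \<i> * ?v \<tau>)" if "0 < \<tau>" "\<tau> < 1" for \<tau>
      using v[OF that] by (simp add: upper_sector_def)
  qed auto
  moreover have "(0::real) - 0 \<le> Re (\<i> * cis (- g) * ?D)"
  proof (rule powr_ray_increment[where m = "\<lambda>_. 0" and m' = "\<lambda>_. 0"])
    show "0 \<le> Re (\<i> * cis (- g) * ?v \<tau>)" if "0 < \<tau>" "\<tau> < 1" for \<tau>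
      using v[OF that] by (simp add: upper_sector_def algebra_simps)
  qed auto
  ultimately show ?thesis by (simp add: upper_sector_def algebra_simps)
qed

text \<open>The speed is \<open>p * \<rho> * norm (w \<tau>) powr (p - 1)\<close> in a direction
  within the sector of opening \<open>p * \<theta>\<close>, and \<open>norm (w \<tau>)\<close> is at
  least \<open>cos (\<theta> / 2) * \<tau>\<close> times the modulus of the endpoint. Integration
  keeps the factor \<open>\<rho>\<close>, the distance to the vertex, which finally produces the
  decay of \<open>h\<close> in \<open>norm s\<close>.\<close>

lemma powr_ray_increment_lower_bound:
  assumes p: "1 \<le> p" "p * \<theta> < pi"
  shows "cos (p * \<theta> / 2) * cos (\<theta> / 2) powr (p - 1) * \<rho> * norm (of_real r + s) powr (p - 1) \<le>
    Re (((of_real r + s) powr of_real p - of_real r powr of_real p) * cis (- (p * \<theta> / 2)))"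
proof -
  let ?v = "\<lambda>\<tau>. rcis (p * norm (w \<tau>) powr (p - 1) * \<rho>) (\<phi> + (p - 1) * Arg (w \<tau>))"
  let ?z = "of_real r + s"
  define K where "K = cos (p * \<theta> / 2) * cos (\<theta> / 2) powr (p - 1) * \<rho> * norm ?z powr (p - 1)"
  define m where "m \<tau> = K * \<tau> powr p" for \<tau> :: real
  have c1: "cos (\<theta> / 2) > 0" using \<theta> by (intro cos_gt_zero_pi) auto
  have c2: "cos (p * \<theta> / 2) > 0" using p \<theta> by (intro cos_gt_zero_pi) (auto intro: less_le_trans[of _ 0])
  have z: "?z \<in> upper_sector \<theta>" unfolding s by (intro upper_sector_add of_real_in_upper_sector rcis_in_upper_sector) (use r \<rho> \<theta> \<phi> in auto)
  have "m 1 - m 0 \<le> Re (cis (- (p * \<theta> / 2)) * (?z powr of_real p - of_real r powr of_real p))"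
  proof (rule powr_ray_increment[where m' = "\<lambda>\<tau>. K * (p * \<tau> powr (p - 1))"])
    fix \<tau> :: real assume t: "0 < \<tau>" "\<tau> < 1"
    show "(m has_real_derivative K * (p * \<tau> powr (p - 1))) (at \<tau>)"
      unfolding m_def using t by (auto intro!: derivative_eq_intros)
    have wz: "cos (\<theta> / 2) * \<tau> * norm ?z \<le> norm (w \<tau>)"
    proof -
      \<comment> \<open>On the segment \<open>w \<tau>\<close> is a convex combination of the
        endpoint and \<open>r\<close>; both have nonnegative component in the direction
        \<open>\<theta> / 2\<close>.\<close>
      have "w \<tau> = of_real \<tau> * ?z + of_real ((1 - \<tau>) * r)" by (simp add: w algebra_simps)
      hence "Re (w \<tau> * cis (- (\<theta> / 2))) = \<tau> * Re (?z * cis (- (\<theta> / 2))) + (1 - \<tau>) * r * cos (\<theta> / 2)"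
        by (simp add: algebra_simps)
      moreover have "\<tau> * (cos (\<theta> / 2) * norm ?z) \<le> \<tau> * Re (?z * cis (- (\<theta> / 2)))"
        using t by (intro mult_left_mono upper_sector_Re_ge z \<theta>) auto
      moreover have "0 \<le> (1 - \<tau>) * r * cos (\<theta> / 2)" using t r c1 by auto
      moreover have "Re (w \<tau> * cis (- (\<theta> / 2))) \<le> norm (w \<tau>)"
        using complex_Re_le_cmod[of "w \<tau> * cis (- (\<theta> / 2))"] by (simp add: norm_mult)
      ultimately show ?thesis by (simp add: mult_ac)
    qed
    have a: "0 \<le> Arg (w \<tau>)" "Arg (w \<tau>) \<le> \<phi>" using ray_Arg[of \<tau>] t by auto
    have up: "\<phi> + (p - 1) * Arg (w \<tau>) \<le> p * \<theta>"
    proof -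
      have "(p - 1) * Arg (w \<tau>) \<le> (p - 1) * \<theta>" using a p \<phi> by (intro mult_left_mono) auto
      thus ?thesis using \<phi> by (simp add: algebra_simps)
    qed
    have "K * (p * \<tau> powr (p - 1)) = cos (p * \<theta> / 2) * (p * (cos (\<theta> / 2) * \<tau> * norm ?z) powr (p - 1) * \<rho>)"
      using c1 t by (simp add: K_def powr_mult mult_ac)
    also have "\<dots> \<le> cos (p * \<theta> / 2) * (p * norm (w \<tau>) powr (p - 1) * \<rho>)"
      using wz c1 c2 t p \<rho> by (intro mult_left_mono mult_right_mono powr_mono2) auto
    also have "\<dots> \<le> Re (?v \<tau> * cis (- (p * \<theta> / 2)))"
      using a p \<rho> \<phi> up by (intro rcis_Re_ge) (auto intro!: add_nonneg_nonneg mult_nonneg_nonneg)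
    finally show "K * (p * \<tau> powr (p - 1)) \<le> Re (cis (- (p * \<theta> / 2)) * ?v \<tau>)" by (simp add: mult.commute)
  next
    show "continuous_on {0..1} m" unfolding m_def using p by (intro continuous_intros continuous_on_powr') auto
  qed
  thus ?thesis by (simp add: m_def K_def mult.commute)
qed

end

text \<open>Along the ray \<open>0 \<le> Arg w \<le> \<phi> \<le> \<theta>\<close>. For exponent
  \<open>\<mu> + 1\<close> the velocity has direction \<open>\<phi> + \<mu> * Arg w\<close>, at most
  \<open>(\<mu> + 1) * \<theta>\<close>; for exponent \<open>\<mu>\<close> it has
  \<open>\<phi> - (1 - \<mu>) * Arg w\<close>, which stays between 0 and \<open>\<phi>\<close> as
  \<open>0 < \<mu> \<le> 1\<close>.\<close>

lemma powr_increment: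
  fixes r \<rho> \<phi> \<theta> \<mu> :: real and s :: complex
  assumes r: "r \<ge> 0" and \<rho>: "\<rho> > 0" and \<phi>: "0 \<le> \<phi>" "\<phi> \<le> \<theta>" and \<theta>: "0 < \<theta>" "\<theta> < pi"
    and s: "s = rcis \<rho> \<phi>" and \<mu>: "0 < \<mu>" "\<mu> \<le> 1" "(\<mu> + 1) * \<theta> < pi"
  shows "(of_real r + s) powr of_real (\<mu> + 1) - of_real r powr of_real (\<mu> + 1) \<in> upper_sector ((\<mu> + 1) * \<theta>)" (is ?A)
    and "(of_real r + s) powr of_real \<mu> - of_real r powr of_real \<mu> \<in> upper_sector \<theta>" (is ?B)
    and "cos ((\<mu> + 1) * \<theta> / 2) * cos (\<theta> / 2) powr \<mu> * \<rho> * norm (of_real r + s) powr \<mu> \<le>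
      Re (((of_real r + s) powr of_real (\<mu> + 1) - of_real r powr of_real (\<mu> + 1)) * cis (- ((\<mu> + 1) * \<theta> / 2)))" (is ?C)
proof -
  have "?A \<and> ?B \<and> ?C"
  \<comment> \<open>For \<open>r = 0\<close> the ray starts at the branch point, and the three
    claims are read off from the polar form of the powers of \<open>s\<close>.\<close>
  proof (cases "r = 0")
    case False
    define w where "w \<tau> = of_real r + of_real \<tau> * s" for \<tau>
    from False r have r': "r > 0" by simp
    note ctx = r' \<rho> \<phi> \<theta> s w_def
    have a: "0 \<le> Arg (w \<tau>)" "Arg (w \<tau>) \<le> \<phi>" if "0 < \<tau>" for \<tau>
      using ray_Arg[OF ctx, of \<tau>] that by auto
    have ?A
    proof (rule powr_ray_increment_in_upper_sector[OF ctx])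
      fix \<tau> :: real assume "0 < \<tau>"
      note a = a[OF this]
      have "\<mu> * Arg (w \<tau>) \<le> \<mu> * \<theta>" using a \<mu> \<phi> by (intro mult_left_mono) auto
      thus "0 \<le> \<phi> + (\<mu> + 1 - 1) * Arg (w \<tau>) \<and> \<phi> + (\<mu> + 1 - 1) * Arg (w \<tau>) \<le> (\<mu> + 1) * \<theta>"
        using a \<mu> \<phi> mult_nonneg_nonneg[of \<mu> "Arg (w \<tau>)"]
        unfolding add_diff_cancel_right' distrib_right by (intro conjI) linarith+
    qed (use \<mu> \<theta> in auto)
    moreover have ?B
    proof (rule powr_ray_increment_in_upper_sector[OF ctx])
      fix \<tau> :: real assume "0 < \<tau>"
      note a = a[OF this]
      have "(1 - \<mu>) * Arg (w \<tau>) \<le> 1 * \<phi>" using a \<mu> \<phi> by (intro mult_mono) auto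
      moreover have "0 \<le> (1 - \<mu>) * Arg (w \<tau>)" using a \<mu> by auto
      ultimately show "0 \<le> \<phi> + (\<mu> - 1) * Arg (w \<tau>) \<and> \<phi> + (\<mu> - 1) * Arg (w \<tau>) \<le> \<theta>"
        using \<phi> by (auto simp: algebra_simps)
    qed (use \<mu> \<theta> in auto)
    moreover have ?C using powr_ray_increment_lower_bound[OF ctx, of "\<mu> + 1"] \<mu> by simp
    ultimately show ?thesis by simp
  next
    case True
    have sc: "s \<in> upper_sector \<theta>" unfolding s by (rule rcis_in_upper_sector) (use \<rho> \<phi> \<theta> in auto)
    have ns: "norm s = \<rho>" "s \<noteq> 0" using \<rho> by (auto simp: s)
    have mt: "\<mu> * \<theta> \<le> 1 * \<theta>" using \<mu> \<theta> by (intro mult_right_mono) auto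
    have A: "s powr of_real (\<mu> + 1) \<in> upper_sector ((\<mu> + 1) * \<theta>)"
      by (rule powr_in_upper_sector[OF sc \<theta>]) (use \<mu> in auto)
    have B: "s powr of_real \<mu> \<in> upper_sector \<theta>"
      by (rule powr_in_upper_sector[OF sc \<theta>]) (use \<mu> \<theta> mt in auto)
    have c1: "0 \<le> cos (\<theta> / 2) powr \<mu>" "cos (\<theta> / 2) powr \<mu> \<le> 1"
      using \<theta> \<mu> cos_gt_zero_pi[of "\<theta> / 2"] by (auto intro!: powr_le1)
    have c2: "cos ((\<mu> + 1) * \<theta> / 2) > 0"
      using \<mu> \<theta> mult_pos_pos[of "\<mu> + 1" \<theta>] by (intro cos_gt_zero_pi) linarith+
    have "cos ((\<mu> + 1) * \<theta> / 2) * cos (\<theta> / 2) powr \<mu> * \<rho> * norm s powr \<mu> \<le> cos ((\<mu> + 1) * \<theta> / 2) * 1 * \<rho> * norm s powr \<mu>"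
      using c1 c2 \<rho> by (intro mult_right_mono mult_left_mono) auto
    also have "\<dots> = cos ((\<mu> + 1) * \<theta> / 2) * norm (s powr of_real (\<mu> + 1))"
      using ns \<rho> by (simp add: powr_of_real_eq_rcis[OF ns(2)] powr_add mult_ac del: of_real_add)
    also have "\<dots> \<le> Re (s powr of_real (\<mu> + 1) * cis (- ((\<mu> + 1) * \<theta> / 2)))"
      by (rule upper_sector_Re_ge[OF A]) (use \<mu> \<theta> mult_pos_pos[of "\<mu> + 1" \<theta>] in linarith)+
    finally show ?thesis using A B True by simp
  qed
  thus ?A ?B ?C by auto
qed

text \<open>The lemma is applied with \<open>a = - (\<beta> + \<omega>)\<close>,
  \<open>b = r powr (\<mu> + 1) - \<omega> * \<alpha>\<close> and
  \<open>d = r powr \<mu> + \<alpha>\<close>, where \<open>N / Q\<close> is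
  \<open>g - \<omega>\<close>. All parts of \<open>N\<close> lie in one sector, so
  \<open>norm N\<close> inherits the lower bound of its increment, whose factor
  \<open>norm z powr \<mu>\<close> cancels in the quotient.\<close>

lemma symbol_estimates_upper:
  fixes r a b d \<theta> \<mu> :: real and s :: complex
  assumes r: "r \<ge> 0" and a: "a \<ge> 0" and b: "b \<ge> 0" and d: "d > 0"
    and s: "s \<in> wedge (- cos \<theta> / sin \<theta>)" "Im s \<ge> 0"
    and \<theta>: "0 < \<theta>" "\<theta> < pi" and \<mu>: "0 < \<mu>" "\<mu> \<le> 1" "(\<mu> + 1) * \<theta> < pi"
  defines "z \<equiv> of_real r + s"
  defines "N \<equiv> (z powr of_real (\<mu> + 1) - of_real r powr of_real (\<mu> + 1)) + of_real a * z powr of_real \<mu> + of_real b"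
    and "Q \<equiv> (z powr of_real \<mu> - of_real r powr of_real \<mu>) + of_real d"
    and "K \<equiv> cos ((\<mu> + 1) * \<theta> / 2) * cos (\<theta> / 2) powr \<mu>"
  shows "z \<notin> \<real>\<^sub>\<le>\<^sub>0 \<and> Q \<noteq> 0 \<and> N \<noteq> 0 \<and> norm (z powr of_real \<mu>) / norm N \<le> 1 / (K * norm s) \<and> \<bar>Arg (N / Q)\<bar> \<le> (\<mu> + 1) * \<theta>"
proof -
  define p where "p = \<mu> + 1"
  have sin: "sin \<theta> > 0" using \<theta> by (intro sin_gt_zero)
  define \<rho> \<phi> where "\<rho> = norm s" and "\<phi> = Arg s"
  have s0: "s \<noteq> 0" using s(1) wedge_nonzero by auto
  hence \<rho>: "\<rho> > 0" by (simp add: \<rho>_def)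
  have sr: "s = rcis \<rho> \<phi>" by (simp add: \<rho>_def \<phi>_def rcis_cmod_Arg)
  \<comment> \<open>Multiplied by \<open>sin \<theta>\<close>, the wedge inequality for
    \<open>Im s \<ge> 0\<close> says that \<open>s * cis (- \<theta>)\<close> has negative imaginary
    part.\<close>
  have sc: "s \<in> upper_sector \<theta>"
  proof -
    have "Re s - cos \<theta> / sin \<theta> * Im s > 0" using s by (simp add: wedge_def)
    hence "Re s * sin \<theta> - cos \<theta> * Im s > 0" using sin by (simp add: field_simps)
    thus ?thesis using s(2) by (simp add: upper_sector_def algebra_simps)
  qed
  have \<phi>: "0 \<le> \<phi>" "\<phi> \<le> \<theta>" using upper_sector_Arg[OF sc s0 \<theta>] by (auto simp: \<phi>_def)
  have p\<theta>: "0 < p * \<theta>" "p * \<theta> < pi" "\<theta> \<le> p * \<theta>" "\<mu> * \<theta> \<le> p * \<theta>" 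
    using \<mu> \<theta> mult_pos_pos[of \<mu> \<theta>] unfolding p_def distrib_right by linarith+
  note inc = powr_increment[OF r \<rho> \<phi> \<theta> sr \<mu>, folded z_def p_def]
  have zc: "z \<in> upper_sector \<theta>" unfolding z_def by (intro upper_sector_add of_real_in_upper_sector sc) (use r \<theta> in auto)
  have cpos: "cos (g / 2) > 0" if "0 < g" "g < pi" for g using that by (intro cos_gt_zero_pi) auto
  have K: "K > 0" using cpos[OF \<theta>] cpos[OF p\<theta>(1,2)] by (simp add: K_def p_def)
  have znR: "z \<notin> \<real>\<^sub>\<le>\<^sub>0"
  proof
    assume "z \<in> \<real>\<^sub>\<le>\<^sub>0"
    hence "Im s = 0" "Re s \<le> 0" using r by (auto simp: z_def complex_nonpos_Reals_iff)
    thus False using s(1) by (simp add: wedge_def)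
  qed
  hence z0: "z \<noteq> 0" by auto
  have zm: "z powr of_real \<mu> \<in> upper_sector (p * \<theta>)"
    by (rule powr_in_upper_sector[OF zc \<theta>]) (use \<mu> p\<theta> in auto)
  let ?D = "z powr of_real p - of_real r powr of_real p"
  have rest: "of_real a * z powr of_real \<mu> + of_real b \<in> upper_sector (p * \<theta>)"
    by (intro upper_sector_add upper_sector_scale zm of_real_in_upper_sector) (use a b p\<theta> in auto)
  have Ne: "N = ?D + (of_real a * z powr of_real \<mu> + of_real b)" by (simp add: N_def p_def)
  have Nc: "N \<in> upper_sector (p * \<theta>)" unfolding Ne by (intro upper_sector_add inc(1) rest)
  have "K * norm s * norm z powr \<mu> \<le> Re (?D * cis (- (p * \<theta> / 2)))"
    using inc(3) by (simp add: K_def \<rho>_def p_def mult_ac)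
  also have "\<dots> \<le> Re (N * cis (- (p * \<theta> / 2)))"
  proof -
    have "0 \<le> cos (p * \<theta> / 2) * norm (of_real a * z powr of_real \<mu> + of_real b)"
      using cpos[OF p\<theta>(1,2)] by simp
    also have "\<dots> \<le> Re ((of_real a * z powr of_real \<mu> + of_real b) * cis (- (p * \<theta> / 2)))"
      by (rule upper_sector_Re_ge[OF rest p\<theta>(1,2)])
    finally show ?thesis unfolding Ne distrib_right by simp
  qed
  also have "\<dots> \<le> norm N" using complex_Re_le_cmod[of "N * cis (- (p * \<theta> / 2))"] by (simp add: norm_mult)
  finally have lower: "K * norm s * norm z powr \<mu> \<le> norm N" .
  have zpos: "norm z powr \<mu> > 0" using z0 by simp
  have pos: "K * norm s * norm z powr \<mu> > 0" using K s0 zpos by simp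
  have N0: "N \<noteq> 0" using lower pos by auto
  have quot: "norm (z powr of_real \<mu>) / norm N \<le> 1 / (K * norm s)"
  proof -
    have "norm (z powr of_real \<mu>) = norm z powr \<mu>"
      unfolding powr_of_real_eq_rcis[OF z0] by simp
    moreover have "norm z powr \<mu> / norm N \<le> norm z powr \<mu> / (K * norm s * norm z powr \<mu>)"
      using N0 by (intro divide_left_mono lower mult_pos_pos pos) auto
    ultimately have "norm (z powr of_real \<mu>) / norm N \<le> norm z powr \<mu> / (K * norm s * norm z powr \<mu>)"
      by simp
    also have "\<dots> = 1 / (K * norm s)" using zpos by simp
    finally show ?thesis .
  qed
  have Qc: "Q \<in> upper_sector \<theta>" unfolding Q_def by (intro upper_sector_add inc(2) of_real_in_upper_sector) (use d \<theta> in auto)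
  have Q0: "Q \<noteq> 0"
  proof -
    have "0 \<le> cos (\<theta> / 2) * norm (z powr of_real \<mu> - of_real r powr of_real \<mu>)" using cpos[OF \<theta>] by simp
    also have "\<dots> \<le> Re ((z powr of_real \<mu> - of_real r powr of_real \<mu>) * cis (- (\<theta> / 2)))"
      by (rule upper_sector_Re_ge[OF inc(2) \<theta>])
    finally have "0 \<le> Re ((z powr of_real \<mu> - of_real r powr of_real \<mu>) * cis (- (\<theta> / 2)))" .
    moreover have "0 < Re (of_real d * cis (- (\<theta> / 2)))" using d cpos[OF \<theta>] by simp
    ultimately have "Re (Q * cis (- (\<theta> / 2))) > 0"
      unfolding Q_def distrib_right plus_complex.simps by (rule add_nonneg_pos)
    thus ?thesis by auto
  qed
  \<comment> \<open>Both arguments lie in \<open>[0, pi)\<close>, so their difference needs no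
    reduction modulo \<open>2 * pi\<close>; it lies between \<open>- \<theta>\<close> and
    \<open>(\<mu> + 1) * \<theta>\<close>.\<close>
  have "N / Q = rcis (norm N) (Arg N) / rcis (norm Q) (Arg Q)" by (simp add: rcis_cmod_Arg)
  also have "\<dots> = rcis (norm N / norm Q) (Arg N - Arg Q)" by (simp add: rcis_divide)
  finally have "Arg (N / Q) = Arg N - Arg Q"
    using upper_sector_Arg[OF Nc N0 p\<theta>(1,2)] upper_sector_Arg[OF Qc Q0 \<theta>] N0 Q0 p\<theta> \<theta> by (simp add: Arg_rcis)
  hence "\<bar>Arg (N / Q)\<bar> \<le> p * \<theta>"
    using upper_sector_Arg[OF Nc N0 p\<theta>(1,2)] upper_sector_Arg[OF Qc Q0 \<theta>] p\<theta> by linarith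
  with znR Q0 N0 quot show ?thesis by (simp add: p_def)
qed

text \<open>The lower half of the wedge follows by conjugation: all coefficients are real, and off
  the real axis powers with real exponent commute with \<open>cnj\<close>.\<close>

lemma symbol_estimates:
  fixes r a b d \<theta> \<mu> :: real and s :: complex
  assumes r: "r \<ge> 0" and a: "a \<ge> 0" and b: "b \<ge> 0" and d: "d > 0"
    and s: "s \<in> wedge (- cos \<theta> / sin \<theta>)"
    and \<theta>: "0 < \<theta>" "\<theta> < pi" and \<mu>: "0 < \<mu>" "\<mu> \<le> 1" "(\<mu> + 1) * \<theta> < pi"
  defines "z \<equiv> of_real r + s"
  defines "N \<equiv> (z powr of_real (\<mu> + 1) - of_real r powr of_real (\<mu> + 1)) + of_real a * z powr of_real \<mu> + of_real b"
    and "Q \<equiv> (z powr of_real \<mu> - of_real r powr of_real \<mu>) + of_real d"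
    and "K \<equiv> cos ((\<mu> + 1) * \<theta> / 2) * cos (\<theta> / 2) powr \<mu>"
  shows "z \<notin> \<real>\<^sub>\<le>\<^sub>0" "Q \<noteq> 0" "N \<noteq> 0" "norm (z powr of_real \<mu>) / norm N \<le> 1 / (K * norm s)" "\<bar>Arg (N / Q)\<bar> \<le> (\<mu> + 1) * \<theta>"
proof -
  have "z \<notin> \<real>\<^sub>\<le>\<^sub>0 \<and> Q \<noteq> 0 \<and> N \<noteq> 0 \<and> norm (z powr of_real \<mu>) / norm N \<le> 1 / (K * norm s) \<and> \<bar>Arg (N / Q)\<bar> \<le> (\<mu> + 1) * \<theta>"
  proof (cases "Im s \<ge> 0")
    case True
    show ?thesis unfolding z_def N_def Q_def K_def
      by (rule symbol_estimates_upper[OF r a b d s True \<theta> \<mu>])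
  next
    case False
    have cs: "cnj s \<in> wedge (- cos \<theta> / sin \<theta>)" "Im (cnj s) \<ge> 0" using s False by (auto simp: wedge_def)
    have czr: "of_real r + cnj s = cnj z" by (simp add: z_def)
    have zi: "Im z \<noteq> 0" using False by (simp add: z_def)
    have cp: "cnj z powr of_real q = cnj (z powr of_real q)" for q
      using cnj_powr[of z "of_real q"] zi by simp
    have cr: "complex_of_real r powr of_real q = of_real (r powr q)" for q using r by (simp add: powr_of_real)
    have cN: "(cnj z powr of_real (\<mu> + 1) - of_real r powr of_real (\<mu> + 1)) + of_real a * cnj z powr of_real \<mu> + of_real b = cnj N"
      unfolding N_def cp cr by simp
    have cQ: "(cnj z powr of_real \<mu> - of_real r powr of_real \<mu>) + of_real d = cnj Q"
      unfolding Q_def cp cr by simp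
    have "cnj z \<notin> \<real>\<^sub>\<le>\<^sub>0 \<and> cnj Q \<noteq> 0 \<and> cnj N \<noteq> 0 \<and> norm (cnj z powr of_real \<mu>) / norm (cnj N) \<le> 1 / (K * norm (cnj s)) \<and> \<bar>Arg (cnj N / cnj Q)\<bar> \<le> (\<mu> + 1) * \<theta>"
      using symbol_estimates_upper[OF r a b d cs \<theta> \<mu>] unfolding czr cN cQ K_def .
    moreover have "\<bar>Arg (cnj N / cnj Q)\<bar> = \<bar>Arg (N / Q)\<bar>"
      using Arg_cnj[of "N / Q"] by simp
    ultimately show ?thesis unfolding cp by (simp add: complex_nonpos_Reals_iff)
  qed
  thus "z \<notin> \<real>\<^sub>\<le>\<^sub>0" "Q \<noteq> 0" "N \<noteq> 0" "norm (z powr of_real \<mu>) / norm N \<le> 1 / (K * norm s)" "\<bar>Arg (N / Q)\<bar> \<le> (\<mu> + 1) * \<theta>" by auto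
qed

section \<open>Laplace transform of the Volterra equation\<close>

text \<open>Fubini on the triangle \<open>0 \<le> s \<le> t \<le> \<tau>\<close>. On the right the
  integral of \<open>a\<close> stops at \<open>\<tau> - s\<close>: this is the only source of error
  when the convolution theorem is applied on a bounded interval.\<close>

lemma integral_convolution_swap:
  fixes a b :: "real \<Rightarrow> complex"
  assumes a: "continuous_on {0..\<tau>} a" and b: "continuous_on {0..\<tau>} b"
  shows "integral {0..\<tau>} (\<lambda>t. integral {0..t} (\<lambda>s. a (t - s) * b s)) =
         integral {0..\<tau>} (\<lambda>s. b s * integral {0..\<tau> - s} a)"
proof -
  define T where "T = {p :: real \<times> real. 0 \<le> snd p \<and> snd p \<le> fst p \<and> fst p \<le> \<tau>}"
  define f where "f p = indicator T p *\<^sub>R (a (fst p - snd p) * b (snd p))" for p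
  have "T = ({0..\<tau>} \<times> {0..\<tau>}) \<inter> {p. snd p \<le> fst p}" by (auto simp: T_def)
  hence T: "compact T"
    by (simp add: compact_Int_closed compact_Times closed_Collect_le continuous_on_fst continuous_on_snd)
  have "continuous_on T (\<lambda>p. a (fst p - snd p) * b (snd p))"
    by (intro continuous_intros continuous_on_compose2[OF a] continuous_on_compose2[OF b]) (auto simp: T_def)
  from borel_integrable_compact[OF T this] have int: "integrable (lborel \<Otimes>\<^sub>M lborel) f"
    unfolding f_def lborel_prod .
  have cont1: "continuous_on {0..t} (\<lambda>s. a (t - s) * b s)" if "t \<le> \<tau>" for t
    using that by (intro continuous_intros continuous_on_compose2[OF a] continuous_on_compose2[OF b]) auto
  have in1: "(\<integral>s. f (t, s) \<partial>lborel) = indicator {0..\<tau>} t *\<^sub>R integral {0..t} (\<lambda>s. a (t - s) * b s)" for t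
  proof (cases "t \<in> {0..\<tau>}")
    case True
    have "(\<integral>s. f (t, s) \<partial>lborel) = (LINT s:{0..t}|lborel. a (t - s) * b s)"
      unfolding set_lebesgue_integral_def using True
      by (intro Bochner_Integration.integral_cong) (auto simp: f_def T_def indicator_def)
    also have "\<dots> = integral {0..t} (\<lambda>s. a (t - s) * b s)"
      using cont1 True by (intro set_borel_integral_eq_integral(2) borel_integrable_atLeastAtMost') auto
    finally show ?thesis using True by simp
  next
    case False
    hence "f (t, s) = 0" for s by (auto simp: f_def T_def indicator_def)
    thus ?thesis using False by simp
  qed
  have cont2: "continuous_on {s..\<tau>} (\<lambda>t. a (t - s) * b s)" if "0 \<le> s" for s
    using that by (intro continuous_intros continuous_on_compose2[OF a]) auto
  have in2: "(\<integral>t. f (t, s) \<partial>lborel) = indicator {0..\<tau>} s *\<^sub>R (b s * integral {0..\<tau> - s} a)" for s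
  proof (cases "s \<in> {0..\<tau>}")
    case True
    have "(\<integral>t. f (t, s) \<partial>lborel) = (LINT t:{s..\<tau>}|lborel. a (t - s) * b s)"
      unfolding set_lebesgue_integral_def using True
      by (intro Bochner_Integration.integral_cong) (auto simp: f_def T_def indicator_def)
    also have "\<dots> = integral {s..\<tau>} (\<lambda>t. a (t - s) * b s)"
      using cont2 True by (intro set_borel_integral_eq_integral(2) borel_integrable_atLeastAtMost') auto
    also have "\<dots> = integral {s..\<tau>} (\<lambda>t. a (t - s)) * b s" by (rule integral_mult_left)
    also have "integral {s..\<tau>} (\<lambda>t. a (t - s)) = integral {0..\<tau> - s} a"
      using integral_shift_real_ivl[of 0 "- s" "\<tau> - s" a] by simp
    finally show ?thesis using True by (simp add: mult.commute)
  next
    case False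
    hence "f (t, s) = 0" for t by (auto simp: f_def T_def indicator_def)
    thus ?thesis using False by simp
  qed
  have i1: "set_integrable lborel {0..\<tau>} (\<lambda>t. integral {0..t} (\<lambda>s. a (t - s) * b s))"
    using lborel_pair.integrable_fst'[OF int] unfolding set_integrable_def in1 .
  have i2: "set_integrable lborel {0..\<tau>} (\<lambda>s. b s * integral {0..\<tau> - s} a)"
    using lborel_pair.integrable_snd[of "\<lambda>x y. f (x, y)"] int unfolding set_integrable_def in2 by simp
  have "(\<integral>s. (\<integral>t. f (t, s) \<partial>lborel) \<partial>lborel) = (\<integral>t. (\<integral>s. f (t, s) \<partial>lborel) \<partial>lborel)"
    using lborel_pair.Fubini_integral[of "\<lambda>x y. f (x, y)"] int by simp
  thus ?thesis
    unfolding in1 in2 set_lebesgue_integral_def[symmetric]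
    by (simp only: set_borel_integral_eq_integral(2)[OF i1] set_borel_integral_eq_integral(2)[OF i2])
qed

text \<open>The tail of the integral is dominated by that of
  \<open>M * exp (- (Re s - 1) * v)\<close>. The rate is uniform near each point, which makes the
  limit holomorphic, and it is kept explicit for use at \<open>T = \<tau> - v\<close>.\<close>

lemma truncated_Laplace_limit:
  fixes k :: "real \<Rightarrow> real"
  assumes k: "continuous_on {0..} k" and bound: "\<And>v. v \<ge> 0 \<Longrightarrow> \<bar>k v\<bar> \<le> M * exp v"
  obtains K where "K holomorphic_on {s. Re s > 1}"
    "\<And>T s. T \<ge> 0 \<Longrightarrow> Re s > 1 \<Longrightarrow>
      norm (integral {0..T} (\<lambda>v. exp (- s * of_real v) * of_real (k v)) - K s) \<le> M / (Re s - 1) * exp (- (Re s - 1) * T)"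
proof -
  define L where "L T s = integral {0..T} (\<lambda>v. exp (- s * of_real v) * of_real (k v))" for T and s :: complex
  have M0: "M \<ge> 0" using bound[of 0] by simp
  have int: "(\<lambda>v. exp (- s * of_real v) * complex_of_real (k v)) integrable_on {x..y}" if "x \<ge> 0" for x y s
    using that by (intro integrable_continuous_real continuous_intros continuous_on_subset[OF k]) auto
  have diff: "norm (L T' s - L T s) \<le> M / (Re s - 1) * exp (- (Re s - 1) * T)" if T: "0 \<le> T" "T \<le> T'" and s: "Re s > 1" for T T' s
  proof -
    define c where "c = Re s - 1"
    have c: "c > 0" using s by (simp add: c_def)
    have "L T s + integral {T..T'} (\<lambda>v. exp (- s * of_real v) * of_real (k v)) = L T' s"
      unfolding L_def by (rule Henstock_Kurzweil_Integration.integral_combine) (use T int in auto)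
    hence "norm (L T' s - L T s) = norm (integral {T..T'} (\<lambda>v. exp (- s * of_real v) * of_real (k v)))"
      by (metis add_diff_cancel_left')
    also have ftc: "((\<lambda>v. M * exp (- c * v)) has_integral (- M / c * exp (- c * T')) - (- M / c * exp (- c * T))) {T..T'}"
      using c T by (intro fundamental_theorem_of_calculus)
        (auto intro!: derivative_eq_intros simp: has_real_derivative_iff_has_vector_derivative[symmetric])
    have "norm (integral {T..T'} (\<lambda>v. exp (- s * of_real v) * complex_of_real (k v))) \<le> integral {T..T'} (\<lambda>v. M * exp (- c * v))"
    proof (rule integral_norm_bound_integral)
      fix v assume v: "v \<in> {T..T'}"
      have "norm (exp (- s * of_real v) * complex_of_real (k v)) = exp (- Re s * v) * \<bar>k v\<bar>"
        by (simp add: norm_mult)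
      also have "\<dots> \<le> exp (- Re s * v) * (M * exp v)" using v T by (intro mult_left_mono bound) auto
      also have "\<dots> = M * exp (- c * v)" by (simp add: c_def exp_add[symmetric] algebra_simps)
      finally show "norm (exp (- s * of_real v) * complex_of_real (k v)) \<le> M * exp (- c * v)" .
    qed (use T int ftc in \<open>auto simp: has_integral_integrable\<close>)
    also have "\<dots> = (- M / c * exp (- c * T')) - (- M / c * exp (- c * T))" using ftc by (rule integral_unique)
    also have "\<dots> \<le> M / c * exp (- c * T)" using M0 c by simp
    finally show ?thesis unfolding c_def .
  qed
  \<comment> \<open>The limit is taken along integers; \<open>est\<close> then extends the rate to
    real \<open>T\<close>.\<close>
  define K where "K s = lim (\<lambda>n. L (real n) s)" for s
  have conv: "(\<lambda>n. L (real n) s) \<longlonglongrightarrow> K s" if s: "Re s > 1" for s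
  proof -
    have lim: "(\<lambda>n. M / (Re s - 1) * exp (- (Re s - 1)) ^ n) \<longlonglongrightarrow> M / (Re s - 1) * 0"
      using s by (intro tendsto_intros LIMSEQ_power_zero) auto
    have "Cauchy (\<lambda>n. L (real n) s)"
    proof (rule metric_CauchyI)
      fix e :: real assume e: "e > 0"
      have "eventually (\<lambda>n. M / (Re s - 1) * exp (- (Re s - 1)) ^ n < e / 2) sequentially"
        using lim e by (intro order_tendstoD) auto
      then obtain N where N: "M / (Re s - 1) * exp (- (Re s - 1)) ^ N < e / 2"
        by (auto simp: eventually_sequentially)
      have pw: "exp (- (Re s - 1)) ^ N = exp (- (Re s - 1) * real N)"
        by (simp add: exp_of_nat_mult[symmetric] mult.commute)
      have "dist (L (real n) s) (L (real N) s) < e / 2" if "n \<ge> N" for n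
        using diff[of "real N" "real n" s] N that s unfolding dist_norm pw by linarith
      thus "\<exists>N. \<forall>m\<ge>N. \<forall>n\<ge>N. dist (L (real m) s) (L (real n) s) < e"
        by (meson dist_triangle_half_l dist_commute)
    qed
    thus ?thesis unfolding K_def by (simp add: Cauchy_convergent_iff convergent_LIMSEQ_iff)
  qed
  have est: "norm (L T s - K s) \<le> M / (Re s - 1) * exp (- (Re s - 1) * T)" if T: "T \<ge> 0" and s: "Re s > 1" for T s
  proof (rule tendsto_upperbound)
    show "(\<lambda>n. norm (L T s - L (real n) s)) \<longlonglongrightarrow> norm (L T s - K s)"
      by (intro tendsto_intros conv s)
    show "eventually (\<lambda>n. norm (L T s - L (real n) s) \<le> M / (Re s - 1) * exp (- (Re s - 1) * T)) sequentially"
      using eventually_ge_at_top[of "nat \<lceil>T\<rceil>"]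
    proof eventually_elim
      case (elim n)
      hence "T \<le> real n" by linarith
      thus ?case using diff[OF T _ s] unfolding norm_minus_commute[of "L T s"] by blast
    qed
  qed simp
  have "K holomorphic_on {s. Re s > 1}"
  proof (rule holomorphic_uniform_sequence)
    show "open {s. Re s > 1}" by (rule open_halfspace_Re_gt)
    show "(\<lambda>s. L (real n) s) holomorphic_on {s. Re s > 1}" for n
    proof -
      have "continuous_on {0..real n} (\<lambda>v. complex_of_real (k v))"
        by (intro continuous_intros continuous_on_subset[OF k]) auto
      from truncated_Laplace_higher_deriv(1)[OF this] show ?thesis
        unfolding L_def by (rule holomorphic_on_subset) auto
    qed
    fix z :: complex assume z: "z \<in> {s. Re s > 1}"
    define d where "d = (Re z - 1) / 2"
    have d: "d > 0" using z by (simp add: d_def)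
    have sub: "Re s - 1 \<ge> d" if "s \<in> cball z d" for s
      using that abs_Re_le_cmod[of "z - s"] by (auto simp: dist_norm d_def field_simps) 
    have "uniform_limit (cball z d) (\<lambda>n. L (real n)) K sequentially"
    proof (rule uniform_limitI)
      fix e :: real assume e: "e > 0"
      have "(\<lambda>n. M / d * exp (- d) ^ n) \<longlonglongrightarrow> M / d * 0"
        using d by (intro tendsto_intros LIMSEQ_power_zero) auto
      hence "eventually (\<lambda>n. M / d * exp (- d) ^ n < e) sequentially"
        using e by (intro order_tendstoD) auto
      thus "eventually (\<lambda>n. \<forall>s\<in>cball z d. dist (L (real n) s) (K s) < e) sequentially"
      proof eventually_elim
        case (elim n)
        show ?case
        proof
          fix s assume s: "s \<in> cball z d"
          have "norm (L (real n) s - K s) \<le> M / (Re s - 1) * exp (- (Re s - 1) * real n)"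
            by (rule est) (use sub[OF s] d in auto)
          also have "\<dots> \<le> M / d * exp (- d * real n)"
          proof (rule mult_mono)
            have "d * real n \<le> (Re s - 1) * real n" using sub[OF s] by (intro mult_right_mono) auto
            thus "exp (- (Re s - 1) * real n) \<le> exp (- d * real n)"
              by (simp only: exp_le_cancel_iff mult_minus_left neg_le_iff_le)
            show "M / (Re s - 1) \<le> M / d" using sub[OF s] d M0 by (intro divide_left_mono) auto
          qed (use d M0 in auto)
          also have "exp (- d * real n) = exp (- d) ^ n" by (simp add: exp_of_nat_mult[symmetric] mult.commute)
          finally show "dist (L (real n) s) (K s) < e" using elim by (simp add: dist_norm)
        qed
      qed
    qed
    thus "\<exists>d>0. cball z d \<subseteq> {s. Re s > 1} \<and> uniform_limit (cball z d) (\<lambda>n. L (real n)) K sequentially"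
      using d sub by (intro exI[of _ d]) force
  qed
  thus thesis using est that unfolding L_def by blast
qed

text \<open>With \<open>P\<close> and \<open>F\<close> the truncated transforms of \<open>p\<close>
  and \<open>f\<close>, the equation becomes \<open>P - p0 / s = Ks * (g * P - F)\<close> up to
  errors. As \<open>Ks * g = 1\<close>, the unknown \<open>P\<close> drops out and \<open>F\<close>
  is close to \<open>g / s * p0\<close>. No growth bound beyond \<open>\<tau>\<close>
  enters.\<close>

lemma Volterra_Laplace:
  fixes k :: "real \<Rightarrow> real" and p f :: "real \<Rightarrow> complex" and p0 g s Ks :: complex
  assumes k: "continuous_on {0..} k" and p: "continuous_on {0..\<tau>} p" and f: "continuous_on {0..\<tau>} f"
    and eq: "\<And>t. t \<in> {0..\<tau>} \<Longrightarrow> ((\<lambda>v. of_real (k (t - v)) * (g * p v - f v)) has_integral (p t - p0)) {0..t}"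
    and Ks: "\<And>T. T \<ge> 0 \<Longrightarrow> norm (integral {0..T} (\<lambda>v. exp (- s * of_real v) * of_real (k v)) - Ks) \<le> M * exp (- (Re s - 1) * T)"
    and g: "Ks * g = 1" and \<tau>: "\<tau> > 0" and s: "Re s > 1"
    and Q: "\<And>v. v \<in> {0..\<tau>} \<Longrightarrow> norm (g * p v - f v) \<le> Q"
  shows "norm (integral {0..\<tau>} (\<lambda>v. exp (- s * of_real v) * f v) - g / s * p0)
    \<le> norm g * (norm p0 + \<tau> * Q * M) * exp (- (Re s - 1) * \<tau>)"
proof -
  define q where "q v = g * p v - f v" for v
  define E where "E v = exp (- s * complex_of_real v)" for v
  have nE: "norm (E v) = exp (- Re s * v)" for v by (simp add: E_def)
  have s0: "s \<noteq> 0" using s by auto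
  have cE: "continuous_on A E" for A unfolding E_def by (intro continuous_intros)
  have cq: "continuous_on {0..\<tau>} q" unfolding q_def by (intro continuous_intros p f)
  define KT where "KT T = integral {0..T} (\<lambda>v. E v * of_real (k v))" for T
  have M0: "0 \<le> M" using order_trans[OF norm_ge_zero Ks[of 0]] by simp
  have Q0: "0 \<le> Q" using order_trans[OF norm_ge_zero Q[of 0]] \<tau> by simp
  have "integral {0..\<tau>} (\<lambda>t. E t * (p t - p0)) = integral {0..\<tau>} (\<lambda>t. integral {0..t} (\<lambda>v. (E (t - v) * of_real (k (t - v))) * (E v * q v)))"
  proof (rule integral_cong)
    fix t assume t: "t \<in> {0..\<tau>}"
    have "E t * (p t - p0) = integral {0..t} (\<lambda>v. E t * (of_real (k (t - v)) * q v))"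
      unfolding q_def by (rule integral_unique[symmetric], rule has_integral_mult_right[OF eq[OF t]])
    also have "(\<lambda>v. E t * (of_real (k (t - v)) * q v)) = (\<lambda>v. (E (t - v) * of_real (k (t - v))) * (E v * q v))"
    proof
      fix v
      have "E t = E (t - v) * E v" by (simp add: E_def exp_add[symmetric] algebra_simps)
      thus "E t * (of_real (k (t - v)) * q v) = (E (t - v) * of_real (k (t - v))) * (E v * q v)"
        by (simp add: mult_ac)
    qed
    finally show "E t * (p t - p0) = integral {0..t} (\<lambda>v. (E (t - v) * of_real (k (t - v))) * (E v * q v))" .
  qed
  also have "\<dots> = integral {0..\<tau>} (\<lambda>v. E v * q v * KT (\<tau> - v))"
    unfolding KT_def by (intro integral_convolution_swap continuous_intros cE cq continuous_on_subset[OF k]) auto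
  finally have 1: "integral {0..\<tau>} (\<lambda>t. E t * (p t - p0)) = integral {0..\<tau>} (\<lambda>v. E v * q v * KT (\<tau> - v))" .
  have cKT: "continuous_on {0..\<tau>} (\<lambda>v. KT (\<tau> - v))"
  proof (rule continuous_on_compose2[where f = "\<lambda>v. \<tau> - v"])
    show "continuous_on {0..\<tau>} KT" unfolding KT_def
      by (intro indefinite_integral_continuous_1 integrable_continuous_real continuous_intros cE continuous_on_subset[OF k]) auto
  qed (auto intro!: continuous_intros)
  \<comment> \<open>The cost of replacing the kernel transform up to \<open>\<tau> - v\<close> by
    its limit. The tail \<open>exp (- (Re s - 1) * (\<tau> - v))\<close> times
    \<open>norm (E v) = exp (- Re s * v)\<close> is at most
    \<open>exp (- (Re s - 1) * \<tau>)\<close>, whatever \<open>v\<close> is.\<close>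
  define Err where "Err = integral {0..\<tau>} (\<lambda>v. E v * q v * (KT (\<tau> - v) - Ks))"
  have Err: "norm Err \<le> Q * M * exp (- (Re s - 1) * \<tau>) * (\<tau> - 0)"
    unfolding Err_def
  proof (rule integral_bound)
    show "continuous_on {0..\<tau>} (\<lambda>v. E v * q v * (KT (\<tau> - v) - Ks))" by (intro continuous_intros cE cq cKT)
    fix v assume v: "v \<in> {0..\<tau>}"
    have "norm (E v * q v * (KT (\<tau> - v) - Ks)) \<le> exp (- Re s * v) * Q * (M * exp (- (Re s - 1) * (\<tau> - v)))"
      unfolding norm_mult nE using v Q0 Q[of v] Ks[of "\<tau> - v"]
      by (intro mult_mono) (auto simp: q_def KT_def E_def)
    also have "\<dots> = Q * M * exp (- (Re s - 1) * \<tau> - v)" by (simp add: exp_add[symmetric] algebra_simps)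
    also have "\<dots> \<le> Q * M * exp (- (Re s - 1) * \<tau>)" using v Q0 M0 by (intro mult_left_mono) auto
    finally show "norm (E v * q v * (KT (\<tau> - v) - Ks)) \<le> Q * M * exp (- (Re s - 1) * \<tau>)" .
  qed (use \<tau> in auto)
  define P where "P = integral {0..\<tau>} (\<lambda>v. E v * p v)"
  define F where "F = integral {0..\<tau>} (\<lambda>v. E v * f v)"
  have int: "(\<lambda>v. E v * p v) integrable_on {0..\<tau>}" "(\<lambda>v. E v * f v) integrable_on {0..\<tau>}" "(\<lambda>v. E v * p0) integrable_on {0..\<tau>}"
      "(\<lambda>v. Ks * (E v * q v)) integrable_on {0..\<tau>}" "(\<lambda>v. E v * q v * (KT (\<tau> - v) - Ks)) integrable_on {0..\<tau>}"
    by (intro integrable_continuous_real continuous_intros cE p f cq cKT)+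
  have Eint: "((\<lambda>v. E v * p0) has_integral (1 - E \<tau>) / s * p0) {0..\<tau>}"
  proof -
    have "(E has_integral (- E \<tau> / s) - (- E 0 / s)) {0..\<tau>}"
    proof (rule fundamental_theorem_of_calculus)
      fix x :: real
      have "((\<lambda>z. - exp (- s * z) / s) has_field_derivative exp (- s * of_real x)) (at (of_real x))"
        using s0 by (auto intro!: derivative_eq_intros)
      thus "((\<lambda>v. - E v / s) has_vector_derivative E x) (at x within {0..\<tau>})"
        unfolding E_def by (rule has_vector_derivative_real_field)
    qed (use \<tau> in auto)
    from has_integral_mult_left[OF this, of p0] show ?thesis by (simp add: E_def diff_divide_distrib)
  qed
  have "P - (1 - E \<tau>) / s * p0 = integral {0..\<tau>} (\<lambda>t. E t * (p t - p0))"
    unfolding P_def right_diff_distrib Henstock_Kurzweil_Integration.integral_diff[OF int(1,3)] integral_unique[OF Eint] ..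
  also have "\<dots> = integral {0..\<tau>} (\<lambda>v. Ks * (E v * q v) + E v * q v * (KT (\<tau> - v) - Ks))"
    unfolding 1 by (intro integral_cong) (simp add: algebra_simps)
  also have "\<dots> = Ks * integral {0..\<tau>} (\<lambda>v. E v * q v) + Err"
    unfolding Henstock_Kurzweil_Integration.integral_add[OF int(4,5)] Err_def by (simp add: integral_mult_right)
  also have "integral {0..\<tau>} (\<lambda>v. E v * q v) = integral {0..\<tau>} (\<lambda>v. g * (E v * p v) - E v * f v)"
    by (intro integral_cong) (simp add: q_def algebra_simps)
  also have "\<dots> = g * P - F"
    unfolding P_def F_def using int(1,2) by (subst Henstock_Kurzweil_Integration.integral_diff) (auto intro: integrable_on_mult_right)
  finally have "P - (1 - E \<tau>) / s * p0 = Ks * (g * P - F) + Err" .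
  \<comment> \<open>Here \<open>P\<close> cancels, leaving an equation for \<open>F\<close>
    alone.\<close>
  moreover have "Ks * (g * P - F) = P - Ks * F"
    using g by (simp add: right_diff_distrib mult.assoc[symmetric])
  moreover have "x - c = x - y + e \<Longrightarrow> y = c + e" for x c y e :: complex
    by (simp add: algebra_simps)
  ultimately have "Ks * F = (1 - E \<tau>) / s * p0 + Err" by metis
  hence "g * (Ks * F) = g * ((1 - E \<tau>) / s * p0 + Err)" by simp
  hence "F = g * ((1 - E \<tau>) / s * p0 + Err)" using g by (simp add: mult.assoc[symmetric] mult.commute[of g])
  hence "F - g / s * p0 = g * (Err - E \<tau> / s * p0)" using s0 by (simp add: field_simps)
  hence "norm (F - g / s * p0) = norm g * norm (Err - E \<tau> / s * p0)" by (simp add: norm_mult)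
  also have "\<dots> \<le> norm g * (Q * M * exp (- (Re s - 1) * \<tau>) * \<tau> + exp (- (Re s - 1) * \<tau>) * norm p0)"
  proof (intro mult_left_mono order_trans[OF norm_triangle_ineq4] add_mono)
    have "norm s \<ge> 1" using complex_Re_le_cmod[of s] s by linarith
    have "norm (E \<tau> / s * p0) = exp (- Re s * \<tau>) / norm s * norm p0" by (simp add: norm_mult norm_divide nE)
    also have "\<dots> \<le> exp (- (Re s - 1) * \<tau>) / 1 * norm p0"
      using \<open>norm s \<ge> 1\<close> \<tau> by (intro mult_right_mono frac_le) (auto simp: algebra_simps)
    finally show "norm (E \<tau> / s * p0) \<le> exp (- (Re s - 1) * \<tau>) * norm p0" by simp
  qed (use Err in auto)
  finally show ?thesis by (simp add: F_def E_def algebra_simps)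
qed

section \<open>The Volterra kernel and its Laplace transform\<close>

lemma kappa_integrable:
  assumes "\<beta> \<ge> 0" "\<mu> > 0" "c \<ge> 0"
  shows "kappa \<alpha> \<beta> \<mu> integrable_on {0..c}"
proof -
  have "(\<lambda>v. v powr (\<mu> - 1) * exp (- \<beta> * v)) integrable_on {0..c}"
  \<comment> \<open>Without exponential decay the half-line integral diverges, so this case is
    integrated on the bounded interval itself.\<close>
  proof (cases "\<beta> = 0")
    case True
    thus ?thesis using integrable_on_powr_from_0[of "\<mu> - 1" c] assms by simp
  next
    case False
    with assms have "(\<lambda>v. v powr (\<mu> - 1) * exp (- \<beta> * v)) integrable_on {0..}"
      using has_integral_powr_exp[of \<mu> \<beta>] by (auto intro: has_integral_integrable)
    thus ?thesis by (rule integrable_on_subinterval) auto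
  qed
  hence "(\<lambda>v. (\<alpha> / Gamma \<mu>) * (v powr (\<mu> - 1) * exp (- \<beta> * v))) integrable_on {0..c}"
    by (rule integrable_on_mult_right)
  thus ?thesis by (simp add: kappa_def[abs_def] mult_ac)
qed

lemma one_conv_kappa_continuous:
  assumes "\<beta> \<ge> 0" "\<mu> > 0"
  shows "continuous_on {0..} (one_conv_kappa \<alpha> \<beta> \<mu>)"
proof -
  have "continuous (at x within {0..}) (one_conv_kappa \<alpha> \<beta> \<mu>)" if "x \<ge> 0" for x
  proof -
    have "continuous_on {0..x + 1} (one_conv_kappa \<alpha> \<beta> \<mu>)"
      unfolding one_conv_kappa_def[abs_def]
      by (intro indefinite_integral_continuous_1 kappa_integrable) (use assms that in auto)
    hence "continuous (at x within {0..x + 1}) (one_conv_kappa \<alpha> \<beta> \<mu>)"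
      using that by (simp add: continuous_on_eq_continuous_within)
    moreover have "at x within {0..x + 1} = at x within {0..}"
      by (rule at_within_nhd[of _ "{..<x + 1}"]) auto
    ultimately show ?thesis by simp
  qed
  thus ?thesis by (simp add: continuous_on_eq_continuous_within)
qed

text \<open>Dropping \<open>exp (- \<beta> * u)\<close> leaves growth of order
  \<open>v powr \<mu>\<close>, relaxed to \<open>exp v\<close>. This choice of majorant is why
  transforms are considered for \<open>Re s > 1\<close>.\<close>

lemma one_conv_kappa_bound:
  assumes "\<beta> \<ge> 0" "\<mu> > 0" "\<mu> \<le> 1" "v \<ge> 0"
  shows "\<bar>1 + one_conv_kappa \<alpha> \<beta> \<mu> v\<bar> \<le> (1 + \<bar>\<alpha>\<bar> / (Gamma \<mu> * \<mu>)) * exp v"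
proof -
  have G: "Gamma \<mu> > 0" using assms by (intro Gamma_real_pos)
  have hi: "((\<lambda>u. \<bar>\<alpha>\<bar> / Gamma \<mu> * u powr (\<mu> - 1)) has_integral \<bar>\<alpha>\<bar> / Gamma \<mu> * (v powr (\<mu> - 1 + 1) / (\<mu> - 1 + 1))) {0..v}"
    by (intro has_integral_mult_right has_integral_powr_from_0) (use assms in auto)
  have "norm (one_conv_kappa \<alpha> \<beta> \<mu> v) \<le> integral {0..v} (\<lambda>u. \<bar>\<alpha>\<bar> / Gamma \<mu> * u powr (\<mu> - 1))"
    unfolding one_conv_kappa_def
  proof (rule integral_norm_bound_integral)
    fix u assume u: "u \<in> {0..v}"
    have "norm (kappa \<alpha> \<beta> \<mu> u) = \<bar>\<alpha>\<bar> / Gamma \<mu> * u powr (\<mu> - 1) * exp (- \<beta> * u)"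
      using G by (simp add: kappa_def abs_mult)
    also have "\<dots> \<le> \<bar>\<alpha>\<bar> / Gamma \<mu> * u powr (\<mu> - 1) * 1"
      using G u assms by (intro mult_left_mono) auto
    finally show "norm (kappa \<alpha> \<beta> \<mu> u) \<le> \<bar>\<alpha>\<bar> / Gamma \<mu> * u powr (\<mu> - 1)" by simp
  qed (use assms hi in \<open>auto intro: kappa_integrable has_integral_integrable\<close>)
  also have "\<dots> = \<bar>\<alpha>\<bar> / (Gamma \<mu> * \<mu>) * v powr \<mu>" using integral_unique[OF hi] by simp
  also have "\<dots> \<le> \<bar>\<alpha>\<bar> / (Gamma \<mu> * \<mu>) * exp v"
  proof (rule mult_left_mono)
    have "v powr \<mu> \<le> 1 + v"
    proof (cases "v \<le> 1")
      case True
      thus ?thesis using assms powr_le1[of \<mu> v] by linarith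
    next
      case False
      thus ?thesis using assms powr_mono[of \<mu> 1 v] by simp
    qed
    also have "\<dots> \<le> exp v" by (rule exp_ge_add_one_self)
    finally show "v powr \<mu> \<le> exp v" .
  qed (use G assms in auto)
  finally have "\<bar>one_conv_kappa \<alpha> \<beta> \<mu> v\<bar> \<le> \<bar>\<alpha>\<bar> / (Gamma \<mu> * \<mu>) * exp v" by simp
  moreover have "1 \<le> exp v" using assms by simp
  ultimately show ?thesis unfolding distrib_right by linarith
qed

text \<open>Integration by parts passes from \<open>1 + one_conv_kappa\<close> to its derivative
  \<open>kappa\<close>, whose transform is Euler's integral with parameter
  \<open>x + \<beta>\<close>; the boundary value 1 at 0 gives the summand
  \<open>1 / x\<close>.\<close>

lemma kernel_Laplace_real:
  assumes \<beta>: "\<beta> \<ge> 0" and \<mu>: "\<mu> > 0" "\<mu> \<le> 1" and x: "x > (1::real)"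
  shows "(\<lambda>n. integral {0..real n} (\<lambda>v. exp (- x * v) * (1 + one_conv_kappa \<alpha> \<beta> \<mu> v)))
    \<longlonglongrightarrow> 1 / x * (1 + \<alpha> / (x + \<beta>) powr \<mu>)"
proof -
  define k where "k v = 1 + one_conv_kappa \<alpha> \<beta> \<mu> v" for v
  have ck: "continuous_on {0..} k" unfolding k_def using one_conv_kappa_continuous[OF \<beta> \<mu>(1)] by (intro continuous_intros)
  have ki: "kappa \<alpha> \<beta> \<mu> integrable_on {0..c}" for c
    using kappa_integrable[OF \<beta> \<mu>(1), of c \<alpha>] by (cases "c \<ge> 0") auto
  have G: "Gamma \<mu> > 0" using \<mu> by (intro Gamma_real_pos)
  have dk: "(k has_real_derivative kappa \<alpha> \<beta> \<mu> v) (at v)" if v: "v > 0" for v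
  proof -
    have "((\<lambda>u. integral {0..u} (kappa \<alpha> \<beta> \<mu>)) has_vector_derivative kappa \<alpha> \<beta> \<mu> v) (at v within {0..v + 1} - {})"
    proof (rule integral_has_vector_derivative_continuous_at[OF ki])
      have "isCont (kappa \<alpha> \<beta> \<mu>) v"
        unfolding kappa_def[abs_def] using v G by (intro continuous_intros) auto
      thus "continuous (at v within {0..v + 1} - {}) (kappa \<alpha> \<beta> \<mu>)"
        by (rule continuous_at_imp_continuous_at_within)
    qed (use v in auto)
    moreover have "at v within {0..v + 1} - {} = at v" using v by (simp add: at_within_Icc_at)
    ultimately have "(one_conv_kappa \<alpha> \<beta> \<mu> has_real_derivative kappa \<alpha> \<beta> \<mu> v) (at v)"
      by (simp add: one_conv_kappa_def[abs_def] has_real_derivative_iff_has_vector_derivative)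
    thus ?thesis unfolding k_def by (auto intro!: derivative_eq_intros)
  qed
  define j where "j v = exp (- x * v) * kappa \<alpha> \<beta> \<mu> v" for v
  have jeq: "j v = \<alpha> / Gamma \<mu> * (v powr (\<mu> - 1) * exp (- (x + \<beta>) * v))" for v
  proof -
    have "exp (- (x + \<beta>) * v) = exp (- x * v) * exp (- \<beta> * v)" by (simp add: exp_add[symmetric] algebra_simps)
    thus ?thesis by (simp add: j_def kappa_def)
  qed
  have xb: "x + \<beta> > 0" using x \<beta> by simp
  have pw: "((\<lambda>v. v powr (\<mu> - 1) * exp (- (x + \<beta>) * v)) has_integral Gamma \<mu> / (x + \<beta>) powr \<mu>) {0..}"
    by (rule has_integral_powr_exp[OF \<mu>(1) xb])
  have jint: "(j has_integral \<alpha> / (x + \<beta>) powr \<mu>) {0..}"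
  proof -
    have *: "\<alpha> / Gamma \<mu> * (Gamma \<mu> / (x + \<beta>) powr \<mu>) = \<alpha> / (x + \<beta>) powr \<mu>" using G by simp
    show ?thesis using has_integral_mult_right[OF pw, of "\<alpha> / Gamma \<mu>"] unfolding jeq[abs_def] * .
  qed
  have jI: "j integrable_on {0..c}" for c
    by (rule integrable_on_subinterval[OF has_integral_integrable[OF jint]]) auto
  have jlim: "(\<lambda>n. integral {0..real n} j) \<longlonglongrightarrow> \<alpha> / (x + \<beta>) powr \<mu>"
  proof -
    have hr: "((\<lambda>v. if v \<in> {0..real n} then j v else 0) has_integral integral {0..real n} j) {0..}" for n
      by (subst has_integral_restrict) (use jI in auto)
    have restr: "integral {0..} (\<lambda>v. if v \<in> {0..real n} then j v else 0) = integral {0..real n} j"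
      "(\<lambda>v. if v \<in> {0..real n} then j v else 0) integrable_on {0..}" for n
      using hr[of n] by (auto simp: has_integral_iff)
    have "(\<lambda>n. integral {0..} (\<lambda>v. if v \<in> {0..real n} then j v else 0)) \<longlonglongrightarrow> integral {0..} j"
    proof (rule dominated_convergence(2))
      show "(\<lambda>v. \<bar>\<alpha>\<bar> / Gamma \<mu> * (v powr (\<mu> - 1) * exp (- (x + \<beta>) * v))) integrable_on {0..}"
        by (intro integrable_on_mult_right has_integral_integrable[OF pw])
      show "norm (if v \<in> {0..real n} then j v else 0) \<le> \<bar>\<alpha>\<bar> / Gamma \<mu> * (v powr (\<mu> - 1) * exp (- (x + \<beta>) * v))" for n v
        using G by (auto simp: jeq abs_mult)
      fix v :: real assume v: "v \<in> {0..}"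
      have "eventually (\<lambda>n. (if v \<in> {0..real n} then j v else 0) = j v) sequentially"
        using eventually_ge_at_top[of "nat \<lceil>v\<rceil>"]
      proof eventually_elim
        case (elim n)
        hence "v \<le> real n" by linarith
        thus ?case using v by simp
      qed
      thus "(\<lambda>n. if v \<in> {0..real n} then j v else 0) \<longlonglongrightarrow> j v" by (rule tendsto_eventually)
    qed (rule restr)
    thus ?thesis by (simp only: restr integral_unique[OF jint])
  qed
  have parts: "integral {0..T} (\<lambda>v. exp (- x * v) * k v) = (1 - exp (- x * T) * k T) / x + integral {0..T} j / x" if T: "T \<ge> 0" for T
  proof -
    have "((\<lambda>v. exp (- x * v) * k v - j v / x) has_integral (- (exp (- x * T) * k T) / x) - (- (exp (- x * 0) * k 0) / x)) {0..T}"
    \<comment> \<open>For \<open>\<mu> < 1\<close> the derivative \<open>kappa\<close> is unbounded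
      at 0, so differentiability is claimed only in the open interval.\<close>
    proof (rule fundamental_theorem_of_calculus_interior[OF T])
      show "continuous_on {0..T} (\<lambda>v. - (exp (- x * v) * k v) / x)"
        using x by (intro continuous_intros continuous_on_subset[OF ck]) auto
      fix v assume "v \<in> {0<..<T}"
      hence "((\<lambda>v. - (exp (- x * v) * k v) / x) has_real_derivative exp (- x * v) * k v - j v / x) (at v)"
        using x by (auto intro!: derivative_eq_intros dk simp: j_def field_simps)
      thus "((\<lambda>v. - (exp (- x * v) * k v) / x) has_vector_derivative exp (- x * v) * k v - j v / x) (at v)"
        by (simp add: has_real_derivative_iff_has_vector_derivative)
    qed
    from has_integral_add[OF this has_integral_divide[OF integrable_integral[OF jI[of T]], of x]]
    have "((\<lambda>v. exp (- x * v) * k v) has_integral (- (exp (- x * T) * k T) / x) - (- (exp (- x * 0) * k 0) / x) + integral {0..T} j / x) {0..T}"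
      by simp
    moreover have "k 0 = 1" by (simp add: k_def one_conv_kappa_def)
    ultimately show ?thesis by (simp add: integral_unique diff_divide_distrib)
  qed
  have "(\<lambda>n. exp (- x * real n) * k (real n)) \<longlonglongrightarrow> 0"
  proof (rule Lim_null_comparison)
    let ?M = "1 + \<bar>\<alpha>\<bar> / (Gamma \<mu> * \<mu>)"
    have "norm (exp (- x * real n) * k (real n)) \<le> ?M * exp (- (x - 1)) ^ n" for n
    proof -
      have "norm (exp (- x * real n) * k (real n)) \<le> exp (- x * real n) * (?M * exp (real n))"
        using one_conv_kappa_bound[OF \<beta> \<mu>, of "real n" \<alpha>] by (simp add: abs_mult k_def)
      also have "\<dots> = ?M * exp (- (x - 1)) ^ n"
        by (simp add: exp_of_nat_mult[symmetric] exp_add[symmetric] algebra_simps)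
      finally show ?thesis .
    qed
    thus "eventually (\<lambda>n. norm (exp (- x * real n) * k (real n)) \<le> ?M * exp (- (x - 1)) ^ n) sequentially" by simp
    have "(\<lambda>n. ?M * exp (- (x - 1)) ^ n) \<longlonglongrightarrow> ?M * 0"
      using x by (intro tendsto_intros LIMSEQ_power_zero) auto
    thus "(\<lambda>n. ?M * exp (- (x - 1)) ^ n) \<longlonglongrightarrow> 0" by simp
  qed
  hence "(\<lambda>n. (1 - exp (- x * real n) * k (real n)) / x + integral {0..real n} j / x) \<longlonglongrightarrow> (1 - 0) / x + (\<alpha> / (x + \<beta>) powr \<mu>) / x"
    using x by (intro tendsto_intros jlim) auto
  also have "(1 - 0) / x + (\<alpha> / (x + \<beta>) powr \<mu>) / x = 1 / x * (1 + \<alpha> / (x + \<beta>) powr \<mu>)"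
    by (simp add: algebra_simps add_divide_distrib)
  finally show ?thesis using parts unfolding k_def by simp
qed

text \<open>The abstract limit \<open>K\<close> and the closed form are both holomorphic for
  \<open>Re s > 1\<close> and agree at real points, so the identity theorem carries the real
  computation to complex \<open>s\<close>; 3 is a convenient accumulation point.\<close>

lemma kernel_Laplace:
  fixes \<alpha> \<beta> \<mu> T :: real and s :: complex
  assumes \<beta>: "\<beta> \<ge> 0" and \<mu>: "\<mu> > 0" "\<mu> \<le> 1" and s: "Re s > 1" and T: "T \<ge> 0"
  defines "M \<equiv> 1 + \<bar>\<alpha>\<bar> / (Gamma \<mu> * \<mu>)"
  shows "norm (integral {0..T} (\<lambda>v. exp (- s * of_real v) * of_real (1 + one_conv_kappa \<alpha> \<beta> \<mu> v))
      - 1 / s * (1 + of_real \<alpha> / (s + of_real \<beta>) powr of_real \<mu>)) \<le> M / (Re s - 1) * exp (- (Re s - 1) * T)"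
proof -
  define k where "k v = 1 + one_conv_kappa \<alpha> \<beta> \<mu> v" for v
  have ck: "continuous_on {0..} k" unfolding k_def using one_conv_kappa_continuous[OF \<beta> \<mu>(1)] by (intro continuous_intros)
  obtain K where K: "K holomorphic_on {s. Re s > 1}"
    "\<And>T s. T \<ge> 0 \<Longrightarrow> Re s > 1 \<Longrightarrow>
      norm (integral {0..T} (\<lambda>v. exp (- s * of_real v) * of_real (k v)) - K s) \<le> M / (Re s - 1) * exp (- (Re s - 1) * T)"
    using truncated_Laplace_limit[OF ck, of M] one_conv_kappa_bound[OF \<beta> \<mu>] unfolding k_def M_def by blast
  define G where "G s = 1 / s * (1 + of_real \<alpha> / (s + of_real \<beta>) powr of_real \<mu>)" for s :: complex
  have nz: "s + of_real \<beta> \<notin> \<real>\<^sub>\<le>\<^sub>0" "s \<noteq> 0" if "Re s > 1" for s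
    using that \<beta> by (auto simp: complex_nonpos_Reals_iff)
  have G: "G holomorphic_on {s. Re s > 1}"
    unfolding G_def using nz by (intro holomorphic_intros) (auto, fastforce)
  have real: "K (of_real x) = G (of_real x)" if x: "x > 1" for x
  proof (rule LIMSEQ_unique)
    let ?L = "\<lambda>n. integral {0..real n} (\<lambda>v. exp (- complex_of_real x * of_real v) * of_real (k v))"
    have "(\<lambda>n. complex_of_real (integral {0..real n} (\<lambda>v. exp (- x * v) * k v))) \<longlonglongrightarrow> of_real (1 / x * (1 + \<alpha> / (x + \<beta>) powr \<mu>))"
      unfolding k_def by (intro tendsto_of_real kernel_Laplace_real \<beta> \<mu> x)
    also have "(\<lambda>n. complex_of_real (integral {0..real n} (\<lambda>v. exp (- x * v) * k v))) = ?L"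
    proof
      fix n
      have "((\<lambda>v. exp (- x * v) * k v) has_integral integral {0..real n} (\<lambda>v. exp (- x * v) * k v)) {0..real n}"
        by (intro integrable_integral integrable_continuous_real continuous_intros continuous_on_subset[OF ck]) auto
      from integral_unique[OF has_integral_of_real[OF this, where ?'b = complex]]
      show "complex_of_real (integral {0..real n} (\<lambda>v. exp (- x * v) * k v)) = ?L n"
        by (simp add: exp_of_real[symmetric])
    qed
    also have "of_real (1 / x * (1 + \<alpha> / (x + \<beta>) powr \<mu>)) = G (of_real x)"
      using x \<beta> by (simp add: G_def powr_of_real[symmetric])
    finally show "?L \<longlonglongrightarrow> G (of_real x)" .
    show "?L \<longlonglongrightarrow> K (of_real x)"
    proof (rule LIM_zero_cancel, rule Lim_null_comparison)
      show "eventually (\<lambda>n. norm (?L n - K (of_real x)) \<le> M / (x - 1) * exp (- (x - 1)) ^ n) sequentially"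
        using K(2)[of "real _" "of_real x"] x
        by (intro always_eventually allI) (simp add: exp_of_nat_mult[symmetric] mult.commute)
      have "(\<lambda>n. M / (x - 1) * exp (- (x - 1)) ^ n) \<longlonglongrightarrow> M / (x - 1) * 0"
        using x by (intro tendsto_intros LIMSEQ_power_zero) auto
      thus "(\<lambda>n. M / (x - 1) * exp (- (x - 1)) ^ n) \<longlonglongrightarrow> 0" by simp
    qed
  qed
  have "K s - G s = 0"
  proof (rule analytic_continuation[where f = "\<lambda>s. K s - G s" and S = "{s. Re s > 1}" and U = "complex_of_real ` {1<..}" and \<xi> = "of_real 3"])
    show "complex_of_real 3 islimpt complex_of_real ` {1<..}"
      unfolding islimpt_approachable
    proof (intro allI impI)
      fix e :: real assume "e > 0"
      thus "\<exists>x'\<in>complex_of_real ` {1<..}. x' \<noteq> of_real 3 \<and> dist x' (of_real 3) < e"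
        by (intro bexI[of _ "of_real (3 + e / 2)"] imageI) (auto simp: dist_norm norm_divide)
    qed
  qed (use K(1) G real s in \<open>auto intro!: holomorphic_intros open_halfspace_Re_gt convex_connected convex_halfspace_Re_gt\<close>)
  thus ?thesis using K(2)[OF T s] by (simp add: G_def k_def)
qed

section \<open>Resolvents and the main estimate\<close>

lemma resolvent_eqs:
  assumes l: "l \<in> resolvent_set D A"
  shows "resolvent D A l y \<in> D" "scaleC l (resolvent D A l y) - A (resolvent D A l y) = y"
    and "x \<in> D \<Longrightarrow> resolvent D A l (scaleC l x - A x) = x"
    and "bounded_linear (resolvent D A l)" "resolvent D A l (scaleC c y) = scaleC c (resolvent D A l y)"
proof -
  have b: "bij_betw (\<lambda>x. scaleC l x - A x) D UNIV" and c: "cbl (resolvent D A l)"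
    using l by (auto simp: resolvent_set_def)
  show "resolvent D A l y \<in> D" unfolding resolvent_def
    by (rule inv_into_into) (use b in \<open>auto simp: bij_betw_def\<close>)
  show "scaleC l (resolvent D A l y) - A (resolvent D A l y) = y" unfolding resolvent_def
    using b f_inv_into_f[of y "\<lambda>x. scaleC l x - A x" D] by (auto simp: bij_betw_def)
  show "x \<in> D \<Longrightarrow> resolvent D A l (scaleC l x - A x) = x" unfolding resolvent_def
    using b inv_into_f_f[of "\<lambda>x. scaleC l x - A x" D x] by (auto simp: bij_betw_def)
  show "bounded_linear (resolvent D A l)" "resolvent D A l (scaleC c y) = scaleC c (resolvent D A l y)"
    using c by (auto simp: cbl_def)
qed

lemma resolvent_identity:
  assumes l: "l \<in> resolvent_set D A" and m: "m \<in> resolvent_set D A"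
  shows "resolvent D A l y - resolvent D A m y = scaleC (m - l) (resolvent D A l (resolvent D A m y))"
proof -
  define u where "u = resolvent D A m y"
  have u: "u \<in> D" "scaleC m u - A u = y" using resolvent_eqs(1,2)[OF m] by (auto simp: u_def)
  have "scaleC m u = scaleC l u + scaleC (m - l) u"
    using scaleC_add_left[of l "m - l" u] by simp
  hence "y = (scaleC l u - A u) + scaleC (m - l) u" using u(2) by (auto simp: algebra_simps)
  hence "resolvent D A l y = resolvent D A l (scaleC l u - A u) + resolvent D A l (scaleC (m - l) u)"
    using linear_add[OF bounded_linear.linear[OF resolvent_eqs(4)[OF l]]] by simp
  also have "\<dots> = u + scaleC (m - l) (resolvent D A l u)"
    using resolvent_eqs(3,5)[OF l] u(1) by simp
  finally show ?thesis by (simp add: u_def)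
qed

text \<open>By the resolvent identity the difference quotient is
  \<open>- \<phi> (resolvent D A l y)\<close> with \<open>y = resolvent D A m x\<close>. Its limit
  needs only continuity of the resolvent in \<open>l\<close>, which the identity and the bound on
  \<open>U\<close> provide.\<close>

lemma holomorphic_functional_resolvent:
  fixes D :: "'a::complex_banach set"
  assumes U: "U \<subseteq> resolvent_set D A"
    and M: "\<And>l y. l \<in> U \<Longrightarrow> norm (resolvent D A l y) \<le> M / norm (l - c) * norm y" and c: "c \<notin> U"
    and \<phi>: "bounded_linear \<phi>" "\<And>a y. \<phi> (scaleC a y) = a * \<phi> y"
  shows "(\<lambda>l. \<phi> (resolvent D A l x)) holomorphic_on U"
  unfolding holomorphic_on_def field_differentiable_def
proof
  fix m assume m: "m \<in> U"
  interpret \<phi>: bounded_linear \<phi> by fact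
  define y where "y = resolvent D A m x"
  have rl: "l \<in> U \<Longrightarrow> bounded_linear (resolvent D A l)" for l using U resolvent_eqs(4) by blast
  have "((\<lambda>l. resolvent D A l y - resolvent D A m y) \<longlongrightarrow> 0) (at m within U)"
  proof (rule Lim_null_comparison)
    show "eventually (\<lambda>l. norm (resolvent D A l y - resolvent D A m y) \<le>
        norm (m - l) * (M / norm (l - c) * norm (resolvent D A m y))) (at m within U)"
      unfolding eventually_at_filter
    proof (intro always_eventually allI impI)
      fix l assume l: "l \<in> U"
      show "norm (resolvent D A l y - resolvent D A m y) \<le> norm (m - l) * (M / norm (l - c) * norm (resolvent D A m y))"
        unfolding resolvent_identity[OF subsetD[OF U l] subsetD[OF U m]] norm_scaleC
        by (intro mult_left_mono M l) auto
    qed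
    have "((\<lambda>l. norm (m - l) * (M / norm (l - c) * norm (resolvent D A m y))) \<longlongrightarrow>
        norm (m - m) * (M / norm (m - c) * norm (resolvent D A m y))) (at m within U)"
      using c m by (intro tendsto_intros) auto
    thus "((\<lambda>l. norm (m - l) * (M / norm (l - c) * norm (resolvent D A m y))) \<longlongrightarrow> 0) (at m within U)" by simp
  qed
  hence "((\<lambda>l. resolvent D A l y) \<longlongrightarrow> resolvent D A m y) (at m within U)" by (rule LIM_zero_cancel)
  hence lim: "((\<lambda>l. - \<phi> (resolvent D A l y)) \<longlongrightarrow> - \<phi> (resolvent D A m y)) (at m within U)"
    by (intro tendsto_minus \<phi>.tendsto)
  have "((\<lambda>l. \<phi> (resolvent D A l x)) has_field_derivative - \<phi> (resolvent D A m y)) (at m within U)"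
    unfolding has_field_derivative_iff
  proof (rule Lim_transform_eventually[OF lim])
    show "eventually (\<lambda>l. - \<phi> (resolvent D A l y) = (\<phi> (resolvent D A l x) - \<phi> (resolvent D A m x)) / (l - m)) (at m within U)"
      unfolding eventually_at_filter
    proof (intro always_eventually allI impI)
      fix l assume l: "l \<noteq> m" "l \<in> U"
      have "\<phi> (resolvent D A l x) - \<phi> (resolvent D A m x) = \<phi> (resolvent D A l x - resolvent D A m x)"
        by (simp add: \<phi>.diff)
      also have "\<dots> = (m - l) * \<phi> (resolvent D A l y)"
        unfolding resolvent_identity[OF subsetD[OF U l(2)] subsetD[OF U m]] y_def by (rule \<phi>(2))
      finally have "\<phi> (resolvent D A l x) - \<phi> (resolvent D A m x) = (m - l) * \<phi> (resolvent D A l y)" .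
      thus "- \<phi> (resolvent D A l y) = (\<phi> (resolvent D A l x) - \<phi> (resolvent D A m x)) / (l - m)"
        using l(1) by (simp add: field_simps)
    qed
  qed
  thus "\<exists>f'. ((\<lambda>l. \<phi> (resolvent D A l x)) has_field_derivative f') (at m within U)" by blast
qed

text \<open>The angle must exceed \<open>pi / 2\<close> to gain decay on the tilted rays,
  \<open>(\<mu> + 1) * \<theta>\<close> must stay inside the sector of \<open>A\<close>, and
  \<open>- cos \<theta> / sin \<theta> \<le> 1\<close> is the condition \<open>k \<le> 1\<close> of
  the contour estimates.\<close>

lemma sector_angle:
  fixes \<mu> \<mu>' :: real
  assumes \<mu>: "0 < \<mu>" "\<mu> < \<mu>'" "\<mu>' \<le> 1"
  obtains \<theta> where "0 < \<theta>" "\<theta> < pi" "(\<mu> + 1) * \<theta> < pi" "(\<mu> + 1) * \<theta> < \<mu>' * pi / 2 + pi / 2"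
    "0 < - cos \<theta> / sin \<theta>" "- cos \<theta> / sin \<theta> \<le> 1"
proof -
  \<comment> \<open>Chosen so that \<open>(\<mu> + 1) * \<theta>\<close> is midway between
    \<open>(\<mu> + 1) * pi / 2\<close> and \<open>(\<mu>' + 1) * pi / 2\<close>;
    \<open>e \<le> 1 / 2\<close> keeps \<open>\<theta>\<close> at most
    \<open>3 * pi / 4\<close>.\<close>
  define e where "e = (\<mu>' - \<mu>) / (2 * (\<mu> + 1))"
  have e: "0 < e" "e \<le> 1 / 2" "e * (\<mu> + 1) = (\<mu>' - \<mu>) / 2" using \<mu> by (auto simp: e_def field_simps)
  define \<theta> where "\<theta> = pi / 2 * (1 + e)"
  have t1: "pi / 2 < \<theta>" using e by (simp add: \<theta>_def field_simps)
  have t2: "\<theta> \<le> 3 * pi / 4" using mult_left_mono[of "1 + e" "3 / 2" "pi / 2"] e by (simp add: \<theta>_def)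
  have "(\<mu> + 1) * \<theta> = pi / 2 * (\<mu> + 1 + e * (\<mu> + 1))" by (simp add: \<theta>_def algebra_simps)
  also have "\<dots> = pi / 2 * (1 + (\<mu> + \<mu>') / 2)" unfolding e(3) by (simp add: field_simps)
  also have "\<dots> < pi / 2 * (1 + \<mu>')" using \<mu> by (intro mult_strict_left_mono) auto
  finally have m: "(\<mu> + 1) * \<theta> < pi / 2 * (1 + \<mu>')" .
  have "pi / 2 * (1 + \<mu>') \<le> pi / 2 * 2" using \<mu> by (intro mult_left_mono) auto
  hence m2: "(\<mu> + 1) * \<theta> < pi" using m by linarith
  have pi: "pi > 0" by simp
  have sin: "sin \<theta> > 0" using t1 t2 pi by (intro sin_gt_zero) linarith+
  have c: "- cos \<theta> = sin (\<theta> - pi / 2)" by (simp add: sin_diff)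
  have s: "sin \<theta> = sin (pi - \<theta>)" by simp
  have "- cos \<theta> > 0" unfolding c using t1 t2 pi by (intro sin_gt_zero) linarith+
  moreover have "- cos \<theta> \<le> sin \<theta>" unfolding c s
    using t1 t2 pi by (intro sin_monotone_2pi_le) linarith+
  ultimately have "0 < - cos \<theta> / sin \<theta>" "- cos \<theta> / sin \<theta> \<le> 1" using sin by (auto simp: divide_simps)
  moreover have "0 < \<theta>" "\<theta> < pi" using t1 t2 pi by linarith+
  ultimately show thesis using m m2 by (intro that[of \<theta>]) (auto simp: algebra_simps add_divide_distrib)
qed

text \<open>The parameter \<open>r\<close> covers both cases. Its last two conditions are the signs
  of the constant terms of \<open>Q\<close> and \<open>N\<close>, which keep both in their
  sectors.\<close>

lemma resolvent_family_bound:
  fixes D :: "'a::complex_banach set" and A :: "'a \<Rightarrow> 'a" and S :: "real \<Rightarrow> 'a \<Rightarrow> 'a"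
    and \<alpha> \<beta> \<mu> \<mu>' \<omega> r :: real
  assumes \<beta>: "\<beta> \<ge> 0" and \<mu>: "0 < \<mu>" "\<mu> < \<mu>'" "\<mu>' \<le> 1" and \<beta>\<omega>: "\<beta> + \<omega> \<le> 0"
    and dense: "densely_defined D" and fam: "resolvent_family \<alpha> \<beta> \<mu> D A S"
    and sect: "omega_sectorial D A \<omega> (\<mu>' * pi / 2)"
    and r: "r \<ge> 0" "r powr \<mu> + \<alpha> > 0" "r powr (\<mu> + 1) - \<omega> * \<alpha> \<ge> 0"
  shows "\<exists>C>0. \<forall>t\<ge>0. onorm (S t) \<le> C * exp (- (\<beta> - r) * t)"
proof -
  have \<mu>1: "\<mu> \<le> 1" using \<mu> by simp
  obtain \<theta> where \<theta>: "0 < \<theta>" "\<theta> < pi" "(\<mu> + 1) * \<theta> < pi" "(\<mu> + 1) * \<theta> < \<mu>' * pi / 2 + pi / 2"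
    and k: "0 < - cos \<theta> / sin \<theta>" "- cos \<theta> / sin \<theta> \<le> 1"
    using sector_angle[OF \<mu>] by blast
  define W where "W = wedge (- cos \<theta> / sin \<theta>)"
  define \<Omega> where "\<Omega> = shifted_sector \<omega> (\<mu>' * pi / 2)"
  have \<Omega>: "\<Omega> \<subseteq> resolvent_set D A" using sect by (simp add: omega_sectorial_def \<Omega>_def)
  have c\<Omega>: "complex_of_real \<omega> \<notin> \<Omega>" by (auto simp: \<Omega>_def shifted_sector_def)
  obtain M where M: "M > 0" "\<And>l. l \<in> \<Omega> \<Longrightarrow> onorm (resolvent D A l) \<le> M / norm (l - of_real \<omega>)"
    using sect c\<Omega> unfolding omega_sectorial_def \<Omega>_def by (metis Diff_iff singletonD)
  have R: "norm (resolvent D A l y) \<le> M / norm (l - of_real \<omega>) * norm y" if l: "l \<in> \<Omega>" for l y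
  proof -
    have "norm (resolvent D A l y) \<le> onorm (resolvent D A l) * norm y"
      by (rule onorm[OF resolvent_eqs(4)]) (use \<Omega> l in auto)
    also have "\<dots> \<le> M / norm (l - of_real \<omega>) * norm y" by (intro mult_right_mono M(2) l) auto
    finally show ?thesis .
  qed
  define z where "z s = of_real r + s" for s :: complex
  define N where "N s = (z s powr of_real (\<mu> + 1) - of_real r powr of_real (\<mu> + 1)) + of_real (- (\<beta> + \<omega>)) * z s powr of_real \<mu>
      + of_real (r powr (\<mu> + 1) - \<omega> * \<alpha>)" for s
  define Q where "Q s = (z s powr of_real \<mu> - of_real r powr of_real \<mu>) + of_real (r powr \<mu> + \<alpha>)" for s
  define K where "K = cos ((\<mu> + 1) * \<theta> / 2) * cos (\<theta> / 2) powr \<mu>"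
  have "(\<mu> + 1) * \<theta> > 0" using \<mu> \<theta> by simp
  hence "cos ((\<mu> + 1) * \<theta> / 2) > 0" "cos (\<theta> / 2) > 0" using \<theta> by (auto intro!: cos_gt_zero_pi)
  hence K0: "K > 0" by (simp add: K_def)
  have est: "z s \<notin> \<real>\<^sub>\<le>\<^sub>0" "Q s \<noteq> 0" "N s \<noteq> 0" "norm (z s powr of_real \<mu>) / norm (N s) \<le> 1 / (K * norm s)"
     "\<bar>Arg (N s / Q s)\<bar> \<le> (\<mu> + 1) * \<theta>" if "s \<in> W" for s
    using symbol_estimates[OF r(1) _ r(3,2) that[unfolded W_def] \<theta>(1,2) \<mu>(1) \<mu>1 \<theta>(3), of "- (\<beta> + \<omega>)"] \<beta>\<omega>
    unfolding z_def N_def Q_def K_def by auto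
  have cr: "complex_of_real r powr of_real q = of_real (r powr q)" for q using r by (simp add: powr_of_real)
  have Q: "Q s = z s powr of_real \<mu> + of_real \<alpha>" for s unfolding Q_def cr by simp
  define g where "g s = of_real \<omega> + N s / Q s" for s
  have g\<Omega>: "g s \<in> \<Omega>" if "s \<in> W" for s
    using est[OF that] \<theta>(4) unfolding \<Omega>_def shifted_sector_def g_def by auto
  have gw: "g s - of_real \<omega> = N s / Q s" for s by (simp add: g_def)
  have geq: "g s = (z s - of_real \<beta>) * z s powr of_real \<mu> / Q s" if "s \<in> W" for s
  proof -
    have z0: "z s \<noteq> 0" using est(1)[OF that] by auto
    have "z s powr of_real (\<mu> + 1) = z s * z s powr of_real \<mu>"
      using z0 by (simp add: powr_add)
    hence "N s = z s * z s powr of_real \<mu> - of_real (\<beta> + \<omega>) * z s powr of_real \<mu> - of_real (\<omega> * \<alpha>)"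
      unfolding N_def cr by (simp add: algebra_simps)
    hence "of_real \<omega> * Q s + N s = (z s - of_real \<beta>) * z s powr of_real \<mu>"
      unfolding Q by (simp add: algebra_simps)
    thus ?thesis using est(2)[OF that] by (simp add: g_def field_simps)
  qed
  have W0: "s \<noteq> 0" if "s \<in> W" for s using that wedge_nonzero by (auto simp: W_def)
  define C0 where "C0 = 12 * exp 3 / (- cos \<theta> / sin \<theta>) * (2 * M / K)"
  have C0: "C0 > 0" unfolding C0_def by (intro mult_pos_pos divide_pos_pos k(1) M(1) K0) auto
  have cblS: "bounded_linear (S t)" if "t \<ge> 0" for t
    using fam that by (auto simp: resolvent_family_def cbl_def)
  have contS: "continuous_on {0..} (\<lambda>t. S t x)" for x using fam by (auto simp: resolvent_family_def)
  have DS: "S t x \<in> D" "S t (A x) = A (S t x)" if "t \<ge> 0" "x \<in> D" for t x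
    using fam that by (auto simp: resolvent_family_def)
  have main: "norm (\<phi> (S t x)) \<le> C0 * norm x * exp (- (\<beta> - r) * t)"
    if t: "t > 0" and x: "x \<in> D" and \<phi>: "bounded_linear \<phi>" "\<And>a y. \<phi> (scaleC a y) = a * \<phi> y" "\<And>y. norm (\<phi> y) \<le> 2 * norm y"
    for t x and \<phi> :: "'a \<Rightarrow> complex"
  proof -
    interpret \<phi>: bounded_linear \<phi> by fact
    \<comment> \<open>The exponential weight moves the vertex to the origin: in the variable
      \<open>s\<close> the original spectral parameter is \<open>s + r - \<beta>\<close>, and
      \<open>z s = s + r\<close>.\<close>
    define f where "f u = exp (of_real ((\<beta> - r) * u)) * \<phi> (S u x)" for u
    define h where "h s = z s powr of_real \<mu> / Q s * \<phi> (resolvent D A (g s) x)" for s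
    \<comment> \<open>The factor \<open>norm (Q s)\<close> cancels the denominator of
      \<open>h\<close>, so no lower bound for \<open>Q\<close> is required beyond
      \<open>Q s \<noteq> 0\<close>.\<close>
    have \<phi>R: "norm (\<phi> (resolvent D A (g s) y)) \<le> 2 * (M * norm (Q s) / norm (N s) * norm y)" if "s \<in> W" for s y
    proof -
      have "norm (resolvent D A (g s) y) \<le> M / norm (g s - of_real \<omega>) * norm y" by (rule R[OF g\<Omega>[OF that]])
      also have "M / norm (g s - of_real \<omega>) = M * norm (Q s) / norm (N s)"
        unfolding gw by (simp add: norm_divide)
      finally show ?thesis using \<phi>(3)[of "resolvent D A (g s) y"] by linarith
    qed
    have "norm (f t) \<le> 12 * exp 3 / (- cos \<theta> / sin \<theta>) * (2 * M / K * norm x)"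
    proof (rule Laplace_inversion_bound[OF _ k _ _ _ t])
      show "continuous_on {0..} f" unfolding f_def
        by (intro continuous_intros \<phi>.continuous_on contS)
      have hz: "(\<lambda>s. z s powr of_real q) holomorphic_on W" for q
        unfolding z_def using est(1) by (intro holomorphic_intros) (auto simp: z_def)
      have "g holomorphic_on W"
        unfolding g_def N_def Q_def using est(2) by (intro holomorphic_intros hz) (auto simp: Q_def)
      hence "((\<lambda>l. \<phi> (resolvent D A l x)) \<circ> g) holomorphic_on W"
        using g\<Omega> by (intro holomorphic_on_compose_gen[OF _ holomorphic_functional_resolvent[OF \<Omega> R c\<Omega> \<phi>(1,2)]]) auto
      hence "h holomorphic_on W" unfolding h_def Q_def o_def
        using est(2) by (intro holomorphic_intros hz) (auto simp: Q_def)
      thus "h holomorphic_on wedge (- cos \<theta> / sin \<theta>)" by (simp add: W_def)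
    next
      fix s assume "s \<in> wedge (- cos \<theta> / sin \<theta>)"
      hence s: "s \<in> W" by (simp add: W_def)
      have "norm (h s) \<le> norm (z s powr of_real \<mu>) / norm (Q s) * (2 * (M * norm (Q s) / norm (N s) * norm x))"
        unfolding h_def norm_mult norm_divide by (intro mult_left_mono \<phi>R s) auto
      also have "\<dots> = (norm (z s powr of_real \<mu>) / norm (N s)) * (2 * M * norm x)"
        using est(2)[OF s] by simp
      also have "\<dots> \<le> (1 / (K * norm s)) * (2 * M * norm x)"
        using M by (intro mult_right_mono est(4) s) auto
      finally show "norm (h s) \<le> 2 * M / K * norm x / norm s" by (simp add: mult_ac)
    next
      fix \<tau> :: real assume \<tau>: "\<tau> > 0"
      define Mk where "Mk = 1 + \<bar>\<alpha>\<bar> / (Gamma \<mu> * \<mu>)"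
      have Mk: "Mk > 0" using \<mu> by (auto simp: Mk_def intro!: add_pos_nonneg divide_nonneg_pos mult_pos_pos Gamma_real_pos)
      have cont\<tau>: "continuous_on {0..\<tau>} (\<lambda>t. S t y)" for y
        by (rule continuous_on_subset[OF contS]) auto
      have "bounded ((\<lambda>v. S v (A x)) ` {0..\<tau>})"
        by (intro compact_imp_bounded compact_continuous_image cont\<tau> compact_Icc)
      then obtain Y where Y: "\<And>v. v \<in> {0..\<tau>} \<Longrightarrow> norm (S v (A x)) \<le> Y"
        unfolding bounded_iff by blast
      have Y0: "Y \<ge> 0" using order_trans[OF norm_ge_zero Y[of 0]] \<tau> by simp
      \<comment> \<open>This constant may depend on \<open>x\<close> and \<open>\<tau>\<close>: it
        disappears in the limit of Post's formula and does not affect \<open>C0\<close>.\<close>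
      define B where "B = 2 * (M / K) * (1 + \<bar>\<beta> - r\<bar>) * (norm x + \<tau> * Y * Mk) * exp (\<tau> * (1 + \<beta> - r))"
      show "\<exists>B s0. \<forall>s. Re s \<ge> s0 \<longrightarrow>
        norm (integral {0..\<tau>} (\<lambda>u. exp (- s * of_real u) * f u) - h s) \<le> B * exp (- \<tau> * Re s)"
      \<comment> \<open>The threshold guarantees \<open>norm s \<ge> 1\<close> and
        \<open>Re l \<ge> 2\<close>, so that \<open>1 / (Re l - 1) \<le> 1\<close> in the kernel
        estimate.\<close>
      proof (rule exI[of _ B], rule exI[of _ "max 1 (2 + \<beta> - r)"], intro allI impI)
        fix s assume "Re s \<ge> max 1 (2 + \<beta> - r)"
        hence s1: "Re s \<ge> 1" and s2: "Re s \<ge> 2 + \<beta> - r" by auto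
        have s: "s \<in> W" using subsetD[OF half_plane_subset_wedge[OF less_imp_le[OF k(1)]], of s] s1 by (simp add: W_def)
        have ns: "norm s \<ge> 1" using s1 complex_Re_le_cmod[of s] by linarith
        define l where "l = z s - of_real \<beta>"
        have l: "Re l \<ge> 2" "l = s - of_real (\<beta> - r)" using s2 by (auto simp: l_def z_def)
        have l0: "l \<noteq> 0" using l(1) by auto
        have lz: "l + of_real \<beta> = z s" by (simp add: l_def)
        define \<psi> where "\<psi> y = \<phi> (resolvent D A (g s) y)" for y
        have gs: "g s \<in> resolvent_set D A" using g\<Omega>[OF s] \<Omega> by auto
        have \<psi>bl: "bounded_linear \<psi>"
          unfolding \<psi>_def by (rule bounded_linear_compose[OF \<phi>(1) resolvent_eqs(4)[OF gs]])
        interpret \<psi>: bounded_linear \<psi> by fact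
        define c where "c = 2 * (M * norm (Q s) / norm (N s))"
        have \<psi>n: "norm (\<psi> y) \<le> c * norm y" for y using \<phi>R[OF s, of y] by (simp add: \<psi>_def c_def)
        have c0: "c \<ge> 0" using M by (simp add: c_def)
        have z0: "z s \<noteq> 0" using est(1)[OF s] by auto
        have zp0: "z s powr of_real \<mu> \<noteq> 0" using z0 by simp
        have gl: "g s = l * z s powr of_real \<mu> / Q s" using geq[OF s] by (simp add: l_def)
        \<comment> \<open>Composing with the resolvent at \<open>g s\<close> removes the unbounded
          operator: along the family, \<open>\<psi> (A (S v x))\<close> becomes the expression
          \<open>g * p v - f v\<close> of the scalar Volterra equation.\<close>
        have \<psi>A: "\<psi> (A y) = g s * \<psi> y - \<phi> y" if "y \<in> D" for y
        proof -
          have "\<phi> y = \<psi> (scaleC (g s) y - A y)" unfolding \<psi>_def resolvent_eqs(3)[OF gs that] ..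
          also have "\<dots> = \<psi> (scaleC (g s) y) - \<psi> (A y)" by (rule \<psi>.diff)
          also have "\<psi> (scaleC (g s) y) = g s * \<psi> y" by (simp add: \<psi>_def resolvent_eqs(5)[OF gs] \<phi>(2))
          finally show ?thesis by simp
        qed
        have key: "norm (integral {0..\<tau>} (\<lambda>v. exp (- l * of_real v) * \<phi> (S v x)) - g s / l * \<psi> x)
          \<le> norm (g s) * (norm (\<psi> x) + \<tau> * (c * Y) * Mk) * exp (- (Re l - 1) * \<tau>)"
        proof (rule Volterra_Laplace[where k = "\<lambda>v. 1 + one_conv_kappa \<alpha> \<beta> \<mu> v" and p = "\<lambda>v. \<psi> (S v x)"
              and Ks = "1 / l * (1 + of_real \<alpha> / (l + of_real \<beta>) powr of_real \<mu>)"])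
          show "continuous_on {0..} (\<lambda>v. 1 + one_conv_kappa \<alpha> \<beta> \<mu> v)"
            by (intro continuous_intros one_conv_kappa_continuous \<beta> \<mu>)
          show "continuous_on {0..\<tau>} (\<lambda>v. \<psi> (S v x))" "continuous_on {0..\<tau>} (\<lambda>v. \<phi> (S v x))"
            by (rule \<psi>.continuous_on[OF cont\<tau>], rule \<phi>.continuous_on[OF cont\<tau>])
          show "1 / l * (1 + of_real \<alpha> / (l + of_real \<beta>) powr of_real \<mu>) * g s = 1"
          proof -
            have "1 + of_real \<alpha> / z s powr of_real \<mu> = Q s / z s powr of_real \<mu>"
              using zp0 by (simp add: Q field_simps)
            thus ?thesis unfolding lz gl using l0 zp0 est(2)[OF s] by simp
          qed
          \<comment> \<open>Commutation gives \<open>\<psi> (S v (A x))\<close>, which is bounded on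
            the compact interval. Keeping the factor \<open>c\<close> matters, since only
            \<open>norm (g s) * c\<close> is bounded in \<open>s\<close>.\<close>
          show "norm (g s * \<psi> (S v x) - \<phi> (S v x)) \<le> c * Y" if "v \<in> {0..\<tau>}" for v
          proof -
            have "g s * \<psi> (S v x) - \<phi> (S v x) = \<psi> (S v (A x))"
              using \<psi>A[OF DS(1), of v x] DS(2)[of v x] that x by simp
            thus ?thesis using order_trans[OF \<psi>n mult_left_mono[OF Y[OF that] c0]] by simp
          qed
          show "norm (integral {0..T} (\<lambda>v. exp (- l * of_real v) * of_real (1 + one_conv_kappa \<alpha> \<beta> \<mu> v))
             - 1 / l * (1 + of_real \<alpha> / (l + of_real \<beta>) powr of_real \<mu>)) \<le> Mk * exp (- (Re l - 1) * T)" if T: "T \<ge> 0" for T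
          proof -
            have "Mk / (Re l - 1) \<le> Mk / 1" using l Mk by (intro divide_left_mono) auto
            hence "Mk / (Re l - 1) * exp (- (Re l - 1) * T) \<le> Mk * exp (- (Re l - 1) * T)"
              by (intro mult_right_mono) auto
            thus ?thesis using kernel_Laplace[OF \<beta> \<mu>(1) \<mu>1 _ T, of l \<alpha>] l unfolding Mk_def by linarith
          qed
          show "((\<lambda>v. of_real (1 + one_conv_kappa \<alpha> \<beta> \<mu> (u - v)) * (g s * \<psi> (S v x) - \<phi> (S v x))) has_integral
              (\<psi> (S u x) - \<psi> x)) {0..u}" if u: "u \<in> {0..\<tau>}" for u
          proof -
            have "((\<lambda>v. (1 + one_conv_kappa \<alpha> \<beta> \<mu> (u - v)) *\<^sub>R A (S v x)) has_integral (S u x - x)) {0..u}"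
              using fam u x by (auto simp: resolvent_family_def)
            from has_integral_linear[OF this \<psi>bl]
            have "((\<lambda>v. \<psi> ((1 + one_conv_kappa \<alpha> \<beta> \<mu> (u - v)) *\<^sub>R A (S v x))) has_integral (\<psi> (S u x) - \<psi> x)) {0..u}"
              by (simp add: o_def \<psi>.diff)
            thus ?thesis
              by (rule has_integral_eq[rotated]) (use \<psi>A DS(1) x in \<open>auto simp: \<psi>.scaleR scaleR_conv_of_real\<close>)
          qed
        qed (use \<tau> l in auto)
        have "exp (- l * of_real v) * \<phi> (S v x) = exp (- s * of_real v) * f v" for v
          by (simp add: f_def l(2) exp_add[symmetric] algebra_simps flip: exp_of_real)
        hence 1: "integral {0..\<tau>} (\<lambda>v. exp (- l * of_real v) * \<phi> (S v x)) = integral {0..\<tau>} (\<lambda>u. exp (- s * of_real u) * f u)"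
          by simp
        have 2: "g s / l * \<psi> x = h s" unfolding gl h_def \<psi>_def using l0 by simp
        \<comment> \<open>Although \<open>g s\<close> may grow, the resolvent bound compensates: the
          product is at most \<open>2 * M / K * norm l / norm s\<close>, and \<open>l\<close>
          differs from \<open>s\<close> by a constant.\<close>
        have gc: "norm (g s) * c \<le> 2 * (M / K) * (1 + \<bar>\<beta> - r\<bar>)"
        proof -
          have "norm (g s) * c = norm l * (2 * M) * (norm (z s powr of_real \<mu>) / norm (N s))"
            unfolding gl c_def using est(2)[OF s] by (simp add: norm_mult norm_divide)
          also have "\<dots> \<le> norm l * (2 * M) * (1 / (K * norm s))"
            using M by (intro mult_left_mono est(4) s) auto
          also have "\<dots> = 2 * (M / K) * (norm l / norm s)" by simp
          also have "\<dots> \<le> 2 * (M / K) * (1 + \<bar>\<beta> - r\<bar>)"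
          proof (rule mult_left_mono)
            have "norm l \<le> norm s + \<bar>\<beta> - r\<bar>" unfolding l(2) using norm_triangle_ineq4[of s "of_real (\<beta> - r)"]
              by (simp del: of_real_diff)
            also have "\<dots> \<le> norm s + \<bar>\<beta> - r\<bar> * norm s" using ns mult_left_mono[OF ns, of "\<bar>\<beta> - r\<bar>"] by simp
            finally have "norm l \<le> (1 + \<bar>\<beta> - r\<bar>) * norm s" by (simp add: algebra_simps)
            thus "norm l / norm s \<le> 1 + \<bar>\<beta> - r\<bar>" using ns by (subst pos_divide_le_eq) auto
          qed (use M K0 in auto)
          finally show ?thesis .
        qed
        have "norm (g s) * (norm (\<psi> x) + \<tau> * (c * Y) * Mk) \<le> norm (g s) * (c * norm x + \<tau> * (c * Y) * Mk)"
          using \<psi>n[of x] by (intro mult_left_mono add_right_mono) auto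
        also have "\<dots> = norm (g s) * c * (norm x + \<tau> * Y * Mk)" by (simp add: algebra_simps)
        also have "\<dots> \<le> 2 * (M / K) * (1 + \<bar>\<beta> - r\<bar>) * (norm x + \<tau> * Y * Mk)"
          using \<tau> Y0 Mk by (intro mult_right_mono gc) auto
        finally have "norm (g s) * (norm (\<psi> x) + \<tau> * (c * Y) * Mk) * exp (- (Re l - 1) * \<tau>)
            \<le> 2 * (M / K) * (1 + \<bar>\<beta> - r\<bar>) * (norm x + \<tau> * Y * Mk) * exp (- (Re l - 1) * \<tau>)"
          by (rule mult_right_mono) auto
        also have ex: "exp (- (Re l - 1) * \<tau>) = exp (\<tau> * (1 + \<beta> - r)) * exp (- \<tau> * Re s)"
          by (simp add: l(2) exp_add[symmetric] algebra_simps)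
        also have "2 * (M / K) * (1 + \<bar>\<beta> - r\<bar>) * (norm x + \<tau> * Y * Mk) * (exp (\<tau> * (1 + \<beta> - r)) * exp (- \<tau> * Re s)) = B * exp (- \<tau> * Re s)"
          by (simp add: B_def)
        finally show "norm (integral {0..\<tau>} (\<lambda>u. exp (- s * of_real u) * f u) - h s) \<le> B * exp (- \<tau> * Re s)"
          using key unfolding 1 2 ex by linarith
      qed
    qed
    hence "norm (f t) \<le> C0 * norm x" by (simp add: C0_def)
    moreover have "norm (f t) = exp ((\<beta> - r) * t) * norm (\<phi> (S t x))" by (simp add: f_def norm_mult del: of_real_mult of_real_diff)
    ultimately have "exp (- (\<beta> - r) * t) * (exp ((\<beta> - r) * t) * norm (\<phi> (S t x))) \<le> exp (- (\<beta> - r) * t) * (C0 * norm x)"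
      by (intro mult_left_mono) auto
    also have "exp (- (\<beta> - r) * t) * (exp ((\<beta> - r) * t) * norm (\<phi> (S t x))) = norm (\<phi> (S t x))"
      unfolding mult.assoc[symmetric] exp_add[symmetric] by (simp add: algebra_simps)
    finally show ?thesis by (simp only: mult_ac)
  qed
  \<comment> \<open>The inversion bound concerns \<open>t > 0\<close>; enlarging the constant to
    \<open>C0 + 1\<close> covers \<open>S 0 = id\<close>.\<close>
  have onD: "norm (S t x) \<le> (C0 + 1) * exp (- (\<beta> - r) * t) * norm x" if t: "t \<ge> 0" and x: "x \<in> D" for t x
  proof (cases "t = 0")
    case True
    have "S 0 x = x" using fam by (simp add: resolvent_family_def)
    moreover have "1 * norm x \<le> (C0 + 1) * norm x" using C0 by (intro mult_right_mono) auto
    ultimately show ?thesis using True by simp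
  next
    case False
    with t have t: "t > 0" by simp
    obtain \<phi> :: "'a \<Rightarrow> complex" where \<phi>: "bounded_linear \<phi>" "\<And>c y. \<phi> (scaleC c y) = c * \<phi> y"
      "\<And>y. norm (\<phi> y) \<le> 2 * norm y" "norm (S t x) \<le> norm (\<phi> (S t x))"
      using norming_complex_functional[of "S t x"] by metis
    have "norm (S t x) \<le> C0 * norm x * exp (- (\<beta> - r) * t)"
      using main[OF t x \<phi>(1-3)] \<phi>(4) by linarith
    also have "\<dots> \<le> (C0 + 1) * exp (- (\<beta> - r) * t) * norm x" by (simp add: algebra_simps)
    finally show ?thesis .
  qed
  \<comment> \<open>The Volterra equation is available only on \<open>D\<close>; for fixed
    \<open>t\<close> the estimate holds on a closed set, hence on the closure of
    \<open>D\<close>.\<close>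
  have "onorm (S t) \<le> (C0 + 1) * exp (- (\<beta> - r) * t)" if t: "t \<ge> 0" for t
  proof (rule onorm_bound)
    fix x
    have "closed {x. norm (S t x) \<le> (C0 + 1) * exp (- (\<beta> - r) * t) * norm x}"
      by (intro closed_Collect_le continuous_intros linear_continuous_on cblS t)
    hence "closure D \<subseteq> {x. norm (S t x) \<le> (C0 + 1) * exp (- (\<beta> - r) * t) * norm x}"
      using onD[OF t] by (intro closure_minimal) auto
    thus "norm (S t x) \<le> (C0 + 1) * exp (- (\<beta> - r) * t) * norm x"
      using dense by (auto simp: densely_defined_def)
  qed (use C0 in auto)
  thus ?thesis using C0 by (intro exI[of _ "C0 + 1"]) auto
qed

theorem theorem2p3:
  fixes D :: "'a::complex_banach set" and A :: "'a \<Rightarrow> 'a" and S :: "real \<Rightarrow> 'a \<Rightarrow> 'a"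
    and \<alpha> \<beta> \<mu> \<mu>' \<omega> :: real
  assumes "\<alpha> \<noteq> 0" and "\<beta> \<ge> 0" and "0 < \<mu>" and "\<mu> < \<mu>'" and "\<mu>' \<le> 1" and "\<omega> < 0"
    and "\<beta> + \<omega> \<le> 0"
    and "closed_operator D A" and "densely_defined D"
    and "resolvent_family \<alpha> \<beta> \<mu> D A S"
  shows "(\<alpha> > 0 \<and> omega_sectorial D A \<omega> (\<mu>' * pi / 2) \<longrightarrow>
            (\<exists>C>0. \<forall>t\<ge>0. onorm (S t) \<le> C * exp (- \<beta> * t)))
       \<and> (\<alpha> < 0 \<and> \<alpha> + \<beta> powr \<mu> \<ge> \<bar>\<alpha>\<bar> \<and> omega_sectorial D A \<omega> (\<mu>' * pi / 2) \<longrightarrow>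
            (\<exists>C>0. \<forall>t\<ge>0. onorm (S t) \<le>
               C * (1 + \<alpha> * \<omega> * t powr (\<mu> + 1)) * exp (- (\<beta> - (\<alpha> * \<omega>) powr (1 / (\<mu> + 1))) * t)))"
proof (intro conjI impI; elim conjE)
  assume \<alpha>: "\<alpha> > 0" and sect: "omega_sectorial D A \<omega> (\<mu>' * pi / 2)"
  \<comment> \<open>With \<open>r = 0\<close> the powers of \<open>r\<close> vanish, and the
    conditions on \<open>r\<close> reduce to \<open>\<alpha> > 0\<close> and this
    inequality.\<close>
  have "\<omega> * \<alpha> \<le> 0" using \<alpha> assms by (simp add: mult_nonpos_nonneg)
  thus "\<exists>C>0. \<forall>t\<ge>0. onorm (S t) \<le> C * exp (- \<beta> * t)"
    using resolvent_family_bound[OF assms(2-5,7,9,10) sect, of 0] \<alpha> by simp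
next
  assume \<alpha>: "\<alpha> < 0" and \<beta>: "\<bar>\<alpha>\<bar> \<le> \<alpha> + \<beta> powr \<mu>" and sect: "omega_sectorial D A \<omega> (\<mu>' * pi / 2)"
  define r where "r = (\<alpha> * \<omega>) powr (1 / (\<mu> + 1))"
  have aw: "\<alpha> * \<omega> > 0" using \<alpha> assms by (simp add: mult_neg_neg)
  have r: "r > 0" using aw by (auto simp: r_def)
  have rp: "r powr (\<mu> + 1) = \<alpha> * \<omega>" using aw assms by (simp add: r_def powr_powr)
  \<comment> \<open>Otherwise \<open>r powr \<mu> \<le> - \<alpha> < \<beta> powr \<mu>\<close>,
    hence \<open>r < \<beta> \<le> - \<omega>\<close>, and multiplying the bounds for
    \<open>r powr \<mu>\<close> and \<open>r\<close> makes \<open>r powr (\<mu> + 1)\<close> smaller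
    than \<open>\<alpha> * \<omega>\<close>, contrary to the choice of \<open>r\<close>.\<close>
  have "r powr \<mu> + \<alpha> > 0"
  proof (rule ccontr)
    assume n: "\<not> r powr \<mu> + \<alpha> > 0"
    have "r powr \<mu> < \<beta> powr \<mu>" using n \<alpha> \<beta> by linarith
    hence "r < \<beta>" using assms r powr_less_cancel2[of \<mu> r \<beta>] by (cases "\<beta> = 0") auto
    hence "r < - \<omega>" using assms by linarith
    have "r powr (\<mu> + 1) = r powr \<mu> * r" using r by (simp add: powr_add)
    also have "\<dots> < r powr \<mu> * (- \<omega>)" using \<open>r < - \<omega>\<close> r by (intro mult_strict_left_mono) auto
    also have "\<dots> \<le> (- \<alpha>) * (- \<omega>)" using n assms by (intro mult_right_mono) auto
    finally show False using rp by simp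
  qed
  then obtain C where C: "C > 0" "\<And>t. t \<ge> 0 \<Longrightarrow> onorm (S t) \<le> C * exp (- (\<beta> - r) * t)"
    using resolvent_family_bound[OF assms(2-5,7,9,10) sect, of r] r rp by (auto simp: mult.commute)
  have "onorm (S t) \<le> C * (1 + \<alpha> * \<omega> * t powr (\<mu> + 1)) * exp (- (\<beta> - r) * t)" if "t \<ge> 0" for t
  proof -
    have "C * 1 * exp (- (\<beta> - r) * t) \<le> C * (1 + \<alpha> * \<omega> * t powr (\<mu> + 1)) * exp (- (\<beta> - r) * t)"
      using C(1) aw by (intro mult_right_mono mult_left_mono) auto
    thus ?thesis using C(2)[OF that] by simp
  qed
  thus "\<exists>C>0. \<forall>t\<ge>0. onorm (S t) \<le>
      C * (1 + \<alpha> * \<omega> * t powr (\<mu> + 1)) * exp (- (\<beta> - (\<alpha> * \<omega>) powr (1 / (\<mu> + 1))) * t)"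
    using C(1) unfolding r_def by blast
qed

end
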